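(* Let $M$ be a compact Riemann surface, $E\to M$ a hermitian vector bundle, $k\ge1$, and let $\gamma(t)$, $t\in[0,1]$, be a horizontal geodesic segment in $\mathcal A_k$ with flat endpoints $\gamma(0),\gamma(1)$, such that the connection $\gamma(1/2)$ is irreducible. If the endpoints of $\gamma$ are conjugate, then the hypersymplectic structure on the moduli space of solutions to the harmonic map equations is degenerate at (the class of) $\gamma$, i.e. the solution $(\nabla,\phi)=\big(\gamma(\tfrac12),\tfrac12(\gamma(1)-\gamma(0))\big)$ lies in the degeneracy locus.
   Context: $\mathcal A_k$ is the affine space of unitary connections on $E$ of Sobolev class $L^2_k$, modelled on $\Omega^1_k(\mathfrak u(E))$ with its $L^2$ inner product $\langle A,B\rangle_{L^2}=-\int_M\mathrm{tr}(A\wedge *B)$, where $\mathfrak u(E)$ is the bundle of skew-adjoint endomorphisms. The group $\mathcal G_{k+1}$ of $L^2_{k+1}$ unitary gauge transformations acts by $u.\nabla=\nabla+u^{-1}\mathrm d^\nabla u$ and $u.(\nabla,\phi)=(u.\nabla,u^{-1}\phi u)$; the tangent space to the gauge orbit of $\nabla$ is the image of $\mathrm d^\nabla:L^2_{k+1}(\mathfrak u(E))\to\Omega^1_k(\mathfrak u(E))$. A connection is irreducible if its stabiliser is $\{e^{i\theta}\mathrm{id}_E\}$. Horizontal geodesic segments: straight segments $\gamma(t)=\nabla+(2t-1)\phi$, $t\in[0,1]$, with $\nabla\in\mathcal A_k$, $\phi\in\Omega^1_k(\mathfrak u(E))$ and $(\mathrm d^\nabla)^*\phi=0$ (then $\gamma$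 is orthogonal to the gauge orbits for all $t$). Such a segment with flat endpoints is the same as a solution of the harmonic map equations $F^{\nabla+\phi}=F^{\nabla-\phi}=0$, $(\mathrm d^\nabla)^*\phi=0$. Conjugate endpoints: this refers to geodesics of the quotient $\mathcal A_k/\mathcal G_{k+1}$: there is a non-trivial Jacobi field along the projected geodesic vanishing at both endpoints. Explicitly, there is a smooth one-parameter family $\gamma(s,t)=\nabla(s)+(2t-1)\phi(s)$ of horizontal geodesic segments with $\gamma(0,t)=\gamma(t)$ whose variation field $Y(t)=\frac{\partial}{\partial s}\big|_{s=0}\gamma(s,t)$ is tangent to the gauge orbits at the endpoints, $Y(0)\in\mathrm{im}\,\mathrm d^{\gamma(0)}$ and $Y(1)\in\mathrm{im}\,\mathrm d^{\gamma(1)}$, and is non-trivial in the quotient, i.e. $Y(t)\notin\mathrm{im}\,\mathrm d^{\gamma(t)}$ for some $t$. Degeneracy locus: on $T^*\mathcal A_k\cong\mathcal A_k\times\Omega^1_k(\mathfrak u(E))$ there is the neutral metric $g((A,\phi),(B,\psi))=\langle A,B\rangle_{L^2}-\langle\phi,\psi\rangle_{L^2}$ (part of a flat hypersymplectic structure whose moment map equations for the gauge group are the harmonic map equations). A pair $(\nabla,\phi)$ lies in the degeneracy locus if $V\cap V^{\perp_g}\ne\{0\}$, where $V=\{(\mathrm d^\nabla\xi,[\phi,\xi]):\xi\in L^2_{k+1}(\mathfrak u(E))\}$ is the tangent space to its gauge orbit and $\perp_g$ is the orthogonal complement with respect to $g$. *)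

theory Defs
  imports "HOL-Analysis.Analysis"
begin

section \<open>Riemann surfaces and hermitian vector bundles\<close>

text \<open>Coordinate domains are open subsets of the complex plane, regarded as a real surface; the
  partial derivatives along \<^term>\<open>1\<close> and \<^term>\<open>\<i>\<close> are those with respect to \<open>x\<close> and \<open>y\<close>
  in \<open>z = x + \<i> y\<close>. For open \<open>S\<close> the following is the usual notion of a \<open>C\<^sup>n\<close> function on \<open>S\<close>.\<close>

primrec Ck_on :: "nat \<Rightarrow> complex set \<Rightarrow> (complex \<Rightarrow> 'b::real_normed_vector) \<Rightarrow> bool" where
  "Ck_on 0 S f \<longleftrightarrow> continuous_on S f"
| "Ck_on (Suc n) S f \<longleftrightarrow>
     (\<forall>z\<in>S. f differentiable (at z)) \<and>
     Ck_on n S (\<lambda>z. frechet_derivative f (at z) 1) \<and>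
     Ck_on n S (\<lambda>z. frechet_derivative f (at z) \<i>)"

definition smooth_on :: "complex set \<Rightarrow> (complex \<Rightarrow> 'b::real_normed_vector) \<Rightarrow> bool" where
  "smooth_on S f \<longleftrightarrow> (\<forall>n. Ck_on n S f)"

type_synonym 'm chart = "'m set \<times> ('m \<Rightarrow> complex)"

definition compact_riemann_surface :: "'m::t2_space chart set \<Rightarrow> bool" where
  "compact_riemann_surface A \<longleftrightarrow>
     compact (UNIV :: 'm set) \<and> connected (UNIV :: 'm set) \<and>
     (\<Union>(U, z)\<in>A. U) = UNIV \<and>
     (\<forall>(U, z)\<in>A. open U \<and> open (z ` U) \<and> homeomorphism U (z ` U) z (inv_into U z)) \<and>
     (\<forall>(U, z)\<in>A. \<forall>(V, w)\<in>A. (w \<circ> inv_into U z) holomorphic_on z ` (U \<inter> V))"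

text \<open>A bundle over the type \<open>'m\<close> with total space the type \<open>'e\<close> and fibre rank \<open>CARD('r)\<close>:
  projection, fibrewise vector space operations, hermitian metric, and the local unitary
  frames \<open>(V, e)\<close>, where \<open>e x\<close> maps coordinate vectors isometrically onto the fibre over
  \<open>x \<in> V\<close>.  The values of the fibrewise operations on vectors of different fibres are irrelevant.\<close>

type_synonym ('m, 'e, 'r) frame = "'m set \<times> ('m \<Rightarrow> complex ^ 'r \<Rightarrow> 'e)"

record ('m, 'e, 'r) herm_bundle =
  bproj :: "'e \<Rightarrow> 'm"
  badd :: "'e \<Rightarrow> 'e \<Rightarrow> 'e"
  bscale :: "complex \<Rightarrow> 'e \<Rightarrow> 'e"
  bmetric :: "'e \<Rightarrow> 'e \<Rightarrow> complex"
  bframes :: "('m, 'e, 'r) frame set"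

text \<open>A patch consists of a holomorphic chart of the surface and a local unitary frame; it is used
  on the intersection of the two domains.\<close>

type_synonym ('m, 'e, 'r) patch = "'m chart \<times> ('m, 'e, 'r) frame"

definition patches :: "'m chart set \<Rightarrow> ('m, 'e, 'r) herm_bundle \<Rightarrow> ('m, 'e, 'r) patch set" where
  "patches A E = A \<times> bframes E"

definition pdom :: "('m, 'e, 'r) patch \<Rightarrow> 'm set" where
  "pdom p = fst (fst p) \<inter> fst (snd p)"

definition coord :: "('m, 'e, 'r) patch \<Rightarrow> 'm \<Rightarrow> complex" where
  "coord p = snd (fst p)"

definition point :: "('m, 'e, 'r) patch \<Rightarrow> complex \<Rightarrow> 'm" where
  "point p = inv_into (fst (fst p)) (coord p)"

definition region :: "('m, 'e, 'r) patch \<Rightarrow> complex set" where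
  "region p = coord p ` pdom p"

definition overlap :: "('m, 'e, 'r) patch \<Rightarrow> ('m, 'e, 'r) patch \<Rightarrow> complex set" where
  "overlap p q = coord p ` (pdom p \<inter> pdom q)"

text \<open>The transition matrix takes coordinates in the frame of \<open>q\<close> to coordinates in the frame of
  \<open>p\<close>; as a function of \<open>z\<close> it is expressed in the holomorphic coordinate of \<open>p\<close>.\<close>

definition transition ::
  "('m, 'e, 'r::finite) patch \<Rightarrow> ('m, 'e, 'r) patch \<Rightarrow> complex \<Rightarrow> complex ^ 'r ^ 'r" where
  "transition p q z =
     matrix (\<lambda>v. inv (snd (snd p) (point p z)) (snd (snd q) (point p z) v))"

definition hermitian_vector_bundle ::
  "'m::t2_space chart set \<Rightarrow> ('m, 'e, 'r::finite) herm_bundle \<Rightarrow> bool" where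
  "hermitian_vector_bundle A E \<longleftrightarrow>
     (\<Union>(V, e)\<in>bframes E. V) = UNIV \<and>
     (\<forall>(V, e)\<in>bframes E. open V \<and>
        (\<forall>x\<in>V. bij_betw (e x) UNIV {y. bproj E y = x} \<and>
           (\<forall>v w. e x (v + w) = badd E (e x v) (e x w)) \<and>
           (\<forall>c v. e x (c *s v) = bscale E c (e x v)) \<and>
           (\<forall>v w. bmetric E (e x v) (e x w) = (\<Sum>i\<in>UNIV. v $ i * cnj (w $ i))))) \<and>
     (\<forall>p\<in>patches A E. \<forall>q\<in>patches A E. smooth_on (overlap p q) (transition p q))"


section \<open>Sobolev classes on coordinate domains\<close>

definition L1_loc :: "complex set \<Rightarrow> (complex \<Rightarrow> 'b::euclidean_space) \<Rightarrow> bool" where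
  "L1_loc S u \<longleftrightarrow> set_borel_measurable lebesgue S u \<and>
     (\<forall>K. compact K \<and> K \<subseteq> S \<longrightarrow> set_integrable lebesgue K u)"

definition L2_loc :: "complex set \<Rightarrow> (complex \<Rightarrow> 'b::euclidean_space) \<Rightarrow> bool" where
  "L2_loc S u \<longleftrightarrow> set_borel_measurable lebesgue S u \<and>
     (\<forall>K. compact K \<and> K \<subseteq> S \<longrightarrow> set_integrable lebesgue K (\<lambda>z. (norm (u z))\<^sup>2))"

definition test_function :: "complex set \<Rightarrow> (complex \<Rightarrow> real) \<Rightarrow> bool" where
  "test_function S f \<longleftrightarrow> smooth_on UNIV f \<and> (\<exists>K. compact K \<and> K \<subseteq> S \<and> (\<forall>z. z \<notin> K \<longrightarrow> f z = 0))"

text \<open>\<open>v\<close> is the weak derivative of \<open>u\<close> on \<open>S\<close> in the direction \<open>d\<close>.\<close>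

definition has_weak_deriv ::
  "complex set \<Rightarrow> complex \<Rightarrow> (complex \<Rightarrow> 'b::euclidean_space) \<Rightarrow> (complex \<Rightarrow> 'b) \<Rightarrow> bool" where
  "has_weak_deriv S d u v \<longleftrightarrow> L1_loc S u \<and> L1_loc S v \<and>
     (\<forall>f. test_function S f \<longrightarrow>
        (LINT z:S|lebesgue. frechet_derivative f (at z) d *\<^sub>R u z) =
        - (LINT z:S|lebesgue. f z *\<^sub>R v z))"

text \<open>Weak derivatives are unique up to null sets; everything below depends on the chosen
  representative only up to null sets.\<close>

definition weak_deriv ::
  "complex set \<Rightarrow> complex \<Rightarrow> (complex \<Rightarrow> 'b::euclidean_space) \<Rightarrow> complex \<Rightarrow> 'b" where
  "weak_deriv S d u = (SOME v. has_weak_deriv S d u v)"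

text \<open>Local Sobolev class \<open>L\<^sup>2\<^sub>k\<close>, and the square of the \<open>L\<^sup>2\<^sub>k\<close> norm over a subset \<open>K\<close>
  (each mixed derivative is counted once for every order of differentiation).\<close>

primrec sobolev_loc :: "nat \<Rightarrow> complex set \<Rightarrow> (complex \<Rightarrow> 'b::euclidean_space) \<Rightarrow> bool" where
  "sobolev_loc 0 S u \<longleftrightarrow> L2_loc S u"
| "sobolev_loc (Suc k) S u \<longleftrightarrow> L2_loc S u \<and>
     (\<forall>d\<in>{1, \<i>}. (\<exists>v. has_weak_deriv S d u v) \<and> sobolev_loc k S (weak_deriv S d u))"

primrec sobolev_sq ::
  "nat \<Rightarrow> complex set \<Rightarrow> complex set \<Rightarrow> (complex \<Rightarrow> 'b::euclidean_space) \<Rightarrow> real" where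
  "sobolev_sq 0 S K u = (LINT z:K|lebesgue. (norm (u z))\<^sup>2)"
| "sobolev_sq (Suc k) S K u = (LINT z:K|lebesgue. (norm (u z))\<^sup>2) +
     (\<Sum>d\<in>{1, \<i>}. sobolev_sq k S K (weak_deriv S d u))"


section \<open>Sections, forms and connections\<close>

text \<open>Sections, forms and connections are given by their local expressions in all patches, as
  functions of the coordinate, subject to the transformation laws on overlaps.  The values outside
  \<^term>\<open>region p\<close> are irrelevant, and all objects are considered up to equality almost everywhere.
  One-forms and connection forms \<open>X dx + Y dy\<close> are represented by the pair of their components, and
  two-forms \<open>W dx \<and> dy\<close> by \<open>W\<close>.\<close>

type_synonym ('m, 'e, 'r, 'b) local_family = "('m, 'e, 'r) patch \<Rightarrow> complex \<Rightarrow> 'b"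

type_synonym 'r mat = "complex ^ 'r ^ 'r"

type_synonym ('m, 'e, 'r) endo = "('m, 'e, 'r, 'r mat) local_family"

type_synonym ('m, 'e, 'r) form1 = "('m, 'e, 'r, 'r mat \<times> 'r mat) local_family"

definition aeq ::
  "'m chart set \<Rightarrow> ('m, 'e, 'r) herm_bundle \<Rightarrow> ('m, 'e, 'r, 'b) local_family \<Rightarrow>
   ('m, 'e, 'r, 'b) local_family \<Rightarrow> bool" where
  "aeq A E u v \<longleftrightarrow> (\<forall>p\<in>patches A E. AE z in lebesgue. z \<in> region p \<longrightarrow> u p z = v p z)"

definition adjoint_mat :: "'r mat \<Rightarrow> 'r::finite mat" where
  "adjoint_mat X = (\<chi> i j. cnj (X $ j $ i))"

definition skew_adjoint :: "'r::finite mat \<Rightarrow> bool" where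
  "skew_adjoint X \<longleftrightarrow> adjoint_mat X = - X"

definition unitary_mat :: "'r::finite mat \<Rightarrow> bool" where
  "unitary_mat X \<longleftrightarrow> adjoint_mat X ** X = mat 1 \<and> X ** adjoint_mat X = mat 1"

definition commutator :: "'r mat \<Rightarrow> 'r mat \<Rightarrow> 'r::finite mat" where
  "commutator X Y = X ** Y - Y ** X"

definition conj_by :: "'r mat \<Rightarrow> 'r mat \<Rightarrow> 'r::finite mat" where
  "conj_by g X = g ** X ** matrix_inv g"

text \<open>Components in the coordinate of \<open>p\<close> of a one-form with components \<open>\<phi> q\<close> in the coordinate of
  \<open>q\<close>: if the coordinate change has complex derivative \<open>a + \<i> b\<close>, then \<open>du = a dx - b dy\<close> and
  \<open>dv = b dx + a dy\<close>.\<close>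

definition pull_form ::
  "('m, 'e, 'r) patch \<Rightarrow> ('m, 'e, 'r) patch \<Rightarrow> ('m, 'e, 'r::finite) form1 \<Rightarrow> complex \<Rightarrow>
   'r mat \<times> 'r mat" where
  "pull_form p q \<phi> z =
     (let c = deriv (coord q \<circ> point p) z; (X, Y) = \<phi> q (coord q (point p z))
      in (Re c *\<^sub>R X + Im c *\<^sub>R Y, - Im c *\<^sub>R X + Re c *\<^sub>R Y))"

definition endo_section ::
  "'m chart set \<Rightarrow> ('m, 'e, 'r) herm_bundle \<Rightarrow> ('m, 'e, 'r::finite) endo \<Rightarrow> bool" where
  "endo_section A E u \<longleftrightarrow>
     (\<forall>p\<in>patches A E. \<forall>q\<in>patches A E. AE z in lebesgue. z \<in> overlap p q \<longrightarrow>
        u p z = conj_by (transition p q z) (u q (coord q (point p z))))"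

definition endo_form1 ::
  "'m chart set \<Rightarrow> ('m, 'e, 'r) herm_bundle \<Rightarrow> ('m, 'e, 'r::finite) form1 \<Rightarrow> bool" where
  "endo_form1 A E \<phi> \<longleftrightarrow>
     (\<forall>p\<in>patches A E. \<forall>q\<in>patches A E. AE z in lebesgue. z \<in> overlap p q \<longrightarrow>
        \<phi> p z = map_prod (conj_by (transition p q z)) (conj_by (transition p q z))
                  (pull_form p q \<phi> z))"

text \<open>A connection is \<open>d + N p\<close> in the frame of \<open>p\<close>, which gives the transformation law
  \<open>N p = g (N q) g\<^sup>-\<^sup>1 - (dg) g\<^sup>-\<^sup>1\<close> for the transition matrix \<open>g\<close> from \<open>q\<close> to \<open>p\<close>.\<close>

definition connection_form ::
  "'m chart set \<Rightarrow> ('m, 'e, 'r) herm_bundle \<Rightarrow> ('m, 'e, 'r::finite) form1 \<Rightarrow> bool" where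
  "connection_form A E N \<longleftrightarrow>
     (\<forall>p\<in>patches A E. \<forall>q\<in>patches A E. AE z in lebesgue. z \<in> overlap p q \<longrightarrow>
        (let g = transition p q; dg = frechet_derivative g (at z)
         in N p z = map_prod (conj_by (g z)) (conj_by (g z)) (pull_form p q N z)
              - (dg 1 ** matrix_inv (g z), dg \<i> ** matrix_inv (g z))))"

text \<open>Since the surface is compact, a section is globally of class \<open>L\<^sup>2\<^sub>k\<close> iff its local
  expressions are locally of class \<open>L\<^sup>2\<^sub>k\<close> in all patches.\<close>

definition of_class ::
  "'m chart set \<Rightarrow> ('m, 'e, 'r) herm_bundle \<Rightarrow> nat \<Rightarrow> ('m, 'e, 'r, 'b::euclidean_space) local_family \<Rightarrow>
   bool" where
  "of_class A E k u \<longleftrightarrow> (\<forall>p\<in>patches A E. sobolev_loc k (region p) (u p))"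

text \<open>\<open>L\<^sup>2\<^sub>k(\<uu>(E))\<close>\<close>

definition sections_u ::
  "'m chart set \<Rightarrow> ('m, 'e, 'r) herm_bundle \<Rightarrow> nat \<Rightarrow> ('m, 'e, 'r::finite) endo set" where
  "sections_u A E k = {\<xi>. endo_section A E \<xi> \<and> of_class A E k \<xi> \<and>
     (\<forall>p\<in>patches A E. AE z in lebesgue. z \<in> region p \<longrightarrow> skew_adjoint (\<xi> p z))}"

text \<open>\<open>\<Omega>\<^sup>1\<^sub>k(\<uu>(E))\<close>\<close>

definition forms_u ::
  "'m chart set \<Rightarrow> ('m, 'e, 'r) herm_bundle \<Rightarrow> nat \<Rightarrow> ('m, 'e, 'r::finite) form1 set" where
  "forms_u A E k = {\<phi>. endo_form1 A E \<phi> \<and> of_class A E k \<phi> \<and>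
     (\<forall>p\<in>patches A E. AE z in lebesgue. z \<in> region p \<longrightarrow>
        skew_adjoint (fst (\<phi> p z)) \<and> skew_adjoint (snd (\<phi> p z)))}"

text \<open>\<open>\<A>\<^sub>k\<close>\<close>

definition connections ::
  "'m chart set \<Rightarrow> ('m, 'e, 'r) herm_bundle \<Rightarrow> nat \<Rightarrow> ('m, 'e, 'r::finite) form1 set" where
  "connections A E k = {N. connection_form A E N \<and> of_class A E k N \<and>
     (\<forall>p\<in>patches A E. AE z in lebesgue. z \<in> region p \<longrightarrow>
        skew_adjoint (fst (N p z)) \<and> skew_adjoint (snd (N p z)))}"

text \<open>\<open>\<G>\<^sub>k\<close>\<close>

definition gauge_group ::
  "'m chart set \<Rightarrow> ('m, 'e, 'r) herm_bundle \<Rightarrow> nat \<Rightarrow> ('m, 'e, 'r::finite) endo set" where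
  "gauge_group A E k = {u. endo_section A E u \<and> of_class A E k u \<and>
     (\<forall>p\<in>patches A E. AE z in lebesgue. z \<in> region p \<longrightarrow> unitary_mat (u p z))}"

text \<open>\<open>d\<^sup>\<nabla>\<xi> = d\<xi> + [N, \<xi>]\<close> and \<open>[\<phi>, \<xi>]\<close> for a section \<open>\<xi>\<close> of \<open>End(E)\<close>.\<close>

definition bracket ::
  "('m, 'e, 'r::finite) form1 \<Rightarrow> ('m, 'e, 'r) endo \<Rightarrow> ('m, 'e, 'r) form1" where
  "bracket \<phi> \<xi> = (\<lambda>p z. (commutator (fst (\<phi> p z)) (\<xi> p z), commutator (snd (\<phi> p z)) (\<xi> p z)))"

definition cov_deriv ::
  "('m, 'e, 'r::finite) form1 \<Rightarrow> ('m, 'e, 'r) endo \<Rightarrow> ('m, 'e, 'r) form1" where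
  "cov_deriv N \<xi> = (\<lambda>p z.
     (weak_deriv (region p) 1 (\<xi> p) z, weak_deriv (region p) \<i> (\<xi> p) z) + bracket N \<xi> p z)"

definition curvature :: "('m, 'e, 'r::finite) form1 \<Rightarrow> ('m, 'e, 'r) endo" where
  "curvature N = (\<lambda>p z.
     weak_deriv (region p) 1 (\<lambda>w. snd (N p w)) z - weak_deriv (region p) \<i> (\<lambda>w. fst (N p w)) z
       + commutator (fst (N p z)) (snd (N p z)))"

definition flat :: "'m chart set \<Rightarrow> ('m, 'e, 'r) herm_bundle \<Rightarrow> ('m, 'e, 'r::finite) form1 \<Rightarrow> bool" where
  "flat A E N \<longleftrightarrow> aeq A E (curvature N) (\<lambda>p z. 0)"

text \<open>\<open>u.\<nabla> = \<nabla> + u\<^sup>-\<^sup>1 d\<^sup>\<nabla>u\<close>\<close>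

definition gauge_act ::
  "('m, 'e, 'r::finite) endo \<Rightarrow> ('m, 'e, 'r) form1 \<Rightarrow> ('m, 'e, 'r) form1" where
  "gauge_act u N = (\<lambda>p z. N p z +
     map_prod (\<lambda>X. matrix_inv (u p z) ** X) (\<lambda>X. matrix_inv (u p z) ** X) (cov_deriv N u p z))"

definition irreducible_connection ::
  "'m chart set \<Rightarrow> ('m, 'e, 'r) herm_bundle \<Rightarrow> nat \<Rightarrow> ('m, 'e, 'r::finite) form1 \<Rightarrow> bool" where
  "irreducible_connection A E k N \<longleftrightarrow>
     (\<forall>u\<in>gauge_group A E (Suc k).
        aeq A E (gauge_act u N) N \<longleftrightarrow> (\<exists>\<theta>. aeq A E u (\<lambda>p z. mat (cis \<theta>))))"


section \<open>The \<open>L\<^sup>2\<close> inner product and the neutral metric\<close>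

text \<open>A two-form is integrated over the surface by cutting the surface into finitely many Borel
  pieces, each relatively compact in the domain of a patch.  The value does not depend on the
  decomposition, by the change of variables formula (holomorphic coordinate changes preserve the
  orientation).\<close>

definition decomposition ::
  "'m::topological_space chart set \<Rightarrow> ('m, 'e, 'r) herm_bundle \<Rightarrow> ('m set \<times> ('m, 'e, 'r) patch) set \<Rightarrow>
   bool" where
  "decomposition A E D \<longleftrightarrow> finite D \<and> (\<Union>(B, p)\<in>D. B) = UNIV \<and>
     (\<forall>(B, p)\<in>D. p \<in> patches A E \<and> B \<in> sets borel \<and> closure B \<subseteq> pdom p) \<and>
     (\<forall>x\<in>D. \<forall>y\<in>D. x \<noteq> y \<longrightarrow> fst x \<inter> fst y = {})"

lemma finite_borel_refinement:
  fixes W :: "'p \<Rightarrow> 'm::t2_space set"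
  assumes cpt: "compact (UNIV :: 'm set)" and op: "\<And>p. p \<in> P \<Longrightarrow> open (W p)"
    and cov: "\<And>x. \<exists>p\<in>P. x \<in> W p"
  shows "\<exists>D. finite D \<and> (\<Union>(B, p)\<in>D. B) = UNIV \<and>
     (\<forall>(B, p)\<in>D. p \<in> P \<and> B \<in> sets borel \<and> closure B \<subseteq> W p) \<and>
     (\<forall>x\<in>D. \<forall>y\<in>D. x \<noteq> y \<longrightarrow> fst x \<inter> fst y = {})"
proof -
  have "compact_space (euclidean :: 'm topology)"
    using cpt by (simp add: compact_space_def)
  moreover have "Hausdorff_space (euclidean :: 'm topology)"
    unfolding Hausdorff_space_def disjnt_def by (simp add: separation_t2 open_openin[symmetric])
  ultimately have "regular_space (euclidean :: 'm topology)"
    by (rule compact_Hausdorff_imp_regular_space)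
  then have nb: "neighbourhood_base_of (closedin euclidean) (euclidean :: 'm topology)"
    by (simp only: neighbourhood_base_of_closedin)
  have "\<exists>Up. open (fst Up) \<and> x \<in> fst Up \<and> snd Up \<in> P \<and> closure (fst Up) \<subseteq> W (snd Up)" for x
  proof -
    obtain p where p: "p \<in> P" "x \<in> W p" using cov by blast
    have "openin euclidean (W p) \<and> x \<in> W p" using op[OF p(1)] p(2) by (simp add: open_openin[symmetric])
    then have "\<exists>U V. openin euclidean U \<and> closedin euclidean V \<and> x \<in> U \<and> U \<subseteq> V \<and> V \<subseteq> W p"
      using nb unfolding neighbourhood_base_of by blast
    then obtain U V where UV: "open U" "closed V" "x \<in> U" "U \<subseteq> V" "V \<subseteq> W p"
      unfolding open_openin[symmetric] closed_closedin[symmetric] by blast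
    have "closure U \<subseteq> W p" using closure_minimal[OF UV(4,2)] UV(5) by (rule subset_trans)
    then show ?thesis using UV(1,3) p(1) by (intro exI[of _ "(U, p)"]) simp
  qed
  then have "\<exists>f. \<forall>x. open (fst (f x)) \<and> x \<in> fst (f x) \<and> snd (f x) \<in> P \<and>
      closure (fst (f x)) \<subseteq> W (snd (f x))"
    by (intro choice allI)
  then obtain f where f: "\<And>x. open (fst (f x))" "\<And>x. x \<in> fst (f x)" "\<And>x. snd (f x) \<in> P"
      "\<And>x. closure (fst (f x)) \<subseteq> W (snd (f x))"
    by blast
  obtain F where F: "finite F" "UNIV \<subseteq> (\<Union>x\<in>F. fst (f x))"
    by (rule compactE_image[OF cpt, of UNIV "\<lambda>x. fst (f x)"]) (use f(1,2) in auto)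
  obtain xs where xs: "set xs = F" using finite_list[OF F(1)] by blast
  define B where "B i = fst (f (xs ! i)) - (\<Union>j<i. fst (f (xs ! j)))" for i
  define D where "D = (\<lambda>i. (B i, snd (f (xs ! i)))) ` {..<length xs}"
  have cover: "\<exists>i<length xs. y \<in> B i" for y
  proof -
    define Q where "Q i \<longleftrightarrow> i < length xs \<and> y \<in> fst (f (xs ! i))" for i
    obtain x where "x \<in> set xs" "y \<in> fst (f x)" using F(2) xs by blast
    then have "\<exists>i. Q i" unfolding Q_def in_set_conv_nth by blast
    then have i: "Q (LEAST i. Q i)" by (rule LeastI_ex)
    have "y \<notin> fst (f (xs ! j))" if "j < (LEAST i. Q i)" for j
      using not_less_Least[OF that] that i unfolding Q_def by linarith
    then show ?thesis using i unfolding B_def Q_def by blast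
  qed
  have disj: "B i \<inter> B j = {}" if "i < j" for i j
    using that by (auto simp: B_def)
  have borel: "B i \<in> sets borel" for i
    unfolding B_def by (intro sets.Diff borel_open open_UN ballI f(1))
  have cl: "closure (B i) \<subseteq> W (snd (f (xs ! i)))" for i
    using closure_mono[of "B i" "fst (f (xs ! i))"] f(4)[of "xs ! i"] by (auto simp: B_def)
  show ?thesis
  proof (intro exI[of _ D] conjI)
    show "finite D" by (simp add: D_def)
    show "(\<Union>(B, p)\<in>D. B) = UNIV" using cover by (fastforce simp: D_def)
    show "\<forall>(B, p)\<in>D. p \<in> P \<and> B \<in> sets borel \<and> closure B \<subseteq> W p"
      using borel cl f(3) by (simp add: D_def)
    show "\<forall>x\<in>D. \<forall>y\<in>D. x \<noteq> y \<longrightarrow> fst x \<inter> fst y = {}"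
    proof (intro ballI impI)
      fix x y assume "x \<in> D" "y \<in> D" "x \<noteq> y"
      then obtain i j where "x = (B i, snd (f (xs ! i)))" "y = (B j, snd (f (xs ! j)))" "i \<noteq> j"
        unfolding D_def by blast
      then show "fst x \<inter> fst y = {}" using disj[of i j] disj[of j i] by (cases "i < j") auto
    qed
  qed
qed

lemma decomposition_exists:
  fixes A :: "'m::t2_space chart set" and E :: "('m, 'e, 'r::finite) herm_bundle"
  assumes A: "compact_riemann_surface A" and E: "hermitian_vector_bundle A E"
  shows "\<exists>D. decomposition A E D"
  unfolding decomposition_def
proof (rule finite_borel_refinement)
  note A' = A[unfolded compact_riemann_surface_def]
  note E' = E[unfolded hermitian_vector_bundle_def]
  show "compact (UNIV :: 'm set)" by (rule A'[THEN conjunct1])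
  have opA: "open (fst c)" if "c \<in> A" for c
    using bspec[OF A'[THEN conjunct2, THEN conjunct2, THEN conjunct2, THEN conjunct1] that]
    unfolding split_beta by (rule conjunct1)
  have opE: "open (fst f)" if "f \<in> bframes E" for f
    using bspec[OF E'[THEN conjunct2, THEN conjunct1] that]
    unfolding split_beta by (rule conjunct1)
  show "open (pdom p)" if "p \<in> patches A E" for p
    using that unfolding patches_def pdom_def by (intro open_Int opA opE) auto
  show "\<exists>p\<in>patches A E. x \<in> pdom p" for x
  proof -
    have "x \<in> (\<Union>(U, z)\<in>A. U)" "x \<in> (\<Union>(V, e)\<in>bframes E. V)"
      unfolding A'[THEN conjunct2, THEN conjunct2, THEN conjunct1] E'[THEN conjunct1] by (rule UNIV_I)+
    then obtain U z V e where "(U, z) \<in> A" "x \<in> U" "(V, e) \<in> bframes E" "x \<in> V" by blast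
    then show ?thesis
      by (intro bexI[of _ "((U, z), (V, e))"]) (simp_all add: patches_def pdom_def)
  qed
qed

definition integral_M ::
  "'m::topological_space chart set \<Rightarrow> ('m, 'e, 'r) herm_bundle \<Rightarrow> ('m, 'e, 'r, real) local_family \<Rightarrow>
   real" where
  "integral_M A E \<omega> =
     (\<Sum>(B, p)\<in>(SOME D. decomposition A E D). LINT z:coord p ` B|lebesgue. \<omega> p z)"

text \<open>\<open>- tr(\<phi> \<and> *\<psi>) = - tr(\<phi>\<^sub>x \<psi>\<^sub>x + \<phi>\<^sub>y \<psi>\<^sub>y) dx \<and> dy\<close> in a holomorphic coordinate, because
  \<open>*dx = dy\<close> and \<open>*dy = - dx\<close>; the trace is real for skew-adjoint matrices.\<close>

definition inner_L2 ::
  "'m::topological_space chart set \<Rightarrow> ('m, 'e, 'r) herm_bundle \<Rightarrow> ('m, 'e, 'r::finite) form1 \<Rightarrow>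
   ('m, 'e, 'r) form1 \<Rightarrow> real" where
  "inner_L2 A E \<phi> \<psi> = integral_M A E (\<lambda>p z.
     - Re (trace (fst (\<phi> p z) ** fst (\<psi> p z) + snd (\<phi> p z) ** snd (\<psi> p z))))"

text \<open>\<open>(d\<^sup>\<nabla>)\<^sup>*\<close> is the adjoint of \<open>d\<^sup>\<nabla> : L\<^sup>2\<^sub>k\<^sub>+\<^sub>1(\<uu>(E)) \<rightarrow> \<Omega>\<^sup>1\<^sub>k(\<uu>(E))\<close> with respect to the
  \<open>L\<^sup>2\<close> inner products.  To avoid the choice of an area form, its value is represented by the
  two-form \<open>\<mu> = *((d\<^sup>\<nabla>)\<^sup>*\<phi>)\<close>, for which \<open>\<langle>(d\<^sup>\<nabla>)\<^sup>*\<phi>, \<xi>\<rangle> = - \<integral> tr(\<mu> \<xi>)\<close>.\<close>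

definition has_codifferential ::
  "'m::topological_space chart set \<Rightarrow> ('m, 'e, 'r) herm_bundle \<Rightarrow> nat \<Rightarrow> ('m, 'e, 'r::finite) form1 \<Rightarrow>
   ('m, 'e, 'r) form1 \<Rightarrow> ('m, 'e, 'r) endo \<Rightarrow> bool" where
  "has_codifferential A E k N \<phi> \<mu> \<longleftrightarrow>
     (\<forall>\<xi>\<in>sections_u A E (Suc k).
        inner_L2 A E \<phi> (cov_deriv N \<xi>) = integral_M A E (\<lambda>p z. - Re (trace (\<mu> p z ** \<xi> p z))))"

definition neutral_metric ::
  "'m::topological_space chart set \<Rightarrow> ('m, 'e, 'r) herm_bundle \<Rightarrow>
   ('m, 'e, 'r::finite) form1 \<times> ('m, 'e, 'r) form1 \<Rightarrow>
   ('m, 'e, 'r) form1 \<times> ('m, 'e, 'r) form1 \<Rightarrow> real" where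
  "neutral_metric A E X Y = inner_L2 A E (fst X) (fst Y) - inner_L2 A E (snd X) (snd Y)"

definition orbit_tangent ::
  "'m chart set \<Rightarrow> ('m, 'e, 'r) herm_bundle \<Rightarrow> nat \<Rightarrow> ('m, 'e, 'r::finite) form1 \<Rightarrow>
   ('m, 'e, 'r) form1 set" where
  "orbit_tangent A E k N = {B. \<exists>\<xi>\<in>sections_u A E (Suc k). aeq A E B (cov_deriv N \<xi>)}"

definition orbit_tangent_pair ::
  "'m chart set \<Rightarrow> ('m, 'e, 'r) herm_bundle \<Rightarrow> nat \<Rightarrow> ('m, 'e, 'r::finite) form1 \<Rightarrow>
   ('m, 'e, 'r) form1 \<Rightarrow> (('m, 'e, 'r) form1 \<times> ('m, 'e, 'r) form1) set" where
  "orbit_tangent_pair A E k N \<phi> = {(cov_deriv N \<xi>, bracket \<phi> \<xi>) | \<xi>. \<xi> \<in> sections_u A E (Suc k)}"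

definition degeneracy_locus ::
  "'m::topological_space chart set \<Rightarrow> ('m, 'e, 'r) herm_bundle \<Rightarrow> nat \<Rightarrow>
   (('m, 'e, 'r::finite) form1 \<times> ('m, 'e, 'r) form1) set" where
  "degeneracy_locus A E k = {(N, \<phi>). N \<in> connections A E k \<and> \<phi> \<in> forms_u A E k \<and>
     (\<exists>X\<in>orbit_tangent_pair A E k N \<phi>.
        (\<forall>Y\<in>orbit_tangent_pair A E k N \<phi>. neutral_metric A E X Y = 0) \<and>
        \<not> (aeq A E (fst X) (\<lambda>p z. 0) \<and> aeq A E (snd X) (\<lambda>p z. 0)))}"


section \<open>Horizontal geodesic segments and conjugate endpoints\<close>

definition segment ::
  "('m, 'e, 'r::finite) form1 \<Rightarrow> ('m, 'e, 'r) form1 \<Rightarrow> real \<Rightarrow> ('m, 'e, 'r) form1" where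
  "segment N \<phi> t = (\<lambda>p z. N p z + (2 * t - 1) *\<^sub>R \<phi> p z)"

definition horizontal_pair ::
  "'m::topological_space chart set \<Rightarrow> ('m, 'e, 'r) herm_bundle \<Rightarrow> nat \<Rightarrow> ('m, 'e, 'r::finite) form1 \<Rightarrow>
   ('m, 'e, 'r) form1 \<Rightarrow> bool" where
  "horizontal_pair A E k N \<phi> \<longleftrightarrow>
     N \<in> connections A E k \<and> \<phi> \<in> forms_u A E k \<and> has_codifferential A E k N \<phi> (\<lambda>p z. 0)"

definition horizontal_segment ::
  "'m::topological_space chart set \<Rightarrow> ('m, 'e, 'r) herm_bundle \<Rightarrow> nat \<Rightarrow>
   (real \<Rightarrow> ('m, 'e, 'r::finite) form1) \<Rightarrow> bool" where
  "horizontal_segment A E k \<gamma> \<longleftrightarrow>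
     (\<exists>N \<phi>. horizontal_pair A E k N \<phi> \<and> (\<forall>t\<in>{0..1}. aeq A E (\<gamma> t) (segment N \<phi> t)))"

text \<open>Derivative of a curve \<open>c\<close> in \<open>\<A>\<^sub>k\<close> or in \<open>\<Omega>\<^sup>1\<^sub>k(\<uu>(E))\<close> with respect to the \<open>L\<^sup>2\<^sub>k\<close>
  topology.  By compactness of the surface, this topology is given by the \<open>L\<^sup>2\<^sub>k\<close> seminorms over
  compact subsets of the coordinate domains of the patches.\<close>

definition curve_deriv ::
  "'m chart set \<Rightarrow> ('m, 'e, 'r) herm_bundle \<Rightarrow> nat \<Rightarrow> (real \<Rightarrow> ('m, 'e, 'r::finite) form1) \<Rightarrow>
   ('m, 'e, 'r) form1 \<Rightarrow> real \<Rightarrow> bool" where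
  "curve_deriv A E k c B s \<longleftrightarrow> B \<in> forms_u A E k \<and>
     (\<forall>p\<in>patches A E. \<forall>K. compact K \<and> K \<subseteq> region p \<longrightarrow>
        ((\<lambda>h. sobolev_sq k (region p) K (\<lambda>z. (c (s + h) p z - c s p z) /\<^sub>R h - B p z))
           \<longlongrightarrow> 0) (at 0))"

definition smooth_curve ::
  "'m chart set \<Rightarrow> ('m, 'e, 'r) herm_bundle \<Rightarrow> nat \<Rightarrow> real \<Rightarrow>
   (real \<Rightarrow> ('m, 'e, 'r::finite) form1) \<Rightarrow> bool" where
  "smooth_curve A E k \<epsilon> c \<longleftrightarrow>
     (\<exists>D :: nat \<Rightarrow> real \<Rightarrow> ('m, 'e, 'r) form1. D 0 = c \<and>
        (\<forall>n. \<forall>s\<in>{-\<epsilon><..<\<epsilon>}. curve_deriv A E k (D n) (D (Suc n) s) s))"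

definition conjugate_endpoints ::
  "'m::topological_space chart set \<Rightarrow> ('m, 'e, 'r) herm_bundle \<Rightarrow> nat \<Rightarrow>
   (real \<Rightarrow> ('m, 'e, 'r::finite) form1) \<Rightarrow> bool" where
  "conjugate_endpoints A E k \<gamma> \<longleftrightarrow>
     (\<exists>\<epsilon>>0. \<exists>N \<phi> Y. smooth_curve A E k \<epsilon> N \<and> smooth_curve A E k \<epsilon> \<phi> \<and>
        (\<forall>s\<in>{-\<epsilon><..<\<epsilon>}. horizontal_pair A E k (N s) (\<phi> s)) \<and>
        (\<forall>t\<in>{0..1}. aeq A E (segment (N 0) (\<phi> 0) t) (\<gamma> t)) \<and>
        (\<forall>t\<in>{0..1}. curve_deriv A E k (\<lambda>s. segment (N s) (\<phi> s) t) (Y t) 0) \<and>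
        Y 0 \<in> orbit_tangent A E k (\<gamma> 0) \<and> Y 1 \<in> orbit_tangent A E k (\<gamma> 1) \<and>
        (\<exists>t\<in>{0..1}. Y t \<notin> orbit_tangent A E k (\<gamma> t)))"

end

theory Submission
  imports Defs
begin

text \<open>Write \<open>A = N'(0)\<close> and \<open>\<psi> = \<phi>'(0)\<close> for the variation of the segment \<open>N \<plusminus> \<phi>\<close>.  Tangency
  to the orbits at the endpoints means \<open>A - \<psi> = d\<^sup>N\<^sup>-\<^sup>\<phi> \<xi>\<^sub>0\<close> and \<open>A + \<psi> = d\<^sup>N\<^sup>+\<^sup>\<phi> \<xi>\<^sub>1\<close>.  With
  \<open>\<eta> = (\<xi>\<^sub>0 + \<xi>\<^sub>1)/2\<close> and \<open>\<zeta> = (\<xi>\<^sub>1 - \<xi>\<^sub>0)/2\<close> this says \<open>A = d\<^sup>N\<eta> + [\<phi>, \<zeta>]\<close> and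
  \<open>\<psi> = d\<^sup>N\<zeta> + [\<phi>, \<eta>]\<close>.  Differentiating \<open>\<langle>\<phi>, d\<^sup>N\<xi>\<rangle> = 0\<close> along the variation gives
  \<open>\<langle>\<psi>, d\<^sup>N\<xi>\<rangle> + \<langle>\<phi>, [A, \<xi>]\<rangle> = 0\<close> for all \<open>\<xi>\<close>.  The terms with \<open>\<eta>\<close> add up to
  \<open>\<langle>\<phi>, d\<^sup>N[\<eta>, \<xi>]\<rangle> = 0\<close>, and the remaining ones say that \<open>(d\<^sup>N\<zeta>, [\<phi>, \<zeta>])\<close> is orthogonal to the
  orbit for the neutral metric.  If this vector vanished, the variation would be the gauge direction
  \<open>d\<^sup>\<gamma>\<^sup>(\<^sup>t\<^sup>)\<eta>\<close> for every \<open>t\<close>.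

  The analytic content is that \<open>[\<eta>, \<xi>]\<close> is again of class \<open>L\<^sup>2\<^sub>k\<^sub>+\<^sub>1\<close>, with the Leibniz rule.  On a
  coordinate domain, a weak derivative \<open>v\<close> of \<open>u\<close> in direction \<open>d\<close> is characterised by
  \<open>u(z + hd) = u(z) + \<integral>\<^sub>0\<^sup>h v(z + sd) ds\<close> for small \<open>h\<close> and almost all \<open>z\<close>; the Leibniz rule and the
  two Sobolev inequalities that make \<open>L\<^sup>2\<^sub>m\<close>, \<open>m \<ge> 2\<close>, an algebra follow from this formula by
  Fubini's theorem.\<close>

section \<open>Smooth bump functions\<close>

text \<open>Horizontality is tested only against sections of class \<open>Suc k\<close>, so the
  \<eta>-terms cancel only if [\<eta>, \<xi>] is an admissible test section. The tightest case is k
  = 1, the algebra property of L^2_2 in dimension two. There a product of two L^2_1 functions has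
  weak derivatives that are merely L^1, so the endpoint embedding of W^{1,1} into L^2 is needed,
  together with a Leibniz rule that asks for no bound on the factors. The formula along lines
  provides it: the rule becomes one-dimensional integration by parts, with no approximation by
  smooth functions. The price is bookkeeping of null sets: the exceptional set depends on h, and
  local Lebesgue functions must be replaced by global Borel ones before Fubini's theorem applies.
  Test functions of the form f(x) g(y) suffice, and averaging along a coordinate axis preserves this
  form. The geometric limits need only L^2 convergence, since sections of class \<open>Suc k\<close>
  are locally bounded.\<close>

primrec Cn :: "nat \<Rightarrow> (real \<Rightarrow> real) \<Rightarrow> bool" where
  "Cn 0 f \<longleftrightarrow> continuous_on UNIV f"
| "Cn (Suc n) f \<longleftrightarrow> (\<exists>f'. (\<forall>x. (f has_real_derivative f' x) (at x)) \<and> Cn n f')"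

lemma Cn_SucI: "(\<And>x. (f has_real_derivative f' x) (at x)) \<Longrightarrow> Cn n f' \<Longrightarrow> Cn (Suc n) f"
  by auto

lemma Cn_continuous: "Cn n f \<Longrightarrow> continuous_on UNIV f"
  by (cases n) (auto intro!: continuous_at_imp_continuous_on intro: DERIV_isCont)

lemma Cn_Suc_imp: "Cn (Suc n) f \<Longrightarrow> Cn n f"
proof (induction n arbitrary: f)
  case 0
  then show ?case using Cn_continuous[of "Suc 0"] by (metis Cn.simps(1) One_nat_def)
next
  case (Suc n)
  then show ?case by (metis Cn.simps(2))
qed

lemma Cn_const: "Cn n (\<lambda>x. c)"
  by (induction n arbitrary: c) (auto intro!: exI[of _ "\<lambda>x. 0"])

lemma Cn_add: "Cn n f \<Longrightarrow> Cn n g \<Longrightarrow> Cn n (\<lambda>x. f x + g x)"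
proof (induction n arbitrary: f g)
  case 0
  then show ?case by (auto intro!: continuous_intros)
next
  case (Suc n)
  then obtain f' g' where "\<And>x. (f has_real_derivative f' x) (at x)" "\<And>x. (g has_real_derivative g' x) (at x)"
    "Cn n f'" "Cn n g'" by auto
  then show ?case
    by (intro Cn_SucI[where f' = "\<lambda>x. f' x + g' x"] Suc.IH) (auto intro!: derivative_intros)
qed

lemma Cn_mult: "Cn n f \<Longrightarrow> Cn n g \<Longrightarrow> Cn n (\<lambda>x. f x * g x)"
proof (induction n arbitrary: f g)
  case 0
  then show ?case by (auto intro!: continuous_intros)
next
  case (Suc n)
  note prev = Cn_Suc_imp[OF Suc.prems(1)] Cn_Suc_imp[OF Suc.prems(2)]
  from Suc obtain f' g' where "\<And>x. (f has_real_derivative f' x) (at x)" "\<And>x. (g has_real_derivative g' x) (at x)"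
    "Cn n f'" "Cn n g'" by auto
  then show ?case using prev
    by (intro Cn_SucI[where f' = "\<lambda>x. f x * g' x + f' x * g x"] Cn_add Suc.IH)
       (auto intro!: derivative_eq_intros)
qed

lemma Cn_diff:
  assumes "Cn n f" "Cn n g" shows "Cn n (\<lambda>x. f x - g x)"
  using Cn_add[OF assms(1) Cn_mult[OF Cn_const[of n "-1"] assms(2)]] by simp

lemma Cn_affine: "Cn n f \<Longrightarrow> Cn n (\<lambda>x. f (m * x + c))"
proof (induction n arbitrary: f)
  case 0
  then show ?case by (auto intro!: continuous_on_compose2[of UNIV f] continuous_intros)
next
  case (Suc n)
  then obtain f' where f': "\<And>x. (f has_real_derivative f' x) (at x)" "Cn n f'" by auto
  have "((\<lambda>x. f (m * x + c)) has_real_derivative f' (m * x + c) * m) (at x)" for x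
    by (rule DERIV_chain2[OF f'(1)]) (auto intro!: derivative_eq_intros)
  then show ?case
    using f'(2) by (intro Cn_SucI[where f' = "\<lambda>x. f' (m * x + c) * m"] Cn_mult Cn_const Suc.IH)
qed

text \<open>For \<open>p = 1\<close> this is the classical flat function exp(-1/x), extended by
  zero. The polynomial in 1/x is carried along because the family is then closed under
  differentiation, which gives smoothness by induction on the order.\<close>

definition bump_tail :: "real poly \<Rightarrow> real \<Rightarrow> real" where
  "bump_tail p x = (if x > 0 then poly p (1 / x) * exp (- (1 / x)) else 0)"

lemma poly_exp_tendsto_0: "((\<lambda>y. poly p y * exp (- y)) \<longlongrightarrow> (0::real)) at_top"
proof -
  have "((\<lambda>y. \<Sum>i\<le>degree p. coeff p i * (y ^ i / exp y)) \<longlongrightarrow> (\<Sum>i\<le>degree p. coeff p i * 0)) at_top"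
    by (intro tendsto_sum tendsto_mult tendsto_const tendsto_power_div_exp_0)
  moreover have "poly p y * exp (- y) = (\<Sum>i\<le>degree p. coeff p i * (y ^ i / exp y))" for y
    by (simp add: poly_altdef exp_minus sum_distrib_right divide_inverse mult.assoc)
  ultimately show ?thesis by simp
qed

text \<open>Substituting y = 1/x turns d/dx into - y^2 d/dy, and p(y) exp(-y) has derivative (p' -
  p)(y) exp(-y) in y; the coefficient list \<open>[:0, 0, 1:]\<close> is the factor y^2. At the
  origin the right-hand difference quotient is y p(y) exp(-y), which tends to 0 as y grows.\<close>

lemma bump_tail_deriv:
  "(bump_tail p has_real_derivative bump_tail ([:0, 0, 1:] * (p - pderiv p)) x) (at x)"
proof (cases x "0::real" rule: linorder_cases)
  case less
  have "((\<lambda>_. 0) has_real_derivative 0) (at x)" by simp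
  moreover have "eventually (\<lambda>y. y < 0) (nhds x)" using eventually_nhds_in_open[of "{..<0}" x] less by simp
  ultimately have "(bump_tail p has_real_derivative 0) (at x)"
    by (subst DERIV_cong_ev[OF refl _ refl, of _ "\<lambda>_. 0"]) (auto elim!: eventually_mono simp: bump_tail_def)
  then show ?thesis using less by (simp add: bump_tail_def)
next
  case greater
  have "((\<lambda>x. poly p (1 / x) * exp (- (1 / x))) has_real_derivative
      poly ([:0, 0, 1:] * (p - pderiv p)) (1 / x) * exp (- (1 / x))) (at x)"
    using greater
    by (auto intro!: derivative_eq_intros DERIV_chain2[OF poly_DERIV] simp: field_simps power2_eq_square)
  moreover have "eventually (\<lambda>y. y > 0) (nhds x)" using eventually_nhds_in_open[of "{0<..}" x] greater by simp
  ultimately have "(bump_tail p has_real_derivative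
      poly ([:0, 0, 1:] * (p - pderiv p)) (1 / x) * exp (- (1 / x))) (at x)"
    by (subst DERIV_cong_ev[OF refl _ refl, of _ "\<lambda>x. poly p (1 / x) * exp (- (1 / x))"])
       (auto elim!: eventually_mono simp: bump_tail_def)
  then show ?thesis using greater by (simp add: bump_tail_def)
next
  case equal
  have "((\<lambda>y. bump_tail p y / y) \<longlongrightarrow> 0) (at 0)"
  proof (rule filterlim_split_at_real)
    show "((\<lambda>y. bump_tail p y / y) \<longlongrightarrow> 0) (at_left 0)"
      by (rule tendsto_eventually) (auto simp: eventually_at_filter bump_tail_def)
    have "((\<lambda>x. poly ([:0, 1:] * p) (inverse x) * exp (- inverse x)) \<longlongrightarrow> 0) (at_right 0)"
      by (rule filterlim_compose[OF poly_exp_tendsto_0 filterlim_inverse_at_top_right])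
    then show "((\<lambda>y. bump_tail p y / y) \<longlongrightarrow> 0) (at_right 0)"
      by (rule Lim_transform_eventually)
         (auto simp: eventually_at_filter bump_tail_def field_simps)
  qed
  then show ?thesis using equal
    by (simp add: has_field_derivative_iff bump_tail_def)
qed

lemma Cn_bump_tail: "Cn n (bump_tail p)"
proof (induction n arbitrary: p)
  case 0
  then show ?case using DERIV_isCont[OF bump_tail_deriv] by (auto intro!: continuous_at_imp_continuous_on)
next
  case (Suc n)
  then show ?case by (intro Cn_SucI[OF bump_tail_deriv])
qed

text \<open>Flat functions rising at \<open>a\<close> and falling at \<open>b\<close>, made steeper
  by the factor n + 1, so that the product converges pointwise to the indicator of the open interval
  while its values stay in [0, 1]. The arguments are expanded into the shape m x + c required by
  \<open>Cn_affine\<close>.\<close>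

definition bump :: "real \<Rightarrow> real \<Rightarrow> nat \<Rightarrow> real \<Rightarrow> real" where
  "bump a b n x = bump_tail 1 (real (Suc n) * x + - real (Suc n) * a) *
     bump_tail 1 (- real (Suc n) * x + real (Suc n) * b)"

lemma Cn_bump: "Cn m (bump a b n)"
  unfolding bump_def by (intro Cn_mult Cn_affine[OF Cn_bump_tail])

lemma bump_tail_bounds: "0 \<le> bump_tail 1 x" "bump_tail 1 x \<le> 1"
  by (auto simp: bump_tail_def)

lemma abs_bump_le: "\<bar>bump a b n x\<bar> \<le> 1"
  unfolding bump_def by (simp add: abs_mult bump_tail_bounds mult_le_one)

lemma bump_eq_0: "x \<le> a \<or> b \<le> x \<Longrightarrow> bump a b n x = 0"
proof -
  assume x: "x \<le> a \<or> b \<le> x"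
  have "real (Suc n) * x + - real (Suc n) * a = real (Suc n) * (x - a)"
    "- real (Suc n) * x + real (Suc n) * b = real (Suc n) * (b - x)" by (simp_all add: algebra_simps)
  then show ?thesis using x unfolding bump_def bump_tail_def
    by (auto simp: zero_less_mult_iff simp del: of_nat_Suc)
qed

lemma bump_tail_lim: 
  assumes "x > 0" shows "(\<lambda>n. bump_tail 1 (real (Suc n) * x)) \<longlonglongrightarrow> 1"
proof -
  have "(\<lambda>n. exp (- (1 / (real (Suc n) * x)))) \<longlonglongrightarrow> exp (- (0 * (1 / x)))"
    unfolding divide_divide_eq_left[symmetric] 
    using tendsto_mult[OF LIMSEQ_inverse_real_of_nat tendsto_const[of "1/x"]]
    by (intro tendsto_intros) (simp add: field_simps)
  then show ?thesis using assms by (simp add: bump_tail_def zero_less_mult_iff)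
qed

lemma bump_lim: "(\<lambda>n. bump a b n x) \<longlonglongrightarrow> indicator {a<..<b} x"
proof (cases "a < x \<and> x < b")
  case True
  have eq: "real (Suc n) * x + - real (Suc n) * a = real (Suc n) * (x - a)"
    "- real (Suc n) * x + real (Suc n) * b = real (Suc n) * (b - x)" for n by (simp_all add: algebra_simps)
  show ?thesis using tendsto_mult[OF bump_tail_lim[of "x - a"] bump_tail_lim[of "b - x"]] True
    unfolding bump_def eq by simp
qed (auto simp: bump_eq_0)

section \<open>Product test functions in the plane\<close>

lemma has_derivative_Re_Im_prod:
  assumes "\<And>x. (f has_real_derivative f' x) (at x)" "\<And>x. (g has_real_derivative g' x) (at x)"
  shows "((\<lambda>z. f (Re z) * g (Im z)) has_derivative
      (\<lambda>h. f' (Re z) * Re h * g (Im z) + f (Re z) * (g' (Im z) * Im h))) (at z)"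
proof -
  have "((\<lambda>z. f (Re z)) has_derivative (\<lambda>h. f' (Re z) * Re h)) (at z)"
    by (rule has_derivative_compose[OF _ assms(1)[unfolded has_field_derivative_def]])
       (auto intro!: derivative_eq_intros)
  moreover have "((\<lambda>z. g (Im z)) has_derivative (\<lambda>h. g' (Im z) * Im h)) (at z)"
    by (rule has_derivative_compose[OF _ assms(2)[unfolded has_field_derivative_def]])
       (auto intro!: derivative_eq_intros)
  ultimately show ?thesis by (auto intro!: derivative_eq_intros)
qed

text \<open>Both partial derivatives of a product f(x) g(y) are again products of this kind, so the
  induction on the order runs over all pairs of factors at once.\<close>

lemma Ck_on_prod:
  assumes "Cn n f" "Cn n g"
  shows "Ck_on n UNIV (\<lambda>z. f (Re z) * g (Im z))"
  using assms
proof (induction n arbitrary: f g)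
  case 0
  then show ?case by (auto intro!: continuous_intros continuous_on_compose2[of UNIV f] continuous_on_compose2[of UNIV g])
next
  case (Suc n)
  note prev = Cn_Suc_imp[OF Suc.prems(1)] Cn_Suc_imp[OF Suc.prems(2)]
  from Suc obtain f' g' where f': "\<And>x. (f has_real_derivative f' x) (at x)" "Cn n f'"
    and g': "\<And>x. (g has_real_derivative g' x) (at x)" "Cn n g'" by auto
  note d = has_derivative_Re_Im_prod[OF f'(1) g'(1)]
  show ?case
    using Suc.IH[OF f'(2) prev(2)] Suc.IH[OF prev(1) g'(2)] d
    by (auto simp: frechet_derivative_at[OF d, symmetric] intro!: differentiableI)
qed

lemma smooth_on_prod: "(\<And>n. Cn n f) \<Longrightarrow> (\<And>n. Cn n g) \<Longrightarrow> smooth_on UNIV (\<lambda>z. f (Re z) * g (Im z))"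
  by (simp add: smooth_on_def Ck_on_prod)

lemma frechet_prod:
  assumes "\<And>x. (f has_real_derivative f' x) (at x)" "\<And>x. (g has_real_derivative g' x) (at x)"
  shows "frechet_derivative (\<lambda>z. f (Re z) * g (Im z)) (at z) 1 = f' (Re z) * g (Im z)"
    and "frechet_derivative (\<lambda>z. f (Re z) * g (Im z)) (at z) \<i> = f (Re z) * g' (Im z)"
  using frechet_derivative_at[OF has_derivative_Re_Im_prod[OF assms], of z, symmetric] by simp_all

lemma test_function_prod:
  assumes "\<And>n. Cn n f" "\<And>n. Cn n g" "\<And>x. x \<notin> {a..b} \<Longrightarrow> f x = 0" "\<And>y. y \<notin> {c..d} \<Longrightarrow> g y = 0"
    and sub: "cbox (Complex a c) (Complex b d) \<subseteq> S"
  shows "test_function S (\<lambda>z. f (Re z) * g (Im z))"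
  unfolding test_function_def
proof (intro conjI exI[of _ "cbox (Complex a c) (Complex b d)"] allI impI smooth_on_prod assms)
  fix z assume "z \<notin> cbox (Complex a c) (Complex b d)"
  then have "Re z \<notin> {a..b} \<or> Im z \<notin> {c..d}" by (auto simp: in_cbox_complex_iff)
  then show "f (Re z) * g (Im z) = 0" using assms by auto
qed (use sub in auto)

lemma ex_antiderivative:
  fixes f :: "real \<Rightarrow> real"
  assumes "continuous_on UNIV f"
  shows "\<exists>F. \<forall>x. (F has_real_derivative f x) (at x)"
proof -
  have "isCont f x" for x using assms by (auto simp: continuous_on_eq_continuous_at)
  from einterval_antiderivative[of "-\<infinity>" "\<infinity>" f, OF _ this]
  show ?thesis by (auto simp: has_real_derivative_iff_has_vector_derivative)
qed

section \<open>The fundamental lemma of the calculus of variations\<close>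

text \<open>A Dynkin system argument: boxes form an intersection-stable generator of the Borel sets,
  and the sets over which \<open>g\<close> integrates to zero are closed under complements and
  countable disjoint unions. Closure under complements uses that the total integral vanishes,
  obtained by exhausting the space with growing cubes.\<close>

lemma AE_zero_if_box_integrals_zero:
  fixes g :: "'a::euclidean_space \<Rightarrow> 'b::{second_countable_topology, banach}"
  assumes g: "integrable lborel g"
    and z: "\<And>a b. (LINT z:box a b|lborel. g z) = 0"
  shows "AE z in lborel. g z = 0"
proof (rule sigma_finite_measure.density_zero[OF sigma_finite_lborel g])
  fix X :: "'a set" assume "X \<in> sets lborel"
  then have X: "X \<in> sigma_sets UNIV (range (\<lambda>(a, b). box a b::'a set))"
    by (simp add: borel_eq_box)
  have stable: "Int_stable (range (\<lambda>(a, b). box a b::'a set))"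
    by (auto simp: Int_stable_def box_Int_box)
  have Pow_closed: "range (\<lambda>(a, b). box a b::'a set) \<subseteq> Pow UNIV" by simp
  have si: "set_integrable lborel Y g" if "Y \<in> sets borel" for Y
    using g that by (simp add: set_integrable_def integrable_mult_indicator)
  have total: "(LINT z|lborel. g z) = 0"
  proof -
    let ?A = "\<lambda>n::nat. box (- (real n *\<^sub>R One)) (real n *\<^sub>R One) :: 'a set"
    have "incseq ?A" by (force simp: incseq_def box_def)
    then have "(\<lambda>n. LINT z:?A n|lborel. g z) \<longlonglongrightarrow> (LINT z:(\<Union>i. ?A i)|lborel. g z)"
      using g by (intro set_integral_cont_up) (auto simp: UN_box_eq_UNIV set_integrable_def)
    then have "(LINT z:(\<Union>i. ?A i)|lborel. g z) = 0"
      unfolding z by (simp add: LIMSEQ_const_iff)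
    then show ?thesis unfolding UN_box_eq_UNIV by (simp add: set_lebesgue_integral_def)
  qed
  show "(LINT z:X|lborel. g z) = 0"
    using stable Pow_closed X
  proof (induction rule: sigma_sets_induct_disjoint)
    case (basic A)
    then show ?case using z by auto
  next
    case empty
    then show ?case by (simp add: set_lebesgue_integral_def)
  next
    case (compl A)
    then have A: "A \<in> sets borel" by (simp add: borel_eq_box)
    have "indicator (UNIV - A) z *\<^sub>R g z = g z - indicator A z *\<^sub>R g z" for z
      by (simp add: indicator_def)
    then have "(LINT z:UNIV - A|lborel. g z) = (LINT z|lborel. g z) - (LINT z:A|lborel. g z)"
      using si[OF A] g unfolding set_lebesgue_integral_def set_integrable_def by simp
    then show ?case using compl total by simp
  next
    case (union A)
    then have A: "\<And>i. A i \<in> sets lborel" by (auto simp: borel_eq_box)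
    have "(LINT z:(\<Union>i. A i)|lborel. g z) = (\<Sum>i. (LINT z:A i|lborel. g z))"
      by (rule lebesgue_integral_countable_add)
         (use union A si[of "\<Union>i. A i"] in \<open>auto simp: disjoint_family_on_def\<close>)
    then show ?case using union by simp
  qed
qed

text \<open>Bump products converge boundedly to the indicator of a box, so testing against products
  f(x) g(y) already determines the integrals of \<open>v\<close> over all boxes whose closed version
  lies in V.\<close>

lemma AE_zero_if_test_integrals_zero:
  fixes v :: "complex \<Rightarrow> 'b::euclidean_space"
  assumes v: "integrable lborel v" and V: "open V"
    and test: "\<And>f g a b c d. (\<And>n. Cn n f) \<Longrightarrow> (\<And>n. Cn n g) \<Longrightarrow> (\<And>x. x \<notin> {a..b} \<Longrightarrow> f x = 0) \<Longrightarrow>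
      (\<And>y. y \<notin> {c..d} \<Longrightarrow> g y = 0) \<Longrightarrow> cbox (Complex a c) (Complex b d) \<subseteq> V \<Longrightarrow>
      (LINT z|lborel. (f (Re z) * g (Im z)) *\<^sub>R v z) = 0"
  shows "AE z\<in>V in lborel. v z = 0"
proof -
  have vm [measurable]: "v \<in> borel_measurable borel" using borel_measurable_integrable[OF v] by simp
  have box0: "(LINT z:box p q|lborel. v z) = 0" if "cbox p q \<subseteq> V" for p q
  proof -
    let ?f = "bump (Re p) (Re q)" and ?g = "bump (Im p) (Im q)"
    have meas: "bump a b n \<in> borel_measurable borel" for a b n
      using Cn_continuous[OF Cn_bump] by (rule borel_measurable_continuous_onI)
    have m2: "(\<lambda>z. (?f n (Re z) * ?g n (Im z)) *\<^sub>R v z) \<in> borel_measurable borel" for n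
    proof -
      have "(\<lambda>z. ?f n (Re z)) \<in> borel_measurable borel" "(\<lambda>z. ?g n (Im z)) \<in> borel_measurable borel"
        by (rule measurable_compose[OF _ meas], measurable)+
      then show ?thesis by measurable
    qed
    have "(\<lambda>n. LINT z|lborel. (?f n (Re z) * ?g n (Im z)) *\<^sub>R v z) \<longlonglongrightarrow>
        (LINT z|lborel. (indicator {Re p<..<Re q} (Re z) * indicator {Im p<..<Im q} (Im z)) *\<^sub>R v z)"
    proof (rule integral_dominated_convergence[where w = "\<lambda>z. norm (v z)"])
      show "(\<lambda>z. (indicator {Re p<..<Re q} (Re z) * indicator {Im p<..<Im q} (Im z)) *\<^sub>R v z) \<in> borel_measurable lborel"
        by measurable
      show "AE z in lborel. (\<lambda>n. (?f n (Re z) * ?g n (Im z)) *\<^sub>R v z) \<longlonglongrightarrow>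
          (indicator {Re p<..<Re q} (Re z) * indicator {Im p<..<Im q} (Im z)) *\<^sub>R v z"
        by (intro AE_I2 tendsto_intros bump_lim)
      have le1: "\<bar>?f n (Re z) * ?g n (Im z)\<bar> \<le> 1" for n z
        unfolding abs_mult by (intro mult_le_one abs_bump_le) simp
      show "AE z in lborel. norm ((?f n (Re z) * ?g n (Im z)) *\<^sub>R v z) \<le> norm (v z)" for n
        using mult_right_mono[OF le1[of n] norm_ge_zero[of "v _"]] by (intro AE_I2) simp
      show "integrable lborel (\<lambda>z. norm (v z))" using v by simp
    qed (use m2 in simp)
    moreover have "(LINT z|lborel. (?f n (Re z) * ?g n (Im z)) *\<^sub>R v z) = 0" for n
      by (rule test[of _ _ "Re p" "Re q" "Im p" "Im q"]) (use that in \<open>auto intro!: Cn_bump bump_eq_0\<close>)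
    moreover have "indicator {Re p<..<Re q} (Re z) * indicator {Im p<..<Im q} (Im z) = (indicator (box p q) z :: real)" for z
      by (auto simp: indicator_def in_box_complex_iff)
    ultimately show ?thesis unfolding set_lebesgue_integral_def by (simp add: LIMSEQ_const_iff)
  qed
  have *: "AE z\<in>cbox a b in lborel. v z = 0" if ab: "cbox a b \<subseteq> V" for a b
  proof -
    \<comment> \<open>Cutting \<open>v\<close> off to one box gives a function whose integrals over
      all boxes vanish, because the intersection of two boxes is empty or a box whose closure lies
      in V.\<close>
    have "AE z in lborel. indicator (box a b) z *\<^sub>R v z = 0"
    proof (rule AE_zero_if_box_integrals_zero)
      show "integrable lborel (\<lambda>z. indicator (box a b) z *\<^sub>R v z)"
        by (intro integrable_mult_indicator v) simp
      fix c d
      have "\<exists>e f. box a b \<inter> box c d = box e f" unfolding box_Int_box by blast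
      then obtain e f where ef: "box a b \<inter> box c d = box e f" by blast
      have "(LINT z:box e f|lborel. v z) = 0"
      proof (cases "box e f = {}")
        case False
        then have "cbox e f \<subseteq> cbox a b" 
          using closure_mono[of "box e f" "box a b"] ef closure_box[OF False]
            closure_minimal[OF box_subset_cbox[of a b] closed_cbox] by blast
        then show ?thesis using ab by (intro box0) auto
      qed (simp add: set_lebesgue_integral_def)
      then show "(LINT z:box c d|lborel. indicator (box a b) z *\<^sub>R v z) = 0"
        unfolding ef[symmetric] set_lebesgue_integral_def by (simp add: indicator_inter_arith mult.commute)
    qed
    \<comment> \<open>The countable cover of V used below consists of closed boxes, so the boundary
      has to be added; it is a null set.\<close>
    moreover have "cbox a b - box a b \<in> null_sets lborel"
      using negligible_frontier_interval[of a b]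
      by (auto simp: negligible_iff_null_sets null_sets_def emeasure_completion)
    then have "AE z in lborel. z \<notin> cbox a b - box a b" by (rule AE_not_in)
    ultimately show ?thesis by eventually_elim (auto simp: indicator_def split: if_splits)
  qed
  obtain D where D: "countable D" "D \<subseteq> Pow V" "\<And>X. X \<in> D \<Longrightarrow> \<exists>a b. X = cbox a b" "\<Union>D = V"
    using open_countable_Union_open_cbox[OF V] by metis
  have "AE z in lborel. \<forall>X\<in>D. z \<in> X \<longrightarrow> v z = 0"
    unfolding AE_ball_countable[OF D(1)] 
  proof
    fix X assume "X \<in> D"
    then show "AE z\<in>X in lborel. v z = 0" using *  D(2) D(3)[OF \<open>X \<in> D\<close>] by auto
  qed
  then show ?thesis using D(4) by (auto elim!: eventually_mono)
qed

section \<open>Integration along lines\<close>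

lemma AE_lborel_shift:
  fixes c :: "'a::euclidean_space"
  assumes "AE z in lborel. P z" shows "AE z in lborel. P (z + c)"
proof -
  have "AE z in distr lborel borel ((+) c). P z" using assms by (subst lborel_distr_plus)
  from AE_distrD[OF _ this] show ?thesis by (simp add: add.commute)
qed

lemma integral_lborel_shift:
  fixes c :: "'a::euclidean_space" and f :: "'a \<Rightarrow> 'b::{banach, second_countable_topology}"
  assumes "f \<in> borel_measurable borel"
  shows "(LINT z|lborel. f (z + c)) = (LINT z|lborel. f z)"
  using integral_distr[of "(+) c" lborel borel f] assms by (simp add: lborel_distr_plus add.commute)

lemma integrable_lborel_shift:
  fixes c :: "'a::euclidean_space" and f :: "'a \<Rightarrow> 'b::{banach, second_countable_topology}"
  assumes "integrable lborel f"
  shows "integrable lborel (\<lambda>z. f (z + c))"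
  using integrable_distr_eq[of "(+) c" lborel borel f] borel_measurable_integrable[OF assms] assms
  by (simp add: lborel_distr_plus add.commute)

lemma nn_integral_lborel_shift:
  fixes c :: "'a::euclidean_space"
  assumes "f \<in> borel_measurable borel"
  shows "(\<integral>\<^sup>+z. f (z + c) \<partial>lborel) = (\<integral>\<^sup>+z. f z \<partial>lborel)"
  using nn_integral_distr[of "(+) c" lborel borel f] assms by (simp add: lborel_distr_plus add.commute)

text \<open>Enclose the exceptional set in a Borel null set; every translate of it is null, and
  Fubini's theorem exchanges the two almost-everywhere quantifiers.\<close>

lemma AE_lborel_shift_line:
  fixes d :: "'a::euclidean_space"
  assumes "AE z in lborel. P z" shows "AE z in lborel. AE s in (lborel :: real measure). P (z + s *\<^sub>R d)"
proof -
  from assms obtain N where N: "{z. \<not> P z} \<subseteq> N" "emeasure lborel N = 0" "N \<in> sets lborel"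
    by (auto elim!: AE_E)
  have [measurable]: "N \<in> sets borel" using N(3) by simp
  have "N \<in> null_sets lborel" using N by (auto intro: null_setsI)
  then have "AE z in lborel. z \<notin> N" by (rule AE_not_in)
  then have "AE z in lborel. z + c \<notin> N" for c by (rule AE_lborel_shift)
  then have "AE s in (lborel :: real measure). AE z in lborel. z + s *\<^sub>R d \<notin> N" by (rule AE_I2)
  then have "AE z in lborel. AE s in (lborel :: real measure). z + s *\<^sub>R d \<notin> N"
  proof (subst lborel_pair.AE_commute)
    show "{x \<in> space (lborel \<Otimes>\<^sub>M lborel). fst x + snd x *\<^sub>R d \<notin> N} \<in> sets (lborel \<Otimes>\<^sub>M (lborel :: real measure))"
      by measurable
  qed
  then show ?thesis using N(1) by (auto elim!: eventually_mono)
qed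

text \<open>By Tonelli and translation invariance the inner integral over z does not depend on s, so
  the total is at most C times the length of the interval times the L^1 norm of
  \<open>v\<close>.\<close>

lemma integrable_line_pair:
  fixes d :: "'a::euclidean_space" and v :: "'a \<Rightarrow> 'b::euclidean_space"
  assumes v: "integrable lborel v" and f: "f \<in> borel_measurable borel" "\<And>z. \<bar>f z\<bar> \<le> C"
  shows "integrable (lborel \<Otimes>\<^sub>M lborel) (\<lambda>(z, s). f z *\<^sub>R (indicator {0..h} s *\<^sub>R v (z + s *\<^sub>R d)))"
proof -
  note [measurable] = f(1)
  have [measurable]: "v \<in> borel_measurable borel" using borel_measurable_integrable[OF v] by simp
  have C: "C \<ge> 0" using f(2) by (meson abs_ge_zero order_trans)
  have fin: "(\<integral>\<^sup>+z. norm (v z) \<partial>lborel) < \<infinity>" using v by (simp add: integrable_iff_bounded)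
  show ?thesis
  proof (rule integrableI_bounded)
    have "(\<integral>\<^sup>+x. norm (case x of (z, s) \<Rightarrow> f z *\<^sub>R (indicator {0..h} s *\<^sub>R v (z + s *\<^sub>R d))) \<partial>(lborel \<Otimes>\<^sub>M lborel))
        \<le> (\<integral>\<^sup>+x. (case x of (z, s) \<Rightarrow> C * (indicator {0..h} s * norm (v (z + s *\<^sub>R d)))) \<partial>(lborel \<Otimes>\<^sub>M lborel))"
      using f(2) by (intro nn_integral_mono) (auto simp: abs_mult intro!: ennreal_leI mult_mono C split: split_indicator)
    also have "\<dots> = (\<integral>\<^sup>+s. \<integral>\<^sup>+z. ennreal C * (indicator {0..h} s * ennreal (norm (v (z + s *\<^sub>R d)))) \<partial>lborel \<partial>lborel)"
      by (subst lborel_pair.nn_integral_snd[symmetric])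
         (auto simp: C ennreal_mult intro!: nn_integral_cong split: split_indicator)
    also have "\<dots> = (\<integral>\<^sup>+s. ennreal C * (indicator {0..h} s * (\<integral>\<^sup>+z. norm (v z) \<partial>lborel)) \<partial>lborel)"
      by (intro nn_integral_cong)
         (simp add: nn_integral_cmult nn_integral_lborel_shift[of "\<lambda>z. ennreal (norm (v z))"])
    also have "\<dots> = ennreal C * (emeasure lborel {0..h} * (\<integral>\<^sup>+z. norm (v z) \<partial>lborel))"
      by (simp add: nn_integral_cmult nn_integral_multc)
    also have "\<dots> < \<infinity>"
      using fin by (auto simp: ennreal_mult_less_top emeasure_lborel_Icc_eq)
    finally show "(\<integral>\<^sup>+x. norm (case x of (z, s) \<Rightarrow> f z *\<^sub>R (indicator {0..h} s *\<^sub>R v (z + s *\<^sub>R d))) \<partial>(lborel \<Otimes>\<^sub>M lborel)) < \<infinity>" .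
  qed measurable
qed

lemma AE_line_integrable:
  fixes d :: "'a::euclidean_space" and v :: "'a \<Rightarrow> 'b::euclidean_space"
  assumes v: "integrable lborel v"
  shows "AE z in lborel. set_integrable lborel {0..h} (\<lambda>s. v (z + s *\<^sub>R d))"
  using lborel_pair.AE_integrable_fst[OF integrable_line_pair[OF v, of "\<lambda>_. 1" 1 h d]]
  by (simp add: set_integrable_def)

lemma integrable_line_integral:
  fixes d :: "'a::euclidean_space" and v :: "'a \<Rightarrow> 'b::euclidean_space"
  assumes v: "integrable lborel v"
  shows "integrable lborel (\<lambda>z. LINT s:{0..h}|lborel. v (z + s *\<^sub>R d))"
  using lborel_pair.integrable_fst[OF integrable_line_pair[OF v, of "\<lambda>_. 1" 1 h d]]
  by (simp add: set_lebesgue_integral_def)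

text \<open>Forward averaging along \<open>d\<close> is transposed, under the integral pairing, to
  backward averaging: two applications of Fubini's theorem with a translation in z between
  them.\<close>

lemma line_fubini:
  fixes d :: "'a::euclidean_space" and v :: "'a \<Rightarrow> 'b::euclidean_space"
  assumes v: "integrable lborel v" and f: "f \<in> borel_measurable borel" "\<And>z. \<bar>f z\<bar> \<le> C"
  shows "(LINT z|lborel. f z *\<^sub>R (LINT s:{0..h}|lborel. v (z + s *\<^sub>R d))) =
    (LINT z|lborel. (LINT s:{0..h}|lborel. f (z - s *\<^sub>R d)) *\<^sub>R v z)"
proof -
  note [measurable] = f(1)
  have [measurable]: "v \<in> borel_measurable borel" using borel_measurable_integrable[OF v] by simp
  have "(LINT z|lborel. f z *\<^sub>R (LINT s:{0..h}|lborel. v (z + s *\<^sub>R d))) =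
      (LINT z|lborel. LINT s|lborel. f z *\<^sub>R (indicator {0..h} s *\<^sub>R v (z + s *\<^sub>R d)))"
    by (simp only: set_lebesgue_integral_def integral_scaleR_right)
  also have "\<dots> = (LINT s|lborel. LINT z|lborel. f z *\<^sub>R (indicator {0..h} s *\<^sub>R v (z + s *\<^sub>R d)))"
    by (rule lborel_pair.Fubini_integral[symmetric, OF integrable_line_pair[OF v f]])
  also have "\<dots> = (LINT s|lborel. LINT z|lborel. (indicator {0..h} s * f (z - s *\<^sub>R d)) *\<^sub>R v z)"
  proof (rule Bochner_Integration.integral_cong[OF refl])
    fix s
    show "(LINT z|lborel. f z *\<^sub>R (indicator {0..h} s *\<^sub>R v (z + s *\<^sub>R d))) =
        (LINT z|lborel. (indicator {0..h} s * f (z - s *\<^sub>R d)) *\<^sub>R v z)"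
      by (subst integral_lborel_shift[of _ "- (s *\<^sub>R d)", symmetric]) (simp_all add: mult.commute)
  qed
  also have "\<dots> = (LINT z|lborel. LINT s|lborel. (indicator {0..h} s * f (z - s *\<^sub>R d)) *\<^sub>R v z)"
  proof (rule lborel_pair.Fubini_integral)
    have C: "C \<ge> 0" using f(2) by (meson abs_ge_zero order_trans)
    have "integrable (lborel \<Otimes>\<^sub>M lborel) (\<lambda>(z, s). (C * indicator {0..h} (s::real)) *\<^sub>R v z)"
    proof (rule lborel_pair.Fubini_integrable)
      show "AE z in lborel. integrable lborel (\<lambda>s. case (z, s) of (z, s) \<Rightarrow> (C * indicator {0..h} (s::real)) *\<^sub>R v z)"
        by (intro AE_I2) (auto intro!: integrable_scaleR_left integrable_mult_right integrable_real_indicator simp: emeasure_lborel_Icc_eq)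
      have "integrable lborel (\<lambda>z. (LINT s|lborel. C * indicator {0..h} (s::real)) * norm (v z))"
        using v by (intro integrable_mult_right) simp
      moreover have "norm ((C * indicator {0..h} s) *\<^sub>R v z) = C * indicator {0..h} s * norm (v z)" for z s
        using C by (simp add: abs_mult)
      ultimately show "integrable lborel (\<lambda>z. LINT s|lborel. norm (case (z, s) of (z, s) \<Rightarrow> (C * indicator {0..h} (s::real)) *\<^sub>R v z))"
        by (simp only: split_conv integral_mult_left_zero)
    qed measurable
    then show "integrable (lborel \<Otimes>\<^sub>M lborel) (\<lambda>(z, s). (indicator {0..h} s * f (z - s *\<^sub>R d)) *\<^sub>R v z)"
      by (rule Bochner_Integration.integrable_bound)
         (use f(2) C in \<open>auto intro!: AE_I2 mult_right_mono simp: abs_mult split: split_indicator\<close>)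
  qed
  also have "\<dots> = (LINT z|lborel. (LINT s:{0..h}|lborel. f (z - s *\<^sub>R d)) *\<^sub>R v z)"
  proof (intro Bochner_Integration.integral_cong refl)
    fix z
    have "integrable lborel (\<lambda>s. C * indicator {0..h} (s::real))"
      by (intro integrable_mult_right integrable_real_indicator) (simp_all add: emeasure_lborel_Icc_eq)
    then have "integrable lborel (\<lambda>s. indicator {0..h} s * f (z - s *\<^sub>R d))"
      by (rule Bochner_Integration.integrable_bound)
         (use f(2) order_trans[OF abs_ge_zero f(2)] in \<open>auto intro!: AE_I2 simp: abs_mult split: split_indicator\<close>)
    then show "(LINT s|lborel. (indicator {0..h} s * f (z - s *\<^sub>R d)) *\<^sub>R v z) =
        (LINT s:{0..h}|lborel. f (z - s *\<^sub>R d)) *\<^sub>R v z"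
      by (simp add: set_lebesgue_integral_def)
  qed
  finally show ?thesis .
qed

lemma integrable_test_mult:
  fixes u :: "'a::euclidean_space \<Rightarrow> 'b::euclidean_space"
  assumes "integrable lborel u" "f \<in> borel_measurable borel" "\<And>z. \<bar>f z\<bar> \<le> C"
  shows "integrable lborel (\<lambda>z. f z *\<^sub>R u z)"
proof (rule Bochner_Integration.integrable_bound)
  show "integrable lborel (\<lambda>z. C *\<^sub>R u z)" using assms(1) by simp
  have "C \<ge> 0" using assms(3) by (meson abs_ge_zero order_trans)
  then show "AE z in lborel. norm (f z *\<^sub>R u z) \<le> norm (C *\<^sub>R u z)"
    using assms(3) by (auto intro!: AE_I2 mult_right_mono)
qed (use assms borel_measurable_integrable[OF assms(1)] in measurable)

section \<open>Weak derivatives and lines\<close>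

text \<open>\<open>F\<close> is the average of \<open>f\<close> over segments of length \<open>h\<close>; using it as a test function turns the
  weak derivative into a difference.\<close>

lemma line_test:
  fixes u v :: "complex \<Rightarrow> 'b::euclidean_space"
  assumes iu: "integrable lborel u" and iv: "integrable lborel v" and h: "0 \<le> h"
    and wd: "\<And>f. test_function W f \<Longrightarrow>
      (LINT z|lborel. frechet_derivative f (at z) d *\<^sub>R u z) = - (LINT z|lborel. f z *\<^sub>R v z)"
    and f: "f \<in> borel_measurable borel" "\<And>z. \<bar>f z\<bar> \<le> C"
    and F: "test_function W F" "\<And>z. frechet_derivative F (at z) d = f z - f (z - h *\<^sub>R d)"
      "\<And>z. F z = (LINT s:{0..h}|lborel. f (z - s *\<^sub>R d))"
  shows "(LINT z|lborel. f z *\<^sub>R (u (z + h *\<^sub>R d) - u z - (LINT s:{0..h}|lborel. v (z + s *\<^sub>R d)))) = 0"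
proof -
  note [measurable] = f(1)
  have [measurable]: "u \<in> borel_measurable borel" using borel_measurable_integrable[OF iu] by simp
  note i1 = integrable_test_mult[OF integrable_lborel_shift[OF iu, of "h *\<^sub>R d"] f]
  note i2 = integrable_test_mult[OF iu f]
  note i3 = integrable_test_mult[OF integrable_line_integral[OF iv, of h d] f]
  have i4: "integrable lborel (\<lambda>z. f (z - h *\<^sub>R d) *\<^sub>R u z)"
    by (rule integrable_test_mult[OF iu, of _ C]) (use f in simp_all)
  have "(LINT z|lborel. f z *\<^sub>R u (z + h *\<^sub>R d)) = (LINT z|lborel. f (z - h *\<^sub>R d) *\<^sub>R u z)"
    by (subst integral_lborel_shift[of _ "- (h *\<^sub>R d)", symmetric]) simp_all
  moreover have "(LINT z|lborel. f z *\<^sub>R (LINT s:{0..h}|lborel. v (z + s *\<^sub>R d))) =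
      - (LINT z|lborel. (f z - f (z - h *\<^sub>R d)) *\<^sub>R u z)"
    unfolding line_fubini[OF iv f] F(3)[symmetric] using wd[OF F(1)] unfolding F(2) by simp
  ultimately show ?thesis
    using i1 i2 i3 i4 by (simp add: scaleR_diff_right scaleR_diff_left)
qed

text \<open>\<open>F\<close> is P(x) - P(x - h) for an antiderivative P of \<open>f\<close>: at once
  the integral of \<open>f\<close> over [x - h, x] and a function whose derivative is a difference
  of values of \<open>f\<close>. Since the average looks backwards, the support grows only to the
  right.\<close>

lemma moving_average:
  assumes f: "\<And>n. Cn n f" "\<And>x. x \<notin> {a..b} \<Longrightarrow> f x = 0" and h: "0 \<le> h"
  obtains F where "\<And>n. Cn n F" "\<And>x. (F has_real_derivative f x - f (x - h)) (at x)"
    "\<And>x. F x = (LINT s:{0..h}|lborel. f (x - s))" "\<And>x. x \<notin> {a..b + h} \<Longrightarrow> F x = 0"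
proof -
  obtain P where P: "\<And>x. (P has_real_derivative f x) (at x)"
    using ex_antiderivative[OF Cn_continuous[OF f(1)]] by blast
  define F where "F x = P x - P (x - h)" for x
  have CP: "Cn n P" for n using P f(1) Cn_Suc_imp[OF Cn_SucI] by blast
  have 1: "Cn n F" for n
    unfolding F_def using Cn_diff[OF CP Cn_affine[OF CP, of n 1 "-h"]] by simp
  have 2: "(F has_real_derivative f x - f (x - h)) (at x)" for x
  proof -
    have "((\<lambda>x. P (x - h)) has_real_derivative f (x - h) * 1) (at x)"
      by (rule DERIV_chain2[OF P]) (auto intro!: derivative_eq_intros)
    then show ?thesis unfolding F_def using P by (auto intro!: derivative_eq_intros)
  qed
  have 3: "F x = (LINT s:{0..h}|lborel. f (x - s))" for x
  proof -
    have "(LINT s|lborel. f (x - s) * indicator {0..h} s) = (- P (x - h)) - (- P (x - 0))"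
    proof (rule integral_FTC_Icc_real[OF h])
      fix s
      have "((\<lambda>s. P (x - s)) has_real_derivative f (x - s) * (- 1)) (at s)"
        by (rule DERIV_chain2[OF P]) (auto intro!: derivative_eq_intros)
      then show "((\<lambda>s. - P (x - s)) has_real_derivative f (x - s)) (at s)"
        by (auto intro!: derivative_eq_intros)
      have "isCont f (x - s)" using Cn_continuous[OF f(1)] by (simp add: continuous_on_eq_continuous_at)
      then show "isCont (\<lambda>s. f (x - s)) s" by (intro isCont_o2[of s "\<lambda>s. x - s" f] continuous_intros)
    qed
    then show ?thesis by (simp add: F_def set_lebesgue_integral_def mult.commute)
  qed
  have 4: "F x = 0" if "x \<notin> {a..b + h}" for x
  proof -
    have "(LINT s:{0..h}|lborel. f (x - s)) = (LINT s:{0..h}|lborel. 0)"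
      by (rule set_lebesgue_integral_cong) (use that in \<open>auto intro!: f(2)\<close>)
    then show ?thesis by (simp add: 3)
  qed
  show thesis by (rule that[OF 1 2 3 4])
qed

lemma bounded_Cn:
  assumes "Cn n f" "\<And>x. x \<notin> {a..b} \<Longrightarrow> f x = 0"
  obtains C where "\<And>x. \<bar>f x\<bar> \<le> C"
proof -
  have "compact (f ` {a..b})"
    by (intro compact_continuous_image compact_Icc continuous_on_subset[OF Cn_continuous[OF assms(1)]]) simp
  then have "bounded (f ` {a..b})" by (rule compact_imp_bounded)
  then obtain C where C: "\<And>x. x \<in> {a..b} \<Longrightarrow> \<bar>f x\<bar> \<le> C" unfolding bounded_iff real_norm_def by blast
  have "\<bar>f x\<bar> \<le> \<bar>C\<bar>" for x using C[of x] assms(2)[of x] by (cases "x \<in> {a..b}") auto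
  then show thesis by (rule that)
qed

text \<open>For a fixed \<open>h\<close> the fundamental lemma is applied to the defect of the
  formula. In the product test function only the factor belonging to the direction \<open>d\<close>
  is replaced by its moving average, so the result is again a product and an admissible test
  function on W.\<close>

lemma weak_deriv_imp_line:
  fixes u v :: "complex \<Rightarrow> 'b::euclidean_space"
  assumes d: "d \<in> {1, \<i>}" and iu: "integrable lborel u" and iv: "integrable lborel v"
    and wd: "\<And>f. test_function W f \<Longrightarrow>
      (LINT z|lborel. frechet_derivative f (at z) d *\<^sub>R u z) = - (LINT z|lborel. f z *\<^sub>R v z)"
    and V: "open V" and h: "0 \<le> h" and VW: "\<And>z s. z \<in> V \<Longrightarrow> 0 \<le> s \<Longrightarrow> s \<le> h \<Longrightarrow> z + s *\<^sub>R d \<in> W"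
  shows "AE z\<in>V in lborel. u (z + h *\<^sub>R d) = u z + (LINT s:{0..h}|lborel. v (z + s *\<^sub>R d))"
proof -
  have "AE z\<in>V in lborel. u (z + h *\<^sub>R d) - u z - (LINT s:{0..h}|lborel. v (z + s *\<^sub>R d)) = 0"
  proof (rule AE_zero_if_test_integrals_zero[OF _ V])
    show "integrable lborel (\<lambda>z. u (z + h *\<^sub>R d) - u z - (LINT s:{0..h}|lborel. v (z + s *\<^sub>R d)))"
      using iu iv by (intro Bochner_Integration.integrable_diff integrable_lborel_shift integrable_line_integral)
    fix f g a b p q
    assume f: "\<And>n. Cn n f" "\<And>x. x \<notin> {a..b} \<Longrightarrow> f x = 0" and g: "\<And>n. Cn n g" "\<And>y. y \<notin> {p..q} \<Longrightarrow> g y = 0"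
      and sub: "cbox (Complex a p) (Complex b q) \<subseteq> V"
    show "(LINT z|lborel. (f (Re z) * g (Im z)) *\<^sub>R (u (z + h *\<^sub>R d) - u z - (LINT s:{0..h}|lborel. v (z + s *\<^sub>R d)))) = 0"
    \<comment> \<open>For an empty rectangle the product vanishes identically; otherwise every point
      of the rectangle enlarged by \<open>h\<close> in direction \<open>d\<close> lies on a forward
      segment starting in the original one.\<close>
    proof (cases "a \<le> b \<and> p \<le> q")
      case False
      then have "f (Re z) * g (Im z) = 0" for z using f(2)[of "Re z"] g(2)[of "Im z"] by fastforce
      then show ?thesis by (simp only: scaleR_zero_left Bochner_Integration.integral_zero)
    next
      case ab: True
      obtain Cf where Cf: "\<And>x. \<bar>f x\<bar> \<le> Cf" using bounded_Cn[OF f(1) f(2)] by metis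
      obtain Cg where Cg: "\<And>x. \<bar>g x\<bar> \<le> Cg" using bounded_Cn[OF g(1) g(2)] by metis
      have bd: "\<bar>f (Re z) * g (Im z)\<bar> \<le> Cf * Cg" for z
        unfolding abs_mult by (intro mult_mono Cf Cg) (auto intro: order_trans[OF abs_ge_zero Cf])
      have cont: "continuous_on UNIV (\<lambda>z. f (Re z) * g (Im z))"
        using Ck_on_prod[OF f(1) g(1), of 0] by simp
      have fm: "(\<lambda>z. f (Re z) * g (Im z)) \<in> borel_measurable borel"
        by (rule borel_measurable_continuous_onI[OF cont])
      obtain F where F: "\<And>n. Cn n F" "\<And>x. (F has_real_derivative f x - f (x - h)) (at x)"
        "\<And>x. F x = (LINT s:{0..h}|lborel. f (x - s))" "\<And>x. x \<notin> {a..b + h} \<Longrightarrow> F x = 0"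
        using moving_average[OF f(1) f(2) h] by metis
      obtain G where G: "\<And>n. Cn n G" "\<And>x. (G has_real_derivative g x - g (x - h)) (at x)"
        "\<And>x. G x = (LINT s:{0..h}|lborel. g (x - s))" "\<And>x. x \<notin> {p..q + h} \<Longrightarrow> G x = 0"
        using moving_average[OF g(1) g(2) h] by metis
      have Cn_deriv: "\<exists>f'. \<forall>x. (f has_real_derivative f' x) (at x)" if "\<And>n. Cn n f" for f
        using that[of 1] by auto
      consider "d = 1" | "d = \<i>" using d by blast
      then show ?thesis
      proof cases
        case 1
        obtain g' where g': "\<And>x. (g has_real_derivative g' x) (at x)" using Cn_deriv[OF g(1)] by blast
        show ?thesis
        proof (rule line_test[OF iu iv h wd fm bd])
          show "test_function W (\<lambda>z. F (Re z) * g (Im z))"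
          proof (rule test_function_prod[OF F(1) g(1) F(4) g(2)])
            show "cbox (Complex a p) (Complex (b + h) q) \<subseteq> W"
            proof
              fix z assume z: "z \<in> cbox (Complex a p) (Complex (b + h) q)"
              \<comment> \<open>The amount by which \<open>z\<close> sticks out beyond the right
                edge; moving back by it lands in the support rectangle, hence in V, and the forward
                segment from there stays in W.\<close>
              define s where "s = max 0 (Re z - b)"
              have "z - s *\<^sub>R d \<in> V" using z ab h 1 by (intro subsetD[OF sub]) (auto simp: in_cbox_complex_iff s_def)
              moreover have "0 \<le> s" "s \<le> h" using z h by (auto simp: in_cbox_complex_iff s_def)
              ultimately show "z \<in> W" using VW[of "z - s *\<^sub>R d" s] by simp
            qed
          qed
          show "frechet_derivative (\<lambda>z. F (Re z) * g (Im z)) (at z) d =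
              f (Re z) * g (Im z) - f (Re (z - h *\<^sub>R d)) * g (Im (z - h *\<^sub>R d))" for z
            using frechet_prod(1)[OF F(2) g'] 1 by (simp add: algebra_simps)
          show "F (Re z) * g (Im z) = (LINT s:{0..h}|lborel. f (Re (z - s *\<^sub>R d)) * g (Im (z - s *\<^sub>R d)))" for z
            using 1 by (simp add: F(3))
        qed
      next
        case 2
        obtain f' where f': "\<And>x. (f has_real_derivative f' x) (at x)" using Cn_deriv[OF f(1)] by blast
        show ?thesis
        proof (rule line_test[OF iu iv h wd fm bd])
          show "test_function W (\<lambda>z. f (Re z) * G (Im z))"
          proof (rule test_function_prod[OF f(1) G(1) f(2) G(4)])
            show "cbox (Complex a p) (Complex b (q + h)) \<subseteq> W"
            proof
              fix z assume z: "z \<in> cbox (Complex a p) (Complex b (q + h))"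
              define s where "s = max 0 (Im z - q)"
              have "z - s *\<^sub>R d \<in> V" using z ab h 2 by (intro subsetD[OF sub]) (auto simp: in_cbox_complex_iff s_def)
              moreover have "0 \<le> s" "s \<le> h" using z h by (auto simp: in_cbox_complex_iff s_def)
              ultimately show "z \<in> W" using VW[of "z - s *\<^sub>R d" s] by simp
            qed
          qed
          show "frechet_derivative (\<lambda>z. f (Re z) * G (Im z)) (at z) d =
              f (Re z) * g (Im z) - f (Re (z - h *\<^sub>R d)) * g (Im (z - h *\<^sub>R d))" for z
            using frechet_prod(2)[OF f' G(2)] 2 by (simp add: algebra_simps)
          show "f (Re z) * G (Im z) = (LINT s:{0..h}|lborel. f (Re (z - s *\<^sub>R d)) * g (Im (z - s *\<^sub>R d)))" for z
            using 2 by (simp add: G(3))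
        qed
      qed
    qed
  qed
  then show ?thesis by (auto elim!: eventually_mono simp: algebra_simps)
qed

section \<open>Boundedness, support and Lipschitz estimates for test functions\<close>

lemma continuous_compact_support_bounded:
  fixes g :: "'a::t2_space \<Rightarrow> real"
  assumes "continuous_on UNIV g" "compact K" "\<And>z. z \<notin> K \<Longrightarrow> g z = 0"
  obtains C where "0 \<le> C" "\<And>z. \<bar>g z\<bar> \<le> C"
proof -
  have "compact (g ` K)"
    by (intro compact_continuous_image assms continuous_on_subset[OF assms(1)]) simp
  then have "bounded (g ` K)" by (rule compact_imp_bounded)
  then obtain C where C: "\<And>x. x \<in> K \<Longrightarrow> \<bar>g x\<bar> \<le> C" unfolding bounded_iff real_norm_def by blast
  have "\<bar>g x\<bar> \<le> \<bar>C\<bar>" for x using C[of x] assms(3)[of x] by (cases "x \<in> K") auto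
  then show thesis by (intro that[of "\<bar>C\<bar>"]) auto
qed

lemma test_function_mono: "test_function S f \<Longrightarrow> S \<subseteq> T \<Longrightarrow> test_function T f"
  by (auto simp: test_function_def)

lemma test_function_has_derivative:
  assumes "test_function S f"
  shows "(f has_derivative frechet_derivative f (at z)) (at z)"
proof -
  have "Ck_on (Suc 0) UNIV f" using assms by (simp only: test_function_def smooth_on_def)
  then show ?thesis by (simp add: frechet_derivative_works)
qed

lemma test_function_continuous: "test_function S f \<Longrightarrow> continuous_on UNIV f"
  unfolding test_function_def smooth_on_def using Ck_on.simps(1)[of UNIV f] by blast

lemma test_function_deriv_continuous:
  assumes "test_function S f" "d \<in> {1, \<i>}"
  shows "continuous_on UNIV (\<lambda>z. frechet_derivative f (at z) d)"
proof -
  have "Ck_on (Suc 0) UNIV f" using assms by (simp only: test_function_def smooth_on_def)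
  then show ?thesis using assms(2) by auto
qed

lemma test_function_support:
  assumes "test_function S f"
  obtains K where "compact K" "K \<subseteq> S" "\<And>z. z \<notin> K \<Longrightarrow> f z = 0" "\<And>z. z \<notin> K \<Longrightarrow> frechet_derivative f (at z) = (\<lambda>_. 0)"
proof -
  obtain K where K: "compact K" "K \<subseteq> S" "\<And>z. z \<notin> K \<Longrightarrow> f z = 0" using assms by (auto simp: test_function_def)
  have "frechet_derivative f (at z) = (\<lambda>_. 0)" if "z \<notin> K" for z
  proof (rule frechet_derivative_at[symmetric])
    show "(f has_derivative (\<lambda>_. 0)) (at z)"
      by (rule has_derivative_transform_within_open[where s = "- K" and f = "\<lambda>_. 0"])
         (use K that compact_imp_closed in auto)
  qed
  then show thesis using that[OF K] by blast
qed

lemma test_function_deriv_zero: "test_function S f \<Longrightarrow> z \<notin> S \<Longrightarrow> frechet_derivative f (at z) d = 0"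
proof -
  assume f: "test_function S f" and "z \<notin> S"
  obtain K where K: "K \<subseteq> S" "\<And>z. z \<notin> K \<Longrightarrow> frechet_derivative f (at z) = (\<lambda>_. 0)"
    using test_function_support[OF f] by metis
  have "z \<notin> K" using \<open>z \<notin> S\<close> K(1) by blast
  then show ?thesis using K(2) by simp
qed

lemma test_function_zero: "test_function S f \<Longrightarrow> z \<notin> S \<Longrightarrow> f z = 0"
  by (auto simp: test_function_def)

lemma test_function_bounded:
  assumes "test_function S f"
  obtains C where "0 \<le> C" "\<And>z. \<bar>f z\<bar> \<le> C"
  by (rule test_function_support[OF assms])
     (metis continuous_compact_support_bounded[OF test_function_continuous[OF assms]])

lemma test_function_deriv_bounded:
  assumes "test_function S f" "d \<in> {1, \<i>}"
  obtains C where "0 \<le> C" "\<And>z. \<bar>frechet_derivative f (at z) d\<bar> \<le> C"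
  by (rule test_function_support[OF assms(1)])
     (metis continuous_compact_support_bounded[OF test_function_deriv_continuous[OF assms]])

lemma test_function_line_deriv:
  assumes "test_function S f"
  shows "((\<lambda>t. f (z - t *\<^sub>R d)) has_real_derivative - frechet_derivative f (at (z - t *\<^sub>R d)) d) (at t)"
proof -
  let ?D = "frechet_derivative f (at (z - t *\<^sub>R d))"
  have D: "(f has_derivative ?D) (at (z - t *\<^sub>R d))" by (rule test_function_has_derivative[OF assms])
  have "((\<lambda>t. z - t *\<^sub>R d) has_derivative (\<lambda>h. - (h *\<^sub>R d))) (at t)"
    by (auto intro!: derivative_eq_intros)
  from has_derivative_compose[OF this D]
  have "((\<lambda>t. f (z - t *\<^sub>R d)) has_derivative (\<lambda>h. ?D (- (h *\<^sub>R d)))) (at t)" .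
  moreover have "(\<lambda>h. ?D (- (h *\<^sub>R d))) = (*) (- ?D d)"
    using has_derivative_linear[OF D] by (intro ext) (simp add: linear_neg linear_scale)
  ultimately show ?thesis unfolding has_field_derivative_def by (simp only:)
qed

lemma test_function_lipschitz:
  assumes "test_function S f" "\<And>z. \<bar>frechet_derivative f (at z) d\<bar> \<le> L" "0 \<le> h"
  shows "\<bar>f (z - h *\<^sub>R d) - f z\<bar> \<le> L * h"
proof (cases "h = 0")
  case False
  then have "0 < h" using assms(3) by simp
  from MVT2[OF this test_function_line_deriv[OF assms(1)], of z d]
  obtain t where "f (z - h *\<^sub>R d) - f z = h * - frechet_derivative f (at (z - t *\<^sub>R d)) d" by auto
  then show ?thesis using mult_left_mono[OF assms(2)[of "z - t *\<^sub>R d"] assms(3)] assms(3)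
    by (simp add: abs_mult mult.commute)
qed simp

text \<open>Integrating the formula against \<open>f\<close> and transposing puts difference
  quotients of \<open>f\<close> against \<open>u\<close> and backward averages of \<open>f\<close>
  against \<open>v\<close>. Both converge boundedly as the step tends to zero, to minus the
  derivative of \<open>f\<close> along \<open>d\<close> and to \<open>f\<close> itself.\<close>

lemma line_imp_weak_deriv:
  fixes u v :: "complex \<Rightarrow> 'b::euclidean_space"
  assumes d: "d \<in> {1, \<i>}" and iu: "integrable lborel u" and iv: "integrable lborel v"
    and f: "test_function V f" and \<delta>: "0 < \<delta>"
    and line: "\<And>h. 0 \<le> h \<Longrightarrow> h \<le> \<delta> \<Longrightarrow> AE z\<in>V in lborel.
      u (z + h *\<^sub>R d) = u z + (LINT s:{0..h}|lborel. v (z + s *\<^sub>R d))"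
  shows "(LINT z|lborel. frechet_derivative f (at z) d *\<^sub>R u z) = - (LINT z|lborel. f z *\<^sub>R v z)"
proof -
  obtain C where C: "0 \<le> C" "\<And>z. \<bar>f z\<bar> \<le> C" using test_function_bounded[OF f] by blast
  obtain L where L: "0 \<le> L" "\<And>z. \<bar>frechet_derivative f (at z) d\<bar> \<le> L" using test_function_deriv_bounded[OF f d] by blast
  have fm [measurable]: "f \<in> borel_measurable borel"
    by (rule borel_measurable_continuous_onI[OF test_function_continuous[OF f]])
  have dm [measurable]: "(\<lambda>z. frechet_derivative f (at z) d) \<in> borel_measurable borel"
    by (rule borel_measurable_continuous_onI[OF test_function_deriv_continuous[OF f d]])
  have um [measurable]: "u \<in> borel_measurable borel" using borel_measurable_integrable[OF iu] by simp
  have vm [measurable]: "v \<in> borel_measurable borel" using borel_measurable_integrable[OF iv] by simp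
  \<comment> \<open>Steps tending to zero that stay in the range where the formula is
    assumed.\<close>
  define h where "h n = \<delta> * inverse (real (Suc n))" for n
  have h: "0 < h n" "h n \<le> \<delta>" for n
    using \<delta> by (auto simp: h_def field_simps intro: mult_pos_pos)
  have "h \<longlonglongrightarrow> \<delta> * 0" unfolding h_def by (intro tendsto_intros LIMSEQ_inverse_real_of_nat)
  then have hlim: "h \<longlonglongrightarrow> 0" by simp
  have avg_meas: "(\<lambda>z. LINT s:{0..h n}|lborel. f (z - s *\<^sub>R d)) \<in> borel_measurable borel" for n
    unfolding set_lebesgue_integral_def by measurable
  have avg_close: "\<bar>(LINT s:{0..h n}|lborel. f (z - s *\<^sub>R d)) / h n - f z\<bar> \<le> L * h n" for n z
  proof -
    have si: "set_integrable lborel {0..h n} (\<lambda>s. f (z - s *\<^sub>R d))"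
      by (intro borel_integrable_atLeastAtMost' continuous_on_compose2[OF test_function_continuous[OF f]] continuous_intros) auto
    have sc: "set_integrable lborel {0..h n} (\<lambda>s. c)" for c :: real
      by (intro borel_integrable_atLeastAtMost' continuous_intros)
    have "(LINT s:{0..h n}|lborel. f (z - s *\<^sub>R d)) - h n * f z =
        (LINT s:{0..h n}|lborel. f (z - s *\<^sub>R d) - f z)"
      using h[of n] by (subst set_integral_diff(2)[OF si sc]) (simp add: set_integral_const)
    moreover have "\<bar>\<dots>\<bar> \<le> (LINT s:{0..h n}|lborel. L * h n)"
    proof -
      have sd: "set_integrable lborel {0..h n} (\<lambda>s. f (z - s *\<^sub>R d) - f z)" by (rule set_integral_diff(1)[OF si sc])
      have "\<bar>LINT s:{0..h n}|lborel. f (z - s *\<^sub>R d) - f z\<bar> \<le> (LINT s:{0..h n}|lborel. \<bar>f (z - s *\<^sub>R d) - f z\<bar>)"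
        using set_integral_norm_bound[OF sd] by simp
      also have "\<dots> \<le> (LINT s:{0..h n}|lborel. L * h n)"
      proof (rule set_integral_mono[OF set_integrable_abs[OF sd] sc])
        fix s assume "s \<in> {0..h n}"
        then show "\<bar>f (z - s *\<^sub>R d) - f z\<bar> \<le> L * h n"
          using test_function_lipschitz[OF f L(2), of s z] L(1) by (auto intro: order_trans mult_left_mono)
      qed
      finally show ?thesis .
    qed
    ultimately have "\<bar>(LINT s:{0..h n}|lborel. f (z - s *\<^sub>R d)) - h n * f z\<bar> \<le> h n * (L * h n)"
      using h[of n] by (simp add: set_integral_const algebra_simps)
    then show ?thesis using h(1)[of n] by (simp add: field_simps abs_if split: if_splits)
  qed
  have avg_lim: "(\<lambda>n. (LINT s:{0..h n}|lborel. f (z - s *\<^sub>R d)) / h n) \<longlonglongrightarrow> f z" for z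
  proof -
    have "(\<lambda>n. (LINT s:{0..h n}|lborel. f (z - s *\<^sub>R d)) / h n - f z) \<longlonglongrightarrow> 0"
      by (rule Lim_null_comparison[of _ "\<lambda>n. L * h n"])
         (use avg_close tendsto_mult[OF tendsto_const hlim, of L] in auto)
    then show ?thesis by (simp add: LIM_zero_iff)
  qed
  have dq_lim: "(\<lambda>n. (f (z - h n *\<^sub>R d) - f z) / h n) \<longlonglongrightarrow> - frechet_derivative f (at z) d" for z
  proof -
    have "((\<lambda>t. (f (z - t *\<^sub>R d) - f z) / t) \<longlongrightarrow> - frechet_derivative f (at z) d) (at 0)"
      using test_function_line_deriv[OF f, of z d 0] by (simp add: has_field_derivative_iff)
    moreover have "filterlim h (at 0) sequentially"
      using hlim h(1) by (auto simp: filterlim_at intro!: always_eventually) (metis less_irrefl)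
    ultimately show ?thesis by (rule filterlim_compose)
  qed
  \<comment> \<open>The formula along lines is known only on V, which suffices under the integral
    because \<open>f\<close> vanishes off V.\<close>
  have eq: "(LINT z|lborel. ((f (z - h n *\<^sub>R d) - f z) / h n) *\<^sub>R u z) =
      (LINT z|lborel. ((LINT s:{0..h n}|lborel. f (z - s *\<^sub>R d)) / h n) *\<^sub>R v z)" for n
  proof -
    note li = integrable_line_integral[OF iv, of "h n" d]
    have "(LINT z|lborel. f z *\<^sub>R (u (z + h n *\<^sub>R d) - u z)) =
        (LINT z|lborel. f z *\<^sub>R (LINT s:{0..h n}|lborel. v (z + s *\<^sub>R d)))"
    proof (rule integral_cong_AE)
      show "AE z in lborel. f z *\<^sub>R (u (z + h n *\<^sub>R d) - u z) = f z *\<^sub>R (LINT s:{0..h n}|lborel. v (z + s *\<^sub>R d))"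
        using line[of "h n"] h[of n] test_function_zero[OF f] by (auto elim!: eventually_mono)
    qed (use borel_measurable_integrable[OF li] in measurable)
    also have "\<dots> = (LINT z|lborel. (LINT s:{0..h n}|lborel. f (z - s *\<^sub>R d)) *\<^sub>R v z)"
      by (rule line_fubini[OF iv fm C(2)])
    also have "(LINT z|lborel. f z *\<^sub>R (u (z + h n *\<^sub>R d) - u z)) =
        (LINT z|lborel. f z *\<^sub>R u (z + h n *\<^sub>R d)) - (LINT z|lborel. f z *\<^sub>R u z)"
      using integrable_test_mult[OF integrable_lborel_shift[OF iu] fm C(2)] integrable_test_mult[OF iu fm C(2)]
      by (simp add: scaleR_diff_right)
    also have "(LINT z|lborel. f z *\<^sub>R u (z + h n *\<^sub>R d)) = (LINT z|lborel. f (z - h n *\<^sub>R d) *\<^sub>R u z)"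
      by (subst integral_lborel_shift[of _ "- (h n *\<^sub>R d)", symmetric]) simp_all
    also have "\<dots> - (LINT z|lborel. f z *\<^sub>R u z) = (LINT z|lborel. (f (z - h n *\<^sub>R d) - f z) *\<^sub>R u z)"
    proof -
      have "integrable lborel (\<lambda>z. f (z - h n *\<^sub>R d) *\<^sub>R u z)"
        by (rule integrable_test_mult[OF iu, of _ C]) (use C in simp_all)
      then show ?thesis using integrable_test_mult[OF iu fm C(2)] by (simp add: scaleR_diff_left)
    qed
    finally have e: "(LINT z|lborel. (f (z - h n *\<^sub>R d) - f z) *\<^sub>R u z) =
        (LINT z|lborel. (LINT s:{0..h n}|lborel. f (z - s *\<^sub>R d)) *\<^sub>R v z)" .
    show ?thesis
      using arg_cong[OF e, of "\<lambda>x. inverse (h n) *\<^sub>R x"]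
      by (simp only: integral_scaleR_right[symmetric] scaleR_scaleR divide_inverse mult.commute[of _ "inverse (h n)"])
  qed
  have "(\<lambda>n. LINT z|lborel. ((f (z - h n *\<^sub>R d) - f z) / h n) *\<^sub>R u z) \<longlonglongrightarrow>
      (LINT z|lborel. (- frechet_derivative f (at z) d) *\<^sub>R u z)"
  proof (rule integral_dominated_convergence[where w = "\<lambda>z. norm (L *\<^sub>R u z)"])
    show "AE z in lborel. (\<lambda>n. ((f (z - h n *\<^sub>R d) - f z) / h n) *\<^sub>R u z) \<longlonglongrightarrow> (- frechet_derivative f (at z) d) *\<^sub>R u z"
      by (intro AE_I2 tendsto_intros dq_lim)
    have "\<bar>(f (z - h n *\<^sub>R d) - f z) / h n\<bar> \<le> L" for n z
      using test_function_lipschitz[OF f L(2), of "h n" z] h(1)[of n] by (simp add: field_simps)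
    then show "AE z in lborel. norm (((f (z - h n *\<^sub>R d) - f z) / h n) *\<^sub>R u z) \<le> norm (L *\<^sub>R u z)" for n
      unfolding norm_scaleR real_norm_def by (intro AE_I2 mult_right_mono norm_ge_zero) (meson abs_ge_self order_trans)
    show "integrable lborel (\<lambda>z. norm (L *\<^sub>R u z))" using iu by simp
  qed measurable
  moreover have "(\<lambda>n. LINT z|lborel. ((LINT s:{0..h n}|lborel. f (z - s *\<^sub>R d)) / h n) *\<^sub>R v z) \<longlonglongrightarrow>
      (LINT z|lborel. f z *\<^sub>R v z)"
  \<comment> \<open>The backward averages differ from \<open>f\<close> by at most L times the step,
    and the step is at most \<delta>; with the bound C on \<open>f\<close> this gives the
    constant.\<close>
  proof (rule integral_dominated_convergence[where w = "\<lambda>z. norm ((C + L * \<delta>) *\<^sub>R v z)"])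
    show "AE z in lborel. (\<lambda>n. ((LINT s:{0..h n}|lborel. f (z - s *\<^sub>R d)) / h n) *\<^sub>R v z) \<longlonglongrightarrow> f z *\<^sub>R v z"
      by (intro AE_I2 tendsto_intros avg_lim)
    have "\<bar>(LINT s:{0..h n}|lborel. f (z - s *\<^sub>R d)) / h n\<bar> \<le> C + L * \<delta>" for n z
      using avg_close[of n z] C(2)[of z] mult_left_mono[OF h(2)[of n] L(1)] by linarith
    then show "AE z in lborel. norm (((LINT s:{0..h n}|lborel. f (z - s *\<^sub>R d)) / h n) *\<^sub>R v z) \<le> norm ((C + L * \<delta>) *\<^sub>R v z)" for n
      unfolding norm_scaleR real_norm_def by (intro AE_I2 mult_right_mono norm_ge_zero) (meson abs_ge_self order_trans)
    show "integrable lborel (\<lambda>z. norm ((C + L * \<delta>) *\<^sub>R v z))" using iv by simp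
  qed (use avg_meas in measurable)
  ultimately have "(LINT z|lborel. (- frechet_derivative f (at z) d) *\<^sub>R u z) = (LINT z|lborel. f z *\<^sub>R v z)"
    unfolding eq by (rule LIMSEQ_unique)
  then show ?thesis by (simp add: minus_equation_iff)
qed

section \<open>Products on lines\<close>

text \<open>Fubini's theorem on \<open>[0, h]\<^sup>2\<close>, split along the diagonal.\<close>

lemma bilinear_primitive:
  fixes prod :: "'a::euclidean_space \<Rightarrow> 'b::euclidean_space \<Rightarrow> 'c::euclidean_space"
  assumes bl: "bounded_bilinear prod"
    and p: "set_integrable lborel {0..h} p" and q: "set_integrable lborel {0..h::real} q"
  shows "prod (LINT s:{0..h}|lborel. p s) (LINT s:{0..h}|lborel. q s) =
    (LINT s:{0..h}|lborel. prod (p s) (LINT t:{0..s}|lborel. q t) + prod (LINT t:{0..s}|lborel. p t) (q s))"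
    and "set_integrable lborel {0..h} (\<lambda>s. prod (p s) (LINT t:{0..s}|lborel. q t))"
    and "set_integrable lborel {0..h} (\<lambda>s. prod (LINT t:{0..s}|lborel. p t) (q s))"
proof -
  interpret bounded_bilinear prod by (rule bl)
  define P where "P s = indicator {0..h} s *\<^sub>R p s" for s
  define Q where "Q s = indicator {0..h} s *\<^sub>R q s" for s
  have iP: "integrable lborel P" and iQ: "integrable lborel Q"
    using p q unfolding P_def[abs_def] Q_def[abs_def] set_integrable_def by blast+
  have Pm [measurable]: "P \<in> borel_measurable borel" using borel_measurable_integrable[OF iP] by simp
  have Qm [measurable]: "Q \<in> borel_measurable borel" using borel_measurable_integrable[OF iQ] by simp
  have pm: "(\<lambda>(s, t). prod (P s) (Q t)) \<in> borel_measurable (lborel \<Otimes>\<^sub>M lborel)"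
  proof -
    have "continuous_on UNIV (\<lambda>x. prod (fst x) (snd x))"
      by (intro continuous_on continuous_intros)
    from borel_measurable_continuous_onI[OF this] have "(\<lambda>x. prod (fst x) (snd x)) \<in> borel_measurable (borel \<Otimes>\<^sub>M borel)"
      by (simp add: borel_prod)
    from measurable_compose[OF _ this, of "\<lambda>(s, t). (P s, Q t)"] show ?thesis
      by (simp add: case_prod_beta)
  qed
  obtain K where K: "0 \<le> K" "\<And>a b. norm (prod a b) \<le> norm a * norm b * K" using nonneg_bounded by blast
  have int: "integrable (lborel \<Otimes>\<^sub>M lborel) (\<lambda>(s, t). prod (P s) (Q t))"
  proof (rule Bochner_Integration.integrable_bound[OF _ pm])
    show "integrable (lborel \<Otimes>\<^sub>M lborel) (\<lambda>(s, t). norm (P s) * norm (Q t) * K)"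
    proof (rule lborel_pair.Fubini_integrable)
      show "integrable lborel (\<lambda>s. LINT t|lborel. norm (case (s, t) of (s, t) \<Rightarrow> norm (P s) * norm (Q t) * K))"
        using iP K(1) by (simp add: abs_mult)
      show "AE s in lborel. integrable lborel (\<lambda>t. case (s, t) of (s, t) \<Rightarrow> norm (P s) * norm (Q t) * K)"
        using iQ by simp
    qed measurable
    show "AE x in lborel \<Otimes>\<^sub>M lborel. norm (case x of (s, t) \<Rightarrow> prod (P s) (Q t)) \<le> norm (case x of (s, t) \<Rightarrow> norm (P s) * norm (Q t) * K)"
      using K by (auto intro!: AE_I2 simp: abs_mult)
  qed
  define I1 where "I1 s t = (indicator {t. t \<le> s} t :: real) *\<^sub>R prod (P s) (Q t)" for s t
  define I2 where "I2 s t = (indicator {t. s < t} t :: real) *\<^sub>R prod (P s) (Q t)" for s t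
  have int1: "integrable (lborel \<Otimes>\<^sub>M lborel) (case_prod I1)"
    by (rule Bochner_Integration.integrable_bound[OF int])
       (use pm in \<open>auto simp: I1_def[abs_def] case_prod_beta split: split_indicator intro!: AE_I2 borel_measurable_scaleR\<close>)
  have int2: "integrable (lborel \<Otimes>\<^sub>M lborel) (case_prod I2)"
    by (rule Bochner_Integration.integrable_bound[OF int])
       (use pm in \<open>auto simp: I2_def[abs_def] case_prod_beta split: split_indicator intro!: AE_I2 borel_measurable_scaleR\<close>)
  have e1: "(LINT t|lborel. I1 s t) = indicator {0..h} s *\<^sub>R prod (p s) (LINT t:{0..s}|lborel. q t)" for s
  proof (cases "s \<in> {0..h}")
    case True
    have "I1 s t = prod (P s) (indicator {0..s} t *\<^sub>R q t)" for t
      using True by (auto simp: I1_def Q_def zero_right split: split_indicator)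
    moreover have "set_integrable lborel {0..s} q" using True by (intro set_integrable_subset[OF q]) auto
    ultimately show ?thesis using True
      by (simp add: set_integrable_def set_lebesgue_integral_def integral_bounded_linear[OF bounded_linear_right] P_def)
  qed (simp add: I1_def P_def zero_left)
  have e2: "(LINT s|lborel. I2 s t) = indicator {0..h} t *\<^sub>R prod (LINT s:{0..t}|lborel. p s) (q t)" for t
  proof (cases "t \<in> {0..h}")
    case True
    have si: "set_integrable lborel {0..t} p" using True by (intro set_integrable_subset[OF p]) auto
    have "I2 s t = prod (indicator {0..<t} s *\<^sub>R p s) (Q t)" for s
      using True by (auto simp: I2_def P_def zero_left split: split_indicator)
    moreover have "set_integrable lborel {0..<t} p" using True by (intro set_integrable_subset[OF p]) auto
    moreover have "(LINT s:{0..<t}|lborel. p s) = (LINT s:{0..t}|lborel. p s)"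
    proof (rule set_integral_cong_set)
      have "AE s in lborel. s \<noteq> t" by (rule AE_lborel_singleton)
      then show "AE x in lborel. (x \<in> {0..t}) = (x \<in> {0..<t})" by eventually_elim auto
    qed (use si calculation(2) in \<open>auto simp: set_integrable_def set_borel_measurable_def\<close>)
    ultimately show ?thesis using True
      by (simp add: set_integrable_def set_lebesgue_integral_def integral_bounded_linear[OF bounded_linear_left] Q_def)
  qed (simp add: I2_def Q_def zero_right)
  show s1: "set_integrable lborel {0..h} (\<lambda>s. prod (p s) (LINT t:{0..s}|lborel. q t))"
    using lborel_pair.integrable_fst[OF int1] unfolding e1 set_integrable_def .
  show s2: "set_integrable lborel {0..h} (\<lambda>s. prod (LINT t:{0..s}|lborel. p t) (q s))"
    using lborel_pair.integrable_snd[OF int2] unfolding e2 set_integrable_def .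
  have "prod (LINT s:{0..h}|lborel. p s) (LINT s:{0..h}|lborel. q s) = prod (LINT s|lborel. P s) (LINT t|lborel. Q t)"
    by (simp add: P_def Q_def set_lebesgue_integral_def)
  also have "\<dots> = (LINT s|lborel. prod (P s) (LINT t|lborel. Q t))"
    by (rule integral_bounded_linear[OF bounded_linear_left iP, symmetric])
  also have "\<dots> = (LINT s|lborel. LINT t|lborel. prod (P s) (Q t))"
    by (simp add: integral_bounded_linear[OF bounded_linear_right iQ])
  also have "\<dots> = integral\<^sup>L (lborel \<Otimes>\<^sub>M lborel) (\<lambda>(s, t). prod (P s) (Q t))"
    by (rule lborel_pair.integral_fst[OF int])
  also have "\<dots> = (LINT x|(lborel \<Otimes>\<^sub>M lborel). case_prod I1 x + case_prod I2 x)"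
    by (intro Bochner_Integration.integral_cong) (auto simp: I1_def I2_def split: split_indicator)
  also have "\<dots> = (LINT s|lborel. LINT t|lborel. I1 s t) + (LINT t|lborel. LINT s|lborel. I2 s t)"
    using int1 int2 lborel_pair.integral_fst[OF int1] lborel_pair.integral_snd[OF int2] by simp
  also have "\<dots> = (LINT s:{0..h}|lborel. prod (p s) (LINT t:{0..s}|lborel. q t)) + (LINT t:{0..h}|lborel. prod (LINT s:{0..t}|lborel. p s) (q t))"
    by (simp add: e1 e2 set_lebesgue_integral_def)
  also have "\<dots> = (LINT s:{0..h}|lborel. prod (p s) (LINT t:{0..s}|lborel. q t) + prod (LINT t:{0..s}|lborel. p t) (q s))"
    by (rule set_integral_add(2)[symmetric, OF s1 s2])
  finally show "prod (LINT s:{0..h}|lborel. p s) (LINT s:{0..h}|lborel. q s) =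
    (LINT s:{0..h}|lborel. prod (p s) (LINT t:{0..s}|lborel. q t) + prod (LINT t:{0..s}|lborel. p t) (q s))" .
qed

lemma borel_measurable_bilinear:
  fixes prod :: "'a::euclidean_space \<Rightarrow> 'b::euclidean_space \<Rightarrow> 'c::euclidean_space"
  assumes bl: "bounded_bilinear prod" and "f \<in> borel_measurable M" "g \<in> borel_measurable M"
  shows "(\<lambda>x. prod (f x) (g x)) \<in> borel_measurable M"
proof (rule borel_measurable_continuous_Pair[OF assms(2,3)])
  interpret bounded_bilinear prod by (rule bl)
  show "continuous_on UNIV (\<lambda>x. prod (fst x) (snd x))"
    by (intro continuous_on continuous_intros)
qed

text \<open>The null set in the assumption depends on \<open>h\<close>. Fubini's theorem turns one
  null set for each of uncountably many \<open>h\<close> into a single null set of base points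
  \<open>z\<close>, at the cost of a null set of \<open>h\<close> on each line. This needs joint
  measurability of the line integral in z and h.\<close>

lemma line_AE_all:
  fixes u v :: "'a::euclidean_space \<Rightarrow> 'b::euclidean_space"
  assumes iu: "integrable lborel u" and iv: "integrable lborel v" and V: "open V"
    and line: "\<And>h. 0 \<le> h \<Longrightarrow> h \<le> \<delta> \<Longrightarrow> AE z\<in>V in lborel.
      u (z + h *\<^sub>R d) = u z + (LINT s:{0..h}|lborel. v (z + s *\<^sub>R d))"
  shows "AE z in lborel. AE h in lborel. z \<in> V \<and> 0 \<le> h \<and> h \<le> \<delta> \<longrightarrow>
      u (z + h *\<^sub>R d) = u z + (LINT s:{0..h}|lborel. v (z + s *\<^sub>R d))"
proof (subst lborel_pair.AE_commute)
  have [measurable]: "u \<in> borel_measurable borel" using borel_measurable_integrable[OF iu] by simp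
  have [measurable]: "v \<in> borel_measurable borel" using borel_measurable_integrable[OF iv] by simp
  have [measurable]: "V \<in> sets borel" using V by simp
  have [measurable]: "(\<lambda>x. LINT s:{0..snd x}|lborel. v (fst x + s *\<^sub>R d)) \<in> borel_measurable (lborel \<Otimes>\<^sub>M lborel)"
  proof -
    \<comment> \<open>The moving interval of integration is written as a condition on the triple, so
      that the integrand is visibly measurable in all three variables before one of them is
      integrated out.\<close>
    have "(\<lambda>y. (if 0 \<le> snd y \<and> snd y \<le> snd (fst y) then 1 else 0 :: real) *\<^sub>R v (fst (fst y) + snd y *\<^sub>R d))
        \<in> borel_measurable ((lborel \<Otimes>\<^sub>M lborel) \<Otimes>\<^sub>M lborel)"
      by measurable
    then have "(\<lambda>x. LINT s|lborel. (if 0 \<le> s \<and> s \<le> snd x then 1 else 0 :: real) *\<^sub>R v (fst x + s *\<^sub>R d))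
        \<in> borel_measurable (lborel \<Otimes>\<^sub>M lborel)"
      by (intro lborel.borel_measurable_lebesgue_integral) (simp add: case_prod_beta)
    then show ?thesis by (simp add: set_lebesgue_integral_def indicator_def if_distrib cong: if_cong)
  qed
  show "{x \<in> space (lborel \<Otimes>\<^sub>M lborel). fst x \<in> V \<and> 0 \<le> snd x \<and> snd x \<le> \<delta> \<longrightarrow>
      u (fst x + snd x *\<^sub>R d) = u (fst x) + (LINT s:{0..snd x}|lborel. v (fst x + s *\<^sub>R d))}
      \<in> sets (lborel \<Otimes>\<^sub>M lborel)"
    by measurable
  show "AE h in lborel. AE z in lborel. z \<in> V \<and> 0 \<le> h \<and> h \<le> \<delta> \<longrightarrow>
      u (z + h *\<^sub>R d) = u z + (LINT s:{0..h}|lborel. v (z + s *\<^sub>R d))"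
  proof (rule AE_I2)
    fix h
    show "AE z in lborel. z \<in> V \<and> 0 \<le> h \<and> h \<le> \<delta> \<longrightarrow>
      u (z + h *\<^sub>R d) = u z + (LINT s:{0..h}|lborel. v (z + s *\<^sub>R d))"
      using line[of h] by (cases "0 \<le> h \<and> h \<le> \<delta>") auto
  qed
qed

text \<open>On almost every line \<open>u\<close> and \<open>v\<close> are constants plus
  primitives. Expanding the product leaves terms linear in one primitive and the product of the two
  primitives, which \<open>bilinear_primitive\<close> rewrites as an integral.\<close>

lemma line_product:
  fixes prod :: "'a::euclidean_space \<Rightarrow> 'b::euclidean_space \<Rightarrow> 'c::euclidean_space"
    and u u' :: "'d::euclidean_space \<Rightarrow> 'a" and v v' :: "'d \<Rightarrow> 'b"
  assumes bl: "bounded_bilinear prod"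
    and int: "integrable lborel u" "integrable lborel u'" "integrable lborel v" "integrable lborel v'"
    and V: "open V"
    and lu: "\<And>h. 0 \<le> h \<Longrightarrow> h \<le> \<delta> \<Longrightarrow> AE z\<in>V in lborel.
      u (z + h *\<^sub>R d) = u z + (LINT s:{0..h}|lborel. u' (z + s *\<^sub>R d))"
    and lv: "\<And>h. 0 \<le> h \<Longrightarrow> h \<le> \<delta> \<Longrightarrow> AE z\<in>V in lborel.
      v (z + h *\<^sub>R d) = v z + (LINT s:{0..h}|lborel. v' (z + s *\<^sub>R d))"
    and h: "0 \<le> h" "h \<le> \<delta>"
  shows "AE z\<in>V in lborel. prod (u (z + h *\<^sub>R d)) (v (z + h *\<^sub>R d)) = prod (u z) (v z) +
      (LINT s:{0..h}|lborel. prod (u' (z + s *\<^sub>R d)) (v (z + s *\<^sub>R d)) + prod (u (z + s *\<^sub>R d)) (v' (z + s *\<^sub>R d)))"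
proof -
  note ae1 = line_AE_all[where \<delta> = \<delta> and d = d, OF int(1,2) V lu, simplified]
  note ae2 = line_AE_all[where \<delta> = \<delta> and d = d, OF int(3,4) V lv, simplified]
  show ?thesis
  using lu[OF h] lv[OF h] ae1 ae2
    AE_line_integrable[OF int(2), of h d] AE_line_integrable[OF int(4), of h d]
proof eventually_elim
  case (elim z)
  interpret bounded_bilinear prod by (rule bl)
  have um [measurable]: "u \<in> borel_measurable borel" using borel_measurable_integrable[OF int(1)] by simp
  have um' [measurable]: "u' \<in> borel_measurable borel" using borel_measurable_integrable[OF int(2)] by simp
  have vm [measurable]: "v \<in> borel_measurable borel" using borel_measurable_integrable[OF int(3)] by simp
  have vm' [measurable]: "v' \<in> borel_measurable borel" using borel_measurable_integrable[OF int(4)] by simp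
  show ?case
  proof
    assume z: "z \<in> V"
    define p where "p s = u' (z + s *\<^sub>R d)" for s
    define q where "q s = v' (z + s *\<^sub>R d)" for s
    define P where "P s = (LINT t:{0..s}|lborel. p t)" for s
    define Q where "Q s = (LINT t:{0..s}|lborel. q t)" for s
    have ip: "set_integrable lborel {0..h} p" and iq: "set_integrable lborel {0..h} q"
      using elim(5,6) by (simp_all add: p_def[abs_def] q_def[abs_def])
    note bp = bilinear_primitive[OF bl ip iq, folded P_def Q_def]
    have i1: "set_integrable lborel {0..h} (\<lambda>s. prod (u z) (q s))"
      using integrable_bounded_linear[OF bounded_linear_right iq[unfolded set_integrable_def], of "u z"]
      by (simp add: set_integrable_def scaleR_right)
    have i2: "set_integrable lborel {0..h} (\<lambda>s. prod (p s) (v z))"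
      using integrable_bounded_linear[OF bounded_linear_left ip[unfolded set_integrable_def], of "v z"]
      by (simp add: set_integrable_def scaleR_left)
    have e1: "(LINT s:{0..h}|lborel. prod (u z) (q s)) = prod (u z) (Q h)"
      using integral_bounded_linear[OF bounded_linear_right iq[unfolded set_integrable_def], of "u z"]
      by (simp add: set_lebesgue_integral_def scaleR_right Q_def)
    have e2: "(LINT s:{0..h}|lborel. prod (p s) (v z)) = prod (P h) (v z)"
      using integral_bounded_linear[OF bounded_linear_left ip[unfolded set_integrable_def], of "v z"]
      by (simp add: set_lebesgue_integral_def scaleR_left P_def)
    have i3: "set_integrable lborel {0..h} (\<lambda>s. prod (p s) (v z + Q s))"
      using set_integral_add(1)[OF i2 bp(2)] by (simp add: add_right)
    have i4: "set_integrable lborel {0..h} (\<lambda>s. prod (u z + P s) (q s))"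
      using set_integral_add(1)[OF i1 bp(3)] by (simp add: add_left)
    have "prod (u (z + h *\<^sub>R d)) (v (z + h *\<^sub>R d)) = prod (u z + P h) (v z + Q h)"
      using elim(1,2) z by (simp add: P_def Q_def p_def q_def)
    also have "\<dots> = prod (u z) (v z) + ((prod (P h) (v z) + prod (u z) (Q h)) + prod (P h) (Q h))"
      by (simp add: add_left add_right)
    also have "(prod (P h) (v z) + prod (u z) (Q h)) + prod (P h) (Q h) =
        (LINT s:{0..h}|lborel. prod (p s) (v z + Q s)) + (LINT s:{0..h}|lborel. prod (u z + P s) (q s))"
      unfolding bp(1) e1[symmetric] e2[symmetric] add_left add_right
      using i1 i2 bp(2,3) by (simp add: set_integral_add)
    also have "\<dots> = (LINT s:{0..h}|lborel. prod (p s) (v z + Q s) + prod (u z + P s) (q s))"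
      by (rule set_integral_add(2)[OF i3 i4, symmetric])
    \<comment> \<open>At intermediate points the formula is known only for almost every
      \<open>s\<close>, which is enough under the integral sign.\<close>
    also have "\<dots> = (LINT s:{0..h}|lborel. prod (p s) (v (z + s *\<^sub>R d)) + prod (u (z + s *\<^sub>R d)) (q s))"
      unfolding set_lebesgue_integral_def
    proof (rule integral_cong_AE)
      show "(\<lambda>s. indicator {0..h} s *\<^sub>R (prod (p s) (v z + Q s) + prod (u z + P s) (q s))) \<in> borel_measurable lborel"
        by (rule borel_measurable_integrable[OF set_integral_add(1)[OF i3 i4, unfolded set_integrable_def]])
      have "(\<lambda>s. prod (p s) (v (z + s *\<^sub>R d))) \<in> borel_measurable lborel" "(\<lambda>s. prod (u (z + s *\<^sub>R d)) (q s)) \<in> borel_measurable lborel"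
        unfolding p_def q_def by (rule borel_measurable_bilinear[OF bl]; measurable)+
      then show "(\<lambda>s. indicator {0..h} s *\<^sub>R (prod (p s) (v (z + s *\<^sub>R d)) + prod (u (z + s *\<^sub>R d)) (q s))) \<in> borel_measurable lborel"
        by measurable
      show "AE s in lborel. indicator {0..h} s *\<^sub>R (prod (p s) (v z + Q s) + prod (u z + P s) (q s)) =
          indicator {0..h} s *\<^sub>R (prod (p s) (v (z + s *\<^sub>R d)) + prod (u (z + s *\<^sub>R d)) (q s))"
        using elim(3,4)
      proof eventually_elim
        case (elim s)
        show ?case
        proof (cases "s \<in> {0..h}")
          case True
          then have "u (z + s *\<^sub>R d) = u z + P s" "v (z + s *\<^sub>R d) = v z + Q s"
            using elim z h(2) by (auto simp: P_def Q_def p_def q_def)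
          then show ?thesis by simp
        qed simp
      qed
    qed
    finally show "prod (u (z + h *\<^sub>R d)) (v (z + h *\<^sub>R d)) = prod (u z) (v z) +
      (LINT s:{0..h}|lborel. prod (u' (z + s *\<^sub>R d)) (v (z + s *\<^sub>R d)) + prod (u (z + s *\<^sub>R d)) (v' (z + s *\<^sub>R d)))"
      by (simp add: p_def q_def)
  qed
qed
qed

section \<open>Weak derivatives on open sets\<close>

text \<open>The Sobolev classes are defined with Lebesgue measurability, whereas composing with (z,
  s) -> z + s d and applying Fubini's theorem calls for Borel functions. The representative is
  assembled from real coordinates in the finite basis.\<close>

lemma lebesgue_measurable_borel_rep:
  fixes f :: "'a::euclidean_space \<Rightarrow> 'b::euclidean_space"
  assumes "f \<in> borel_measurable lebesgue"
  shows "\<exists>g\<in>borel_measurable borel. AE z in lborel. f z = g z"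
proof -
  have "\<exists>g\<in>borel_measurable lborel. AE z in lborel. f z \<bullet> b = g z" for b
    using assms by (intro completion_ex_borel_measurable_real borel_measurable_inner) auto
  then have "\<exists>g. g \<in> borel_measurable borel \<and> (AE z in lborel. f z \<bullet> b = g z)" for b
    by (simp add: Bex_def)
  then obtain g where g: "\<And>b. g b \<in> borel_measurable borel" "\<And>b. AE z in lborel. f z \<bullet> b = g b z"
    by metis
  have "AE z in lborel. \<forall>b\<in>Basis. f z \<bullet> b = g b z"
    using g(2) by (simp add: AE_ball_countable countable_finite)
  then have "AE z in lborel. f z = (\<Sum>b\<in>Basis. g b z *\<^sub>R b)"
  proof eventually_elim
    case (elim z)
    then show ?case by (subst euclidean_representation[symmetric]) simp
  qed
  moreover have "(\<lambda>z. \<Sum>b\<in>Basis. g b z *\<^sub>R b) \<in> borel_measurable borel"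
    using g(1) by measurable
  ultimately show ?thesis by (rule bexI)
qed

text \<open>Multiplying by the indicator of K makes a locally integrable function globally
  integrable, so all arguments along lines can be made for integrable Borel functions on the whole
  plane.\<close>

lemma L1_loc_rep:
  fixes u :: "complex \<Rightarrow> 'b::euclidean_space"
  assumes u: "L1_loc S u" and K: "compact K" "K \<subseteq> S"
  shows "\<exists>u0. (AE z\<in>K in lborel. u0 z = u z) \<and> integrable lborel u0"
proof -
  have iu: "integrable lebesgue (\<lambda>z. indicator K z *\<^sub>R u z)"
    using u K by (auto simp: L1_loc_def set_integrable_def)
  from lebesgue_measurable_borel_rep[OF borel_measurable_integrable[OF this]]
  obtain g where g: "g \<in> borel_measurable borel" "AE z in lborel. indicator K z *\<^sub>R u z = g z" by blast
  have "integrable lebesgue g"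
    by (rule integrable_cong_AE_imp[OF iu]) (use g in \<open>auto intro: AE_completion measurable_completion elim!: eventually_mono\<close>)
  then have "integrable lborel g" using g(1) by (simp add: integrable_completion)
  moreover have "AE z\<in>K in lborel. g z = u z" using g(2) by eventually_elim (auto simp: indicator_def)
  ultimately show ?thesis by blast
qed

text \<open>The weight \<open>g\<close> vanishes off K, so a representative that is valid on K alone
  computes the integral over S.\<close>

lemma integral_rep:
  fixes u u0 :: "complex \<Rightarrow> 'b::euclidean_space"
  assumes ae: "AE z\<in>K in lborel. u0 z = u z" and u0: "integrable lborel u0"
    and K: "K \<subseteq> S" and g: "g \<in> borel_measurable borel" "\<And>z. z \<notin> K \<Longrightarrow> g z = 0"
  shows "(LINT z:S|lebesgue. g z *\<^sub>R u z) = (LINT z|lborel. g z *\<^sub>R u0 z)"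
proof -
  note [measurable] = g(1)
  have [measurable]: "u0 \<in> borel_measurable borel" using borel_measurable_integrable[OF u0] by simp
  have m: "(\<lambda>z. g z *\<^sub>R u0 z) \<in> borel_measurable lborel" by measurable
  have "AE z in lborel. g z *\<^sub>R u0 z = indicator S z *\<^sub>R g z *\<^sub>R u z"
    using ae
  proof eventually_elim
    case (elim z)
    then show ?case using K g(2)[of z] by (cases "z \<in> K") auto
  qed
  then have ae2: "AE z in lebesgue. g z *\<^sub>R u0 z = indicator S z *\<^sub>R g z *\<^sub>R u z" by (rule AE_completion)
  have "(LINT z:S|lebesgue. g z *\<^sub>R u z) = (LINT z|lebesgue. g z *\<^sub>R u0 z)"
    unfolding set_lebesgue_integral_def
    by (rule integral_cong_AE)
       (use m ae2 borel_measurable_AE[OF measurable_completion[OF m] ae2] in \<open>auto intro: measurable_completion elim!: eventually_mono\<close>)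
  also have "\<dots> = (LINT z|lborel. g z *\<^sub>R u0 z)" by (rule integral_completion[OF m])
  finally show ?thesis .
qed

lemma weak_deriv_rep:
  fixes u v :: "complex \<Rightarrow> 'b::euclidean_space"
  assumes wd: "has_weak_deriv S d u v" and d: "d \<in> {1, \<i>}"
    and u0: "AE z\<in>K in lborel. u0 z = u z" "integrable lborel u0"
    and v0: "AE z\<in>K in lborel. v0 z = v z" "integrable lborel v0"
    and K: "K \<subseteq> S" and W: "W \<subseteq> K" and f: "test_function W f"
  shows "(LINT z|lborel. frechet_derivative f (at z) d *\<^sub>R u0 z) = - (LINT z|lborel. f z *\<^sub>R v0 z)"
proof -
  have m: "f \<in> borel_measurable borel" "(\<lambda>z. frechet_derivative f (at z) d) \<in> borel_measurable borel"
    by (rule borel_measurable_continuous_onI test_function_continuous[OF f] test_function_deriv_continuous[OF f d])+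
  have fK: "test_function K f" by (rule test_function_mono[OF f W])
  have fS: "test_function S f" by (rule test_function_mono[OF fK K])
  show ?thesis
    using integral_rep[OF u0 K m(2) test_function_deriv_zero[OF fK]] integral_rep[OF v0 K m(1) test_function_zero[OF fK]]
      wd[unfolded has_weak_deriv_def] fS by simp
qed

text \<open>Sublevel sets of the distance to K: radius e/2 for V, radius e for W, and the closed
  version of W for L. A step of length at most \<delta> = e/2 in a unit direction leads from V into
  W.\<close>

lemma compact_neighbourhoods:
  fixes K :: "complex set"
  assumes K: "compact K" "K \<subseteq> S" and S: "open S"
  obtains V W L \<delta> where "open V" "K \<subseteq> V" "V \<subseteq> W" "W \<subseteq> L" "compact L" "L \<subseteq> S" "0 < \<delta>"
    "\<And>z s d. z \<in> V \<Longrightarrow> norm d = 1 \<Longrightarrow> 0 \<le> s \<Longrightarrow> s \<le> \<delta> \<Longrightarrow> z + s *\<^sub>R d \<in> W"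
proof (cases "K = {}")
  case True
  \<comment> \<open>The distance to an empty set carries no information, so empty neighbourhoods are
    taken.\<close>
  then show thesis by (intro that[of "{}" "{}" "{}" 1]) auto
next
  case False
  obtain e where e: "0 < e" "{z. infdist z K \<le> e} \<subseteq> S"
    using compact_in_open_separated[OF False K(1) S K(2)] by blast
  show thesis
  proof (rule that[of "{z. infdist z K < e / 2}" "{z. infdist z K < e}" "{z. infdist z K \<le> e}" "e / 2"])
    show "open {z. infdist z K < e / 2}" by (intro open_Collect_less continuous_intros)
    show "compact {z. infdist z K \<le> e}" by (rule compact_infdist_le[OF False K(1) e(1)])
    fix z d :: complex and s :: real
    assume "z \<in> {z. infdist z K < e / 2}" "norm d = 1" "0 \<le> s" "s \<le> e / 2"
    then show "z + s *\<^sub>R d \<in> {z. infdist z K < e}"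
      using infdist_triangle[of "z + s *\<^sub>R d" K z] by (simp add: dist_norm)
  qed (use e in auto)
qed

lemma AE_on_open:
  fixes S :: "'a::euclidean_space set"
  assumes S: "open S" and P: "\<And>K. compact K \<Longrightarrow> K \<subseteq> S \<Longrightarrow> AE z\<in>K in M. P z"
  shows "AE z\<in>S in M. P z"
proof -
  obtain D where D: "countable D" "D \<subseteq> Pow S" "\<And>X. X \<in> D \<Longrightarrow> \<exists>a b. X = cbox a b" "\<Union>D = S"
    using open_countable_Union_open_cbox[OF S] by metis
  have "AE z in M. \<forall>X\<in>D. z \<in> X \<longrightarrow> P z"
    unfolding AE_ball_countable[OF D(1)]
  proof
    fix X assume X: "X \<in> D"
    then have "compact X" using D(3) compact_cbox by blast
    moreover have "X \<subseteq> S" using X D(2) by blast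
    ultimately show "AE z\<in>X in M. P z" by (rule P)
  qed
  then show ?thesis using D(4) by (auto elim!: eventually_mono)
qed

text \<open>Two weak derivatives pair equally with every test function, so the fundamental lemma
  applies to the difference of their integrable representatives near each compact set.\<close>

lemma weak_deriv_unique:
  fixes u v :: "complex \<Rightarrow> 'b::euclidean_space"
  assumes wd: "has_weak_deriv S d u v" "has_weak_deriv S d u v'" and S: "open S"
  shows "AE z\<in>S in lebesgue. v z = v' z"
proof (rule AE_on_open[OF S])
  fix K assume K: "compact K" "K \<subseteq> S"
  obtain V W L \<delta> where V: "open V" "K \<subseteq> V" "V \<subseteq> W" "W \<subseteq> L" "compact L" "L \<subseteq> S"
    using compact_neighbourhoods[OF K S] by metis
  obtain v0 where v0: "integrable lborel v0" "AE z\<in>L in lborel. v0 z = v z"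
    using L1_loc_rep[of S v L] wd(1) V by (auto simp: has_weak_deriv_def)
  obtain v1 where v1: "integrable lborel v1" "AE z\<in>L in lborel. v1 z = v' z"
    using L1_loc_rep[of S v' L] wd(2) V by (auto simp: has_weak_deriv_def)
  have "AE z\<in>V in lborel. v0 z - v1 z = 0"
  proof (rule AE_zero_if_test_integrals_zero[OF Bochner_Integration.integrable_diff[OF v0(1) v1(1)] V(1)])
    fix f g a b p q
    assume fg: "\<And>n. Cn n f" "\<And>n. Cn n g" "\<And>x. x \<notin> {a..b} \<Longrightarrow> f x = 0" "\<And>y. y \<notin> {p..q} \<Longrightarrow> g y = 0"
      "cbox (Complex a p) (Complex b q) \<subseteq> V"
    let ?F = "\<lambda>z. f (Re z) * g (Im z)"
    have tV: "test_function V ?F" by (rule test_function_prod[OF fg])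
    then have tL: "test_function L ?F" by (rule test_function_mono) (use V in auto)
    then have tS: "test_function S ?F" by (rule test_function_mono) (use V in auto)
    obtain C where C: "\<And>z. \<bar>?F z\<bar> \<le> C" using test_function_bounded[OF tV] by blast
    have m: "?F \<in> borel_measurable borel"
      by (rule borel_measurable_continuous_onI[OF test_function_continuous[OF tV]])
    have "(LINT z|lborel. ?F z *\<^sub>R v0 z) = (LINT z|lborel. ?F z *\<^sub>R v1 z)"
      using integral_rep[OF v0(2,1) V(6) m test_function_zero[OF tL]]
        integral_rep[OF v1(2,1) V(6) m test_function_zero[OF tL]] wd tS
      unfolding has_weak_deriv_def by (metis neg_equal_iff_equal)
    then show "(LINT z|lborel. ?F z *\<^sub>R (v0 z - v1 z)) = 0"
      using integrable_test_mult[OF v0(1) m C] integrable_test_mult[OF v1(1) m C]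
      by (simp add: scaleR_diff_right)
  qed
  with v0(2) v1(2) have "AE z\<in>K in lborel. v z = v' z"
    by eventually_elim (use V in auto)
  then show "AE z\<in>K in lebesgue. v z = v' z" by (rule AE_completion)
qed

lemma has_weak_deriv_lines:
  fixes u v :: "complex \<Rightarrow> 'b::euclidean_space"
  assumes wd: "has_weak_deriv S d u v" and d: "d \<in> {1, \<i>}"
    and u0: "AE z\<in>L in lborel. u0 z = u z" "integrable lborel u0"
    and v0: "AE z\<in>L in lborel. v0 z = v z" "integrable lborel v0"
    and L: "L \<subseteq> S" and W: "W \<subseteq> L" and V: "open V"
    and VW: "\<And>z s d. z \<in> V \<Longrightarrow> norm d = 1 \<Longrightarrow> 0 \<le> s \<Longrightarrow> s \<le> \<delta> \<Longrightarrow> z + s *\<^sub>R d \<in> W"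
    and h: "0 \<le> h" "h \<le> \<delta>"
  shows "AE z\<in>V in lborel. u0 (z + h *\<^sub>R d) = u0 z + (LINT s:{0..h}|lborel. v0 (z + s *\<^sub>R d))"
proof (rule weak_deriv_imp_line[OF d u0(2) v0(2) _ V h(1)])
  show "(LINT z|lborel. frechet_derivative f (at z) d *\<^sub>R u0 z) = - (LINT z|lborel. f z *\<^sub>R v0 z)"
    if "test_function W f" for f
    by (rule weak_deriv_rep[OF wd d u0 v0 L W that])
  show "z + s *\<^sub>R d \<in> W" if "z \<in> V" "0 \<le> s" "s \<le> h" for z s
    using that VW[of z d s] d h by auto
qed

text \<open>Both factors are converted to the formula along lines, multiplied there, and converted
  back. No limit of approximating products is taken, so local integrability of the product and of
  its expected derivative is all that is asked beyond the two weak derivatives.\<close>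

lemma has_weak_deriv_prod:
  fixes prod :: "'a::euclidean_space \<Rightarrow> 'b::euclidean_space \<Rightarrow> 'c::euclidean_space"
  assumes bl: "bounded_bilinear prod" and S: "open S" and d: "d \<in> {1, \<i>}"
    and u: "has_weak_deriv S d u u'" and v: "has_weak_deriv S d v v'"
    and w: "L1_loc S (\<lambda>z. prod (u z) (v z))" and w': "L1_loc S (\<lambda>z. prod (u' z) (v z) + prod (u z) (v' z))"
  shows "has_weak_deriv S d (\<lambda>z. prod (u z) (v z)) (\<lambda>z. prod (u' z) (v z) + prod (u z) (v' z))"
  unfolding has_weak_deriv_def
proof (intro conjI w w' allI impI)
  fix f assume f: "test_function S f"
  obtain K where K: "compact K" "K \<subseteq> S" "\<And>z. z \<notin> K \<Longrightarrow> f z = 0" using f by (auto simp: test_function_def)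
  obtain V W L \<delta> where V: "open V" "K \<subseteq> V" "V \<subseteq> W" "W \<subseteq> L" "compact L" "L \<subseteq> S" "0 < \<delta>"
    and VW: "\<And>z s d. z \<in> V \<Longrightarrow> norm d = 1 \<Longrightarrow> 0 \<le> s \<Longrightarrow> s \<le> \<delta> \<Longrightarrow> z + s *\<^sub>R d \<in> W"
    using compact_neighbourhoods[OF K(1,2) S] by metis
  have fV: "test_function V f" using f K V(2) by (auto simp: test_function_def)
  have fL: "test_function L f" by (rule test_function_mono[OF fV]) (use V in auto)
  obtain u0 where u0: "AE z\<in>L in lborel. u0 z = u z" "integrable lborel u0"
    using L1_loc_rep[of S u L] u V by (auto simp: has_weak_deriv_def)
  obtain u1 where u1: "AE z\<in>L in lborel. u1 z = u' z" "integrable lborel u1"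
    using L1_loc_rep[of S u' L] u V by (auto simp: has_weak_deriv_def)
  obtain v0 where v0: "AE z\<in>L in lborel. v0 z = v z" "integrable lborel v0"
    using L1_loc_rep[of S v L] v V by (auto simp: has_weak_deriv_def)
  obtain v1 where v1: "AE z\<in>L in lborel. v1 z = v' z" "integrable lborel v1"
    using L1_loc_rep[of S v' L] v V by (auto simp: has_weak_deriv_def)
  obtain w0 where w0: "AE z\<in>L in lborel. w0 z = prod (u z) (v z)" "integrable lborel w0"
    using L1_loc_rep[OF w V(5,6)] by blast
  obtain w1 where w1: "AE z\<in>L in lborel. w1 z = prod (u' z) (v z) + prod (u z) (v' z)" "integrable lborel w1"
    using L1_loc_rep[OF w' V(5,6)] by blast
  have m: "f \<in> borel_measurable borel" "(\<lambda>z. frechet_derivative f (at z) d) \<in> borel_measurable borel"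
    by (rule borel_measurable_continuous_onI test_function_continuous[OF f] test_function_deriv_continuous[OF f d])+
  have um: "u0 \<in> borel_measurable borel" "v0 \<in> borel_measurable borel" "u1 \<in> borel_measurable borel" "v1 \<in> borel_measurable borel" "w1 \<in> borel_measurable borel"
    using borel_measurable_integrable[OF u0(2)] borel_measurable_integrable[OF v0(2)] borel_measurable_integrable[OF u1(2)]
      borel_measurable_integrable[OF v1(2)] borel_measurable_integrable[OF w1(2)] by simp_all
  have A: "AE z\<in>L in lborel. w0 z = prod (u0 z) (v0 z)"
    using u0(1) v0(1) w0(1) by eventually_elim auto
  have B: "AE z\<in>L in lborel. w1 z = prod (u1 z) (v0 z) + prod (u0 z) (v1 z)"
    using u0(1) v0(1) u1(1) v1(1) w1(1) by eventually_elim auto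
  have "(LINT z|lborel. frechet_derivative f (at z) d *\<^sub>R w0 z) = - (LINT z|lborel. f z *\<^sub>R w1 z)"
  proof (rule line_imp_weak_deriv[OF d w0(2) w1(2) fV V(7)])
    fix h assume h: "0 \<le> h" "h \<le> \<delta>"
    have lu: "AE z\<in>V in lborel. u0 (z + h *\<^sub>R d) = u0 z + (LINT s:{0..h}|lborel. u1 (z + s *\<^sub>R d))"
      if "0 \<le> h" "h \<le> \<delta>" for h by (rule has_weak_deriv_lines[OF u d u0 u1 V(6,4,1) VW that])
    have lv: "AE z\<in>V in lborel. v0 (z + h *\<^sub>R d) = v0 z + (LINT s:{0..h}|lborel. v1 (z + s *\<^sub>R d))"
      if "0 \<le> h" "h \<le> \<delta>" for h by (rule has_weak_deriv_lines[OF v d v0 v1 V(6,4,1) VW that])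
    note lp = line_product[where \<delta> = \<delta> and d = d and h = h, OF bl u0(2) u1(2) v0(2) v1(2) V(1) lu lv h, simplified]
    \<comment> \<open>The representatives \<open>w0\<close> and \<open>w1\<close> match the product
      and the Leibniz expression only almost everywhere on L. The match is needed at z, at z + h d,
      and for \<open>w1\<close> at almost every point of the segment, hence the three forms of
      shifting below.\<close>
    show "AE z\<in>V in lborel. w0 (z + h *\<^sub>R d) = w0 z + (LINT s:{0..h}|lborel. w1 (z + s *\<^sub>R d))"
      using lp A AE_lborel_shift[OF A, of "h *\<^sub>R d"]
        AE_lborel_shift_line[OF B, of d]
    proof eventually_elim
      case (elim z)
      show ?case
      proof
        assume z: "z \<in> V"
        have in_L: "z + s *\<^sub>R d \<in> L" if "0 \<le> s" "s \<le> h" for s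
          using VW[OF z, of d s] that h d V(4) by auto
        have "(LINT s:{0..h}|lborel. prod (u1 (z + s *\<^sub>R d)) (v0 (z + s *\<^sub>R d)) + prod (u0 (z + s *\<^sub>R d)) (v1 (z + s *\<^sub>R d))) =
            (LINT s:{0..h}|lborel. w1 (z + s *\<^sub>R d))"
        proof (rule set_lebesgue_integral_cong_AE)
          have s: "(\<lambda>s. z + s *\<^sub>R d) \<in> borel_measurable lborel" by measurable
          show "(\<lambda>s. prod (u1 (z + s *\<^sub>R d)) (v0 (z + s *\<^sub>R d)) + prod (u0 (z + s *\<^sub>R d)) (v1 (z + s *\<^sub>R d))) \<in> borel_measurable lborel"
            by (intro borel_measurable_add borel_measurable_bilinear[OF bl] measurable_compose[OF s] um)
          show "(\<lambda>s. w1 (z + s *\<^sub>R d)) \<in> borel_measurable lborel"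
            by (intro measurable_compose[OF s] um)
          show "AE s\<in>{0..h} in lborel. prod (u1 (z + s *\<^sub>R d)) (v0 (z + s *\<^sub>R d)) + prod (u0 (z + s *\<^sub>R d)) (v1 (z + s *\<^sub>R d)) = w1 (z + s *\<^sub>R d)"
            using elim(4) by eventually_elim (use in_L in auto)
        qed simp
        moreover have "w0 (z + h *\<^sub>R d) = prod (u0 (z + h *\<^sub>R d)) (v0 (z + h *\<^sub>R d))"
          using elim(3) in_L[of h] h by simp
        moreover have "w0 z = prod (u0 z) (v0 z)" using elim(2) in_L[of 0] h by simp
        ultimately show "w0 (z + h *\<^sub>R d) = w0 z + (LINT s:{0..h}|lborel. w1 (z + s *\<^sub>R d))"
          using elim(1) z by simp
      qed
    qed
  qed
  then show "(LINT z:S|lebesgue. frechet_derivative f (at z) d *\<^sub>R prod (u z) (v z)) =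
      - (LINT z:S|lebesgue. f z *\<^sub>R (prod (u' z) (v z) + prod (u z) (v' z)))"
    using integral_rep[OF w0 V(6) m(2) test_function_deriv_zero[OF fL]] integral_rep[OF w1 V(6) m(1) test_function_zero[OF fL]]
    by simp
qed

section \<open>Sobolev inequalities\<close>

text \<open>Lebesgue measure is determined by its values on boxes, and the image of the product
  measure under \<open>Complex\<close> gives a box the product of its side lengths; Tonelli then
  applies.\<close>

lemma nn_integral_lborel_complex:
  fixes G :: "complex \<Rightarrow> ennreal"
  assumes G [measurable]: "G \<in> borel_measurable borel"
  shows "(\<integral>\<^sup>+z. G z \<partial>lborel) = (\<integral>\<^sup>+x. \<integral>\<^sup>+y. G (Complex x y) \<partial>lborel \<partial>lborel)"
proof -
  have C_eq: "(\<lambda>(x, y). Complex x y) = (\<lambda>p. of_real (fst p) + \<i> * of_real (snd p))"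
    by (auto simp: complex_eq_iff)
  have Cm [measurable]: "(\<lambda>(x, y). Complex x y) \<in> lborel \<Otimes>\<^sub>M lborel \<rightarrow>\<^sub>M borel"
    unfolding C_eq by measurable
  have "lborel = distr (lborel \<Otimes>\<^sub>M lborel) borel (\<lambda>(x, y). Complex x y)"
  proof (rule lborel_eqI)
    fix l u :: complex assume le: "\<And>b. b \<in> Basis \<Longrightarrow> l \<bullet> b \<le> u \<bullet> b"
    have le': "Re l \<le> Re u" "Im l \<le> Im u" using le[of 1] le[of \<i>] by (auto simp: Basis_complex_def)
    have "(\<lambda>(x, y). Complex x y) -` box l u \<inter> space (lborel \<Otimes>\<^sub>M lborel) = {Re l<..<Re u} \<times> {Im l<..<Im u}"
      by (auto simp: in_box_complex_iff space_pair_measure)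
    then have "emeasure (distr (lborel \<Otimes>\<^sub>M lborel) borel (\<lambda>(x, y). Complex x y)) (box l u) =
        emeasure (lborel \<Otimes>\<^sub>M lborel) ({Re l<..<Re u} \<times> {Im l<..<Im u})"
      by (simp add: emeasure_distr)
    also have "\<dots> = ennreal ((Re u - Re l) * (Im u - Im l))"
      using le' by (simp add: lborel.emeasure_pair_measure_Times ennreal_mult)
    also have "(Re u - Re l) * (Im u - Im l) = (\<Prod>b\<in>Basis. (u - l) \<bullet> b)"
      by (simp add: Basis_complex_def)
    finally show "emeasure (distr (lborel \<Otimes>\<^sub>M lborel) borel (\<lambda>(x, y). Complex x y)) (box l u) = ennreal (\<Prod>b\<in>Basis. (u - l) \<bullet> b)" .
  qed simp
  then have "(\<integral>\<^sup>+z. G z \<partial>lborel) = (\<integral>\<^sup>+z. G z \<partial>distr (lborel \<Otimes>\<^sub>M lborel) borel (\<lambda>(x, y). Complex x y))"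
    by simp
  also have "\<dots> = (\<integral>\<^sup>+p. G (case p of (x, y) \<Rightarrow> Complex x y) \<partial>(lborel \<Otimes>\<^sub>M lborel))"
    by (rule nn_integral_distr) simp_all
  also have "\<dots> = (\<integral>\<^sup>+x. \<integral>\<^sup>+y. G (case (x, y) of (x, y) \<Rightarrow> Complex x y) \<partial>lborel \<partial>lborel)"
    by (rule lborel.nn_integral_fst[symmetric]) measurable
  finally show ?thesis by simp
qed

text \<open>For almost every \<open>h\<close> in the interval, the norm of u at z is at most its
  norm at z + h d plus the integral of the norm of v over the whole segment. Integrating over
  \<open>h\<close> trades the value at a point for an integral along the segment and multiplies the
  second term by \<delta>.\<close>

lemma line_bound:
  fixes u v :: "'a::euclidean_space \<Rightarrow> 'b::euclidean_space"
  assumes iu: "integrable lborel u" and iv: "integrable lborel v" and V: "open V" and \<delta>: "0 < \<delta>"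
    and line: "\<And>h. 0 \<le> h \<Longrightarrow> h \<le> \<delta> \<Longrightarrow> AE z\<in>V in lborel.
      u (z + h *\<^sub>R d) = u z + (LINT s:{0..h}|lborel. v (z + s *\<^sub>R d))"
  shows "AE z\<in>V in lborel. ennreal (\<delta> * norm (u z)) \<le>
      (\<integral>\<^sup>+s. indicator {0..\<delta>} s * ennreal (norm (u (z + s *\<^sub>R d)) + \<delta> * norm (v (z + s *\<^sub>R d))) \<partial>lborel)"
proof -
  note ae = line_AE_all[where \<delta> = \<delta> and d = d, OF iu iv V line, simplified]
  show ?thesis
    using ae AE_line_integrable[OF iu, of \<delta> d] AE_line_integrable[OF iv, of \<delta> d]
  proof eventually_elim
    case (elim z)
    show ?case
    proof
      assume z: "z \<in> V"
      define p where "p s = norm (u (z + s *\<^sub>R d))" for s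
      define q where "q s = norm (v (z + s *\<^sub>R d))" for s
      have ip: "set_integrable lborel {0..\<delta>} p" and iq: "set_integrable lborel {0..\<delta>} q"
        using set_integrable_norm[OF elim(2)] set_integrable_norm[OF elim(3)] by (simp_all add: p_def[abs_def] q_def[abs_def])
      define I where "I = (LINT s:{0..\<delta>}|lborel. q s)"
      have c: "set_integrable lborel {0..\<delta>} (\<lambda>s. c)" for c :: real
        by (intro borel_integrable_atLeastAtMost' continuous_intros)
      have "AE h\<in>{0..\<delta>} in lborel. norm (u z) \<le> p h + I"
        using elim(1)
      proof eventually_elim
        case (elim h)
        show ?case
        proof
          assume h: "h \<in> {0..\<delta>}"
          then have eq: "u z = u (z + h *\<^sub>R d) - (LINT s:{0..h}|lborel. v (z + s *\<^sub>R d))" using elim z by simp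
          have sub: "set_integrable lborel {0..h} (\<lambda>s. v (z + s *\<^sub>R d))"
            using h by (intro set_integrable_subset[OF \<open>set_integrable lborel {0..\<delta>} (\<lambda>s. v (z + s *\<^sub>R d))\<close>]) auto
          have "norm (LINT s:{0..h}|lborel. v (z + s *\<^sub>R d)) \<le> (LINT s:{0..h}|lborel. q s)"
            unfolding q_def by (rule set_integral_norm_bound[OF sub])
          also have "\<dots> \<le> I"
            unfolding I_def set_lebesgue_integral_def
            by (rule integral_mono) (use h iq set_integrable_norm[OF sub] in \<open>auto simp: set_integrable_def q_def[abs_def] split: split_indicator\<close>)
          finally show "norm (u z) \<le> p h + I" unfolding p_def
            using norm_triangle_ineq4[of "u (z + h *\<^sub>R d)" "LINT s:{0..h}|lborel. v (z + s *\<^sub>R d)"] eq by simp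
        qed
      qed
      then have "(LINT s:{0..\<delta>}|lborel. norm (u z)) \<le> (LINT s:{0..\<delta>}|lborel. p s + I)"
        by (intro set_integral_mono_AE c set_integral_add(1) ip)
      also have "(LINT s:{0..\<delta>}|lborel. p s + I) = (LINT s:{0..\<delta>}|lborel. p s) + \<delta> * I"
        using \<delta> by (subst set_integral_add(2)[OF ip c]) (simp add: set_integral_const)
      also have "\<dots> = (LINT s:{0..\<delta>}|lborel. p s + \<delta> * q s)"
        using iq by (subst set_integral_add(2)[OF ip]) (simp_all add: I_def)
      finally have "\<delta> * norm (u z) \<le> (LINT s:{0..\<delta>}|lborel. p s + \<delta> * q s)"
        using \<delta> by (simp add: set_integral_const)
      then have "ennreal (\<delta> * norm (u z)) \<le> ennreal (LINT s:{0..\<delta>}|lborel. p s + \<delta> * q s)" by (rule ennreal_leI)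
      also have "\<dots> = (\<integral>\<^sup>+s. ennreal (indicator {0..\<delta>} s *\<^sub>R (p s + \<delta> * q s)) \<partial>lborel)"
        unfolding set_lebesgue_integral_def
      proof (rule nn_integral_eq_integral[symmetric])
        show "integrable lborel (\<lambda>s. indicator {0..\<delta>} s *\<^sub>R (p s + \<delta> * q s))"
          using set_integral_add(1)[OF ip set_integrable_mult_right[of \<delta>, OF iq]] by (simp add: set_integrable_def)
        show "AE s in lborel. 0 \<le> indicator {0..\<delta>} s *\<^sub>R (p s + \<delta> * q s)"
          using \<delta> by (auto simp: p_def q_def intro!: AE_I2)
      qed
      also have "\<dots> = (\<integral>\<^sup>+s. indicator {0..\<delta>} s * ennreal (p s + \<delta> * q s) \<partial>lborel)"
        by (intro nn_integral_cong) (simp split: split_indicator)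
      finally show "ennreal (\<delta> * norm (u z)) \<le>
          (\<integral>\<^sup>+s. indicator {0..\<delta>} s * ennreal (norm (u (z + s *\<^sub>R d)) + \<delta> * norm (v (z + s *\<^sub>R d))) \<partial>lborel)"
        by (simp add: p_def q_def)
    qed
  qed
qed

lemma nn_integral_indicator_le: "(\<integral>\<^sup>+s. indicator X s * f s \<partial>M) \<le> (\<integral>\<^sup>+s. f s \<partial>M)"
  by (intro nn_integral_mono) (simp split: split_indicator)

lemma nn_integral_norm_sum_finite:
  fixes u v :: "'a \<Rightarrow> 'b::euclidean_space"
  assumes "integrable M u" "integrable M v" "0 \<le> c"
  shows "(\<integral>\<^sup>+z. ennreal (norm (u z) + c * norm (v z)) \<partial>M) < \<infinity>"
proof -
  have i: "integrable M (\<lambda>z. norm (u z) + c * norm (v z))" using assms by simp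
  show ?thesis using assms(3) by (subst nn_integral_eq_integral[OF i]) auto
qed

text \<open>The sup over one variable is controlled by an integral over that variable, so the square is
  bounded by a product of a function of \<open>x\<close> and a function of \<open>y\<close>.\<close>

lemma W11_L2_bound:
  fixes w :: "complex \<Rightarrow> 'b::euclidean_space"
  assumes S: "open S" and w1: "has_weak_deriv S 1 w w1" and w2: "has_weak_deriv S \<i> w w2"
    and K: "compact K" "K \<subseteq> S"
  shows "set_integrable lebesgue K (\<lambda>z. (norm (w z))\<^sup>2)"
proof -
  obtain V W L \<delta> where V: "open V" "K \<subseteq> V" "V \<subseteq> W" "W \<subseteq> L" "compact L" "L \<subseteq> S" "0 < \<delta>"
    and VW: "\<And>z s d. z \<in> V \<Longrightarrow> norm d = 1 \<Longrightarrow> 0 \<le> s \<Longrightarrow> s \<le> \<delta> \<Longrightarrow> z + s *\<^sub>R d \<in> W"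
    using compact_neighbourhoods[OF K S] by metis
  obtain u where u: "AE z\<in>L in lborel. u z = w z" "integrable lborel u"
    using L1_loc_rep[of S w L] w1 V by (auto simp: has_weak_deriv_def)
  obtain u1 where u1: "AE z\<in>L in lborel. u1 z = w1 z" "integrable lborel u1"
    using L1_loc_rep[of S w1 L] w1 V by (auto simp: has_weak_deriv_def)
  obtain u2 where u2: "AE z\<in>L in lborel. u2 z = w2 z" "integrable lborel u2"
    using L1_loc_rep[of S w2 L] w2 V by (auto simp: has_weak_deriv_def)
  have [measurable]: "u \<in> borel_measurable borel" "u1 \<in> borel_measurable borel" "u2 \<in> borel_measurable borel"
    using borel_measurable_integrable[OF u(2)] borel_measurable_integrable[OF u1(2)] borel_measurable_integrable[OF u2(2)] by simp_all
  have [measurable]: "K \<in> sets borel" using K(1) by (simp add: compact_imp_closed)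
  define G1 where "G1 z = ennreal (norm (u z) + \<delta> * norm (u1 z))" for z
  define G2 where "G2 z = ennreal (norm (u z) + \<delta> * norm (u2 z))" for z
  have [measurable]: "G1 \<in> borel_measurable borel" "G2 \<in> borel_measurable borel"
    unfolding G1_def[abs_def] G2_def[abs_def] by measurable
  have fin: "(\<integral>\<^sup>+z. G1 z \<partial>lborel) < \<infinity>" "(\<integral>\<^sup>+z. G2 z \<partial>lborel) < \<infinity>"
    unfolding G1_def G2_def using u(2) u1(2) u2(2) V(7) by (intro nn_integral_norm_sum_finite; simp)+
  have l1: "AE z\<in>V in lborel. u (z + h *\<^sub>R 1) = u z + (LINT s:{0..h}|lborel. u1 (z + s *\<^sub>R 1))"
    if "0 \<le> h" "h \<le> \<delta>" for h by (rule has_weak_deriv_lines[OF w1 _ u u1 V(6,4,1) VW that]) simp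
  have l2: "AE z\<in>V in lborel. u (z + h *\<^sub>R \<i>) = u z + (LINT s:{0..h}|lborel. u2 (z + s *\<^sub>R \<i>))"
    if "0 \<le> h" "h \<le> \<delta>" for h by (rule has_weak_deriv_lines[OF w2 _ u u2 V(6,4,1) VW that]) simp
  define a where "a y = (\<integral>\<^sup>+x. G1 (Complex x y) \<partial>lborel)" for y
  define b where "b x = (\<integral>\<^sup>+y. G2 (Complex x y) \<partial>lborel)" for x
  have Ceq: "Complex x y = of_real x + \<i> * of_real y" for x y by (simp add: complex_eq_iff)
  have am [measurable]: "a \<in> borel_measurable borel" unfolding a_def[abs_def] Ceq by measurable
  have bm [measurable]: "b \<in> borel_measurable borel" unfolding b_def[abs_def] Ceq by measurable
  have ia: "(\<integral>\<^sup>+y. a y \<partial>lborel) = (\<integral>\<^sup>+z. G1 z \<partial>lborel)"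
    unfolding a_def nn_integral_lborel_complex[OF \<open>G1 \<in> _\<close>]
    by (rule lborel_pair.Fubini') (simp add: Ceq, measurable)
  have ib: "(\<integral>\<^sup>+x. b x \<partial>lborel) = (\<integral>\<^sup>+z. G2 z \<partial>lborel)"
    unfolding b_def nn_integral_lborel_complex[OF \<open>G2 \<in> _\<close>] ..
  have ae: "AE z\<in>K in lborel. ennreal (\<delta> * norm (u z)) \<le> a (Im z) \<and> ennreal (\<delta> * norm (u z)) \<le> b (Re z)"
    using line_bound[where d = 1, OF u(2) u1(2) V(1,7) l1, simplified] line_bound[where d = \<i>, OF u(2) u2(2) V(1,7) l2, simplified]
  proof eventually_elim
    case (elim z)
    show ?case
    proof
      assume "z \<in> K"
      then have "z \<in> V" using V(2) by blast
      have "ennreal (\<delta> * norm (u z)) \<le> (\<integral>\<^sup>+s. indicator {0..\<delta>} s * G1 (z + of_real s) \<partial>lborel)"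
        using elim(1) \<open>z \<in> V\<close> by (simp add: G1_def scaleR_conv_of_real)
      also have "\<dots> \<le> (\<integral>\<^sup>+s. G1 (z + of_real s) \<partial>lborel)" by (rule nn_integral_indicator_le)
      also have "\<dots> = (\<integral>\<^sup>+s. G1 (Complex (s + Re z) (Im z)) \<partial>lborel)"
        by (intro nn_integral_cong arg_cong[of _ _ G1]) (simp add: complex_eq_iff)
      also have "\<dots> = a (Im z)" unfolding a_def
        by (rule nn_integral_lborel_shift[of "\<lambda>s. G1 (Complex s (Im z))"]) (unfold Ceq, measurable)
      finally have 1: "ennreal (\<delta> * norm (u z)) \<le> a (Im z)" .
      have "ennreal (\<delta> * norm (u z)) \<le> (\<integral>\<^sup>+s. indicator {0..\<delta>} s * G2 (z + s *\<^sub>R \<i>) \<partial>lborel)"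
        using elim(2) \<open>z \<in> V\<close> by (simp add: G2_def)
      also have "\<dots> \<le> (\<integral>\<^sup>+s. G2 (z + s *\<^sub>R \<i>) \<partial>lborel)" by (rule nn_integral_indicator_le)
      also have "\<dots> = (\<integral>\<^sup>+s. G2 (Complex (Re z) (s + Im z)) \<partial>lborel)"
        by (intro nn_integral_cong arg_cong[of _ _ G2]) (simp add: complex_eq_iff)
      also have "\<dots> = b (Re z)" unfolding b_def
        by (rule nn_integral_lborel_shift[of "\<lambda>s. G2 (Complex (Re z) s)"]) (unfold Ceq, measurable)
      finally show "ennreal (\<delta> * norm (u z)) \<le> a (Im z) \<and> ennreal (\<delta> * norm (u z)) \<le> b (Re z)" using 1 by simp
    qed
  qed
  have "(\<integral>\<^sup>+z. ennreal (indicator K z * (\<delta> * norm (u z))\<^sup>2) \<partial>lborel) \<le> (\<integral>\<^sup>+z. a (Im z) * b (Re z) \<partial>lborel)"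
    using ae
    by (intro nn_integral_mono_AE, eventually_elim)
       (use V(7) in \<open>auto simp: power2_eq_square ennreal_mult intro!: mult_mono split: split_indicator\<close>)
  also have "\<dots> = (\<integral>\<^sup>+x. \<integral>\<^sup>+y. a y * b x \<partial>lborel \<partial>lborel)"
    by (subst nn_integral_lborel_complex) simp_all
  also have "\<dots> = (\<integral>\<^sup>+z. G1 z \<partial>lborel) * (\<integral>\<^sup>+z. G2 z \<partial>lborel)"
    by (simp add: nn_integral_multc nn_integral_cmult ia ib)
  also have "\<dots> < \<infinity>" using fin by (simp add: ennreal_mult_less_top)
  finally have "integrable lborel (\<lambda>z. indicator K z * (\<delta> * norm (u z))\<^sup>2)"
    by (intro integrableI_bounded) simp_all
  then have "integrable lborel (\<lambda>z. inverse (\<delta>\<^sup>2) * (indicator K z * (\<delta> * norm (u z))\<^sup>2))" by (rule integrable_mult_right)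
  then have i: "integrable lborel (\<lambda>z. indicator K z *\<^sub>R (norm (u z))\<^sup>2)"
    using V(7) by (simp add: power_mult_distrib field_simps)
  have il: "integrable lebesgue (\<lambda>z. indicator K z *\<^sub>R (norm (u z))\<^sup>2)"
    using i by (subst integrable_completion) simp_all
  have "AE z in lborel. indicator K z *\<^sub>R (norm (u z))\<^sup>2 = indicator K z *\<^sub>R (norm (w z))\<^sup>2"
    using u(1) by eventually_elim (use V in \<open>auto split: split_indicator\<close>)
  then have ae': "AE z in lebesgue. indicator K z *\<^sub>R (norm (u z))\<^sup>2 = indicator K z *\<^sub>R (norm (w z))\<^sup>2" by (rule AE_completion)
  show ?thesis unfolding set_integrable_def
    by (rule integrable_cong_AE_imp[OF il borel_measurable_AE[OF borel_measurable_integrable[OF il] ae'] ae'])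
qed

text \<open>Bounding first along \<open>x\<close> and then along \<open>y\<close> leaves an integral over a square.\<close>

lemma W21_bounded:
  fixes w :: "complex \<Rightarrow> 'b::euclidean_space"
  assumes S: "open S" and w1: "has_weak_deriv S 1 w w1" and w2: "has_weak_deriv S \<i> w w2"
    and w12: "has_weak_deriv S \<i> w1 w12"
    and K: "compact K" "K \<subseteq> S"
  shows "\<exists>C. AE z\<in>K in lebesgue. norm (w z) \<le> C"
proof -
  obtain V W L \<delta> where V: "open V" "K \<subseteq> V" "V \<subseteq> W" "W \<subseteq> L" "compact L" "L \<subseteq> S" "0 < \<delta>"
    and VW: "\<And>z s d. z \<in> V \<Longrightarrow> norm d = 1 \<Longrightarrow> 0 \<le> s \<Longrightarrow> s \<le> \<delta> \<Longrightarrow> z + s *\<^sub>R d \<in> W"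
    using compact_neighbourhoods[OF K S] by metis
  \<comment> \<open>After the step along 1 the point lies in W, where a second step along
    \<open>\<i>\<close> has to be taken; hence a second set of neighbourhoods, built around the
    compact set L of the first.\<close>
  obtain V' W' L' \<epsilon> where V': "open V'" "L \<subseteq> V'" "V' \<subseteq> W'" "W' \<subseteq> L'" "compact L'" "L' \<subseteq> S" "0 < \<epsilon>"
    and VW': "\<And>z s d. z \<in> V' \<Longrightarrow> norm d = 1 \<Longrightarrow> 0 \<le> s \<Longrightarrow> s \<le> \<epsilon> \<Longrightarrow> z + s *\<^sub>R d \<in> W'"
    using compact_neighbourhoods[OF V(5,6) S] by metis
  have WL': "W \<subseteq> L'" using V(4) V'(2-4) by blast
  obtain u where u: "AE z\<in>L' in lborel. u z = w z" "integrable lborel u"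
    using L1_loc_rep[of S w L'] w1 V' by (auto simp: has_weak_deriv_def)
  obtain u1 where u1: "AE z\<in>L' in lborel. u1 z = w1 z" "integrable lborel u1"
    using L1_loc_rep[of S w1 L'] w1 V' by (auto simp: has_weak_deriv_def)
  obtain u2 where u2: "AE z\<in>L' in lborel. u2 z = w2 z" "integrable lborel u2"
    using L1_loc_rep[of S w2 L'] w2 V' by (auto simp: has_weak_deriv_def)
  obtain u12 where u12: "AE z\<in>L' in lborel. u12 z = w12 z" "integrable lborel u12"
    using L1_loc_rep[of S w12 L'] w12 V' by (auto simp: has_weak_deriv_def)
  have [measurable]: "u \<in> borel_measurable borel" "u1 \<in> borel_measurable borel" "u2 \<in> borel_measurable borel" "u12 \<in> borel_measurable borel"
    using borel_measurable_integrable[OF u(2)] borel_measurable_integrable[OF u1(2)]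
      borel_measurable_integrable[OF u2(2)] borel_measurable_integrable[OF u12(2)] by simp_all
  define G1 where "G1 z = ennreal (norm (u z) + \<epsilon> * norm (u2 z))" for z
  define G2 where "G2 z = ennreal (norm (u1 z) + \<epsilon> * norm (u12 z))" for z
  define G where "G z = G1 z + ennreal \<delta> * G2 z" for z
  have [measurable]: "G1 \<in> borel_measurable borel" "G2 \<in> borel_measurable borel" "G \<in> borel_measurable borel"
    unfolding G_def[abs_def] G1_def[abs_def] G2_def[abs_def] by measurable
  have fin: "(\<integral>\<^sup>+z. G1 z \<partial>lborel) < \<infinity>" "(\<integral>\<^sup>+z. G2 z \<partial>lborel) < \<infinity>"
    unfolding G1_def G2_def using u(2) u1(2) u2(2) u12(2) V'(7) by (intro nn_integral_norm_sum_finite; simp)+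
  define B where "B = (\<integral>\<^sup>+z. G z \<partial>lborel)"
  have B: "B < \<infinity>" unfolding B_def G_def using fin
    by (subst nn_integral_add) (auto simp: nn_integral_cmult ennreal_mult_less_top)
  have l1: "AE z\<in>V in lborel. u (z + h *\<^sub>R 1) = u z + (LINT s:{0..h}|lborel. u1 (z + s *\<^sub>R 1))"
    if "0 \<le> h" "h \<le> \<delta>" for h by (rule has_weak_deriv_lines[OF w1 _ u u1 V'(6) WL' V(1) VW that]) simp
  have l2: "AE z\<in>V' in lborel. u (z + h *\<^sub>R \<i>) = u z + (LINT s:{0..h}|lborel. u2 (z + s *\<^sub>R \<i>))"
    if "0 \<le> h" "h \<le> \<epsilon>" for h by (rule has_weak_deriv_lines[OF w2 _ u u2 V'(6,4,1) VW' that]) simp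
  have l12: "AE z\<in>V' in lborel. u1 (z + h *\<^sub>R \<i>) = u1 z + (LINT s:{0..h}|lborel. u12 (z + s *\<^sub>R \<i>))"
    if "0 \<le> h" "h \<le> \<epsilon>" for h by (rule has_weak_deriv_lines[OF w12 _ u1 u12 V'(6,4,1) VW' that]) simp
  \<comment> \<open>This combination of \<open>u\<close> and \<open>u1\<close> is the integrand that
    the bound along 1 produces, so the two bounds can be chained.\<close>
  have "AE z\<in>V' in lborel.
      ennreal \<epsilon> * ennreal (norm (u z) + \<delta> * norm (u1 z)) \<le> (\<integral>\<^sup>+r. G (z + r *\<^sub>R \<i>) \<partial>lborel)"
    using line_bound[where d = \<i>, OF u(2) u2(2) V'(1,7) l2, simplified] line_bound[where d = \<i>, OF u1(2) u12(2) V'(1,7) l12, simplified]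
  proof eventually_elim
    case (elim z)
    show ?case
    proof
      assume z: "z \<in> V'"
      have 1: "ennreal (\<epsilon> * norm (u z)) \<le> (\<integral>\<^sup>+s. G1 (z + s *\<^sub>R \<i>) \<partial>lborel)"
        unfolding G1_def by (rule order_trans[OF mp[OF elim(1) z] nn_integral_indicator_le])
      have 2: "ennreal (\<epsilon> * norm (u1 z)) \<le> (\<integral>\<^sup>+s. G2 (z + s *\<^sub>R \<i>) \<partial>lborel)"
        unfolding G2_def by (rule order_trans[OF mp[OF elim(2) z] nn_integral_indicator_le])
      have "ennreal \<epsilon> * ennreal (norm (u z) + \<delta> * norm (u1 z)) =
          ennreal (\<epsilon> * norm (u z)) + ennreal \<delta> * ennreal (\<epsilon> * norm (u1 z))"
        using V(7) V'(7) by (simp add: ennreal_mult[symmetric] ennreal_plus[symmetric] algebra_simps del: ennreal_plus)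
      also have "\<dots> \<le> (\<integral>\<^sup>+s. G1 (z + s *\<^sub>R \<i>) \<partial>lborel) + ennreal \<delta> * (\<integral>\<^sup>+s. G2 (z + s *\<^sub>R \<i>) \<partial>lborel)"
        by (intro add_mono mult_left_mono 1 2) simp
      also have "\<dots> = (\<integral>\<^sup>+r. G (z + r *\<^sub>R \<i>) \<partial>lborel)"
        unfolding G_def by (subst nn_integral_add) (auto simp: nn_integral_cmult)
      finally show "ennreal \<epsilon> * ennreal (norm (u z) + \<delta> * norm (u1 z)) \<le> (\<integral>\<^sup>+r. G (z + r *\<^sub>R \<i>) \<partial>lborel)" .
    qed
  qed
  from AE_lborel_shift_line[OF this, of 1] line_bound[where d = 1, OF u(2) u1(2) V(1,7) l1, simplified] u(1)
  have "AE z\<in>K in lborel. norm (w z) \<le> enn2real B / (\<epsilon> * \<delta>)"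
  proof eventually_elim
    case (elim z)
    show ?case
    proof
      assume zK: "z \<in> K"
      then have z: "z \<in> V" "z \<in> L'" using V(2) V(3) WL' by auto
      have "ennreal (\<epsilon> * \<delta> * norm (u z)) = ennreal \<epsilon> * ennreal (\<delta> * norm (u z))"
        using V'(7) V(7) by (simp add: ennreal_mult[symmetric] mult.assoc)
      also have "\<dots> \<le> ennreal \<epsilon> * (\<integral>\<^sup>+s. indicator {0..\<delta>} s * ennreal (norm (u (z + s *\<^sub>R 1)) + \<delta> * norm (u1 (z + s *\<^sub>R 1))) \<partial>lborel)"
        using elim(2) z(1) by (intro mult_left_mono) simp_all
      also have "\<dots> = (\<integral>\<^sup>+s. ennreal \<epsilon> * (indicator {0..\<delta>} s * ennreal (norm (u (z + s *\<^sub>R 1)) + \<delta> * norm (u1 (z + s *\<^sub>R 1)))) \<partial>lborel)"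
        by (rule nn_integral_cmult[symmetric]) measurable
      also have "\<dots> \<le> (\<integral>\<^sup>+s. \<integral>\<^sup>+r. G (z + s *\<^sub>R 1 + r *\<^sub>R \<i>) \<partial>lborel \<partial>lborel)"
        using elim(1)
      proof (intro nn_integral_mono_AE, eventually_elim)
        case (elim s)
        show ?case
        proof (cases "s \<in> {0..\<delta>}")
          case True
          then have "z + s *\<^sub>R 1 \<in> V'" using VW[OF z(1), of 1 s] V(4) V'(2) by auto
          then show ?thesis using elim True by simp
        qed simp
      qed
      also have "\<dots> = (\<integral>\<^sup>+s. \<integral>\<^sup>+r. G (Complex s r + z) \<partial>lborel \<partial>lborel)"
        by (intro nn_integral_cong arg_cong[of _ _ G]) (simp add: complex_eq_iff)
      also have "\<dots> = (\<integral>\<^sup>+x. G (x + z) \<partial>lborel)"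
        by (rule nn_integral_lborel_complex[symmetric]) measurable
      also have "\<dots> = B" unfolding B_def by (rule nn_integral_lborel_shift) measurable
      also have "B = ennreal (enn2real B)" using B by simp
      finally have "\<epsilon> * \<delta> * norm (u z) \<le> enn2real B" by (subst (asm) ennreal_le_iff) simp_all
      then have "norm (u z) \<le> enn2real B / (\<epsilon> * \<delta>)" using V(7) V'(7) by (simp add: field_simps)
      then show "norm (w z) \<le> enn2real B / (\<epsilon> * \<delta>)" using elim(3) z(2) by simp
    qed
  qed
  then show ?thesis by (intro exI) (rule AE_completion)
qed

section \<open>Local Sobolev spaces\<close>

lemma set_borel_measurable_cong_AE:
  fixes u v :: "complex \<Rightarrow> 'b::euclidean_space"
  assumes "AE z\<in>S in lebesgue. u z = v z" "set_borel_measurable lebesgue S u"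
  shows "set_borel_measurable lebesgue S v"
  unfolding set_borel_measurable_def
  by (rule borel_measurable_AE[OF assms(2)[unfolded set_borel_measurable_def]])
     (use assms(1) in \<open>auto elim!: eventually_mono simp: indicator_def\<close>)

lemma set_integrable_lebesgue_cong_AE:
  fixes u v :: "complex \<Rightarrow> 'b::euclidean_space"
  assumes ae: "AE z\<in>S in lebesgue. u z = v z" and u: "set_integrable lebesgue S u"
  shows "set_integrable lebesgue S v"
proof -
  have ae': "AE z in lebesgue. indicator S z *\<^sub>R u z = indicator S z *\<^sub>R v z"
    using ae by eventually_elim (auto simp: indicator_def)
  show ?thesis unfolding set_integrable_def
    by (rule integrable_cong_AE_imp[OF u[unfolded set_integrable_def]
          borel_measurable_AE[OF borel_measurable_integrable[OF u[unfolded set_integrable_def]] ae'] ae'])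
qed

lemma set_integral_lebesgue_cong_AE:
  fixes u v :: "complex \<Rightarrow> 'b::euclidean_space"
  assumes ae: "AE z\<in>S in lebesgue. u z = v z"
  shows "(LINT z:S|lebesgue. u z) = (LINT z:S|lebesgue. v z)"
proof (cases "set_borel_measurable lebesgue S u")
  case True
  then have "set_borel_measurable lebesgue S v" by (rule set_borel_measurable_cong_AE[OF ae])
  then show ?thesis using True ae unfolding set_lebesgue_integral_def set_borel_measurable_def
    by (intro integral_cong_AE) (auto elim!: eventually_mono simp: indicator_def)
next
  \<comment> \<open>If \<open>u\<close> is not measurable on S, neither is \<open>v\<close>; then
    both integrals take the default value 0.\<close>
  case False
  have ae': "AE z\<in>S in lebesgue. v z = u z" using ae by eventually_elim auto
  have "\<not> set_borel_measurable lebesgue S v" using False set_borel_measurable_cong_AE[OF ae'] by blast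
  then show ?thesis using False unfolding set_lebesgue_integral_def set_borel_measurable_def
    by (metis borel_measurable_integrable not_integrable_integral_eq)
qed

lemma L1_loc_cong:
  assumes ae: "AE z\<in>S in lebesgue. u z = v z" and u: "L1_loc S u"
  shows "L1_loc S v"
proof -
  have "AE z\<in>K in lebesgue. u z = v z" if "K \<subseteq> S" for K
    using ae by eventually_elim (use that in auto)
  then show ?thesis
    using u set_borel_measurable_cong_AE[OF ae] set_integrable_lebesgue_cong_AE unfolding L1_loc_def by blast
qed

lemma L2_loc_cong:
  assumes ae: "AE z\<in>S in lebesgue. u z = v z" and u: "L2_loc S u"
  shows "L2_loc S v"
proof -
  have "set_integrable lebesgue K (\<lambda>z. (norm (v z))\<^sup>2)" if "compact K" "K \<subseteq> S" for K
  proof (rule set_integrable_lebesgue_cong_AE)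
    show "AE z\<in>K in lebesgue. (norm (u z))\<^sup>2 = (norm (v z))\<^sup>2"
      using ae by eventually_elim (use that in auto)
  qed (use u that in \<open>auto simp: L2_loc_def\<close>)
  then show ?thesis
    using u set_borel_measurable_cong_AE[OF ae] unfolding L2_loc_def by blast
qed

lemma has_weak_deriv_cong:
  assumes u: "AE z\<in>S in lebesgue. u z = u' z" and v: "AE z\<in>S in lebesgue. v z = v' z"
    and wd: "has_weak_deriv S d u v"
  shows "has_weak_deriv S d u' v'"
proof -
  have "(LINT z:S|lebesgue. frechet_derivative f (at z) d *\<^sub>R u z) = (LINT z:S|lebesgue. frechet_derivative f (at z) d *\<^sub>R u' z)"
    "(LINT z:S|lebesgue. f z *\<^sub>R v z) = (LINT z:S|lebesgue. f z *\<^sub>R v' z)" for f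
    by (rule set_integral_lebesgue_cong_AE, use u in eventually_elim, simp)
       (rule set_integral_lebesgue_cong_AE, use v in eventually_elim, simp)
  then show ?thesis using wd L1_loc_cong[OF u] L1_loc_cong[OF v] by (simp add: has_weak_deriv_def)
qed

text \<open>An equality of functions rather than one almost everywhere: both sides are chosen from
  the same predicate, so the choice operator returns the same representative.\<close>

lemma weak_deriv_cong:
  assumes u: "AE z\<in>S in lebesgue. u z = u' z"
  shows "weak_deriv S d u = weak_deriv S d u'"
proof -
  have u': "AE z\<in>S in lebesgue. u' z = u z" using u by eventually_elim auto
  have "has_weak_deriv S d u v \<longleftrightarrow> has_weak_deriv S d u' v" for v
    using has_weak_deriv_cong[OF u AE_I2] has_weak_deriv_cong[OF u' AE_I2] by blast
  then show ?thesis by (simp add: weak_deriv_def)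
qed

lemma sobolev_loc_cong:
  assumes ae: "AE z\<in>S in lebesgue. u z = v z" and u: "sobolev_loc k S u"
  shows "sobolev_loc k S v"
proof (cases k)
  case 0
  then show ?thesis using u L2_loc_cong[OF ae] by simp
next
  case (Suc n)
  have "has_weak_deriv S d u w \<Longrightarrow> has_weak_deriv S d v w" for d w
    by (rule has_weak_deriv_cong[OF ae AE_I2]) auto
  then show ?thesis using u L2_loc_cong[OF ae] unfolding Suc sobolev_loc.simps weak_deriv_cong[OF ae] by blast
qed

lemma has_weak_deriv_weak_deriv: "has_weak_deriv S d u v \<Longrightarrow> has_weak_deriv S d u (weak_deriv S d u)"
  unfolding weak_deriv_def by (rule someI[where P = "has_weak_deriv S d u"])

lemma weak_deriv_AE_eq:
  assumes "open S" "has_weak_deriv S d u v"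
  shows "AE z\<in>S in lebesgue. weak_deriv S d u z = v z"
  by (rule weak_deriv_unique[OF has_weak_deriv_weak_deriv[OF assms(2)] assms(2,1)])

text \<open>\<open>sobolev_loc\<close> speaks of the chosen weak derivative. By uniqueness on open
  sets any weak derivative may be supplied instead, which is the form in which the later closure
  properties are proved.\<close>

lemma sobolev_loc_SucI:
  assumes "open S" "L2_loc S u" "\<And>d. d \<in> {1, \<i>} \<Longrightarrow> \<exists>v. has_weak_deriv S d u v \<and> sobolev_loc k S v"
  shows "sobolev_loc (Suc k) S u"
proof -
  have "sobolev_loc k S (weak_deriv S d u)" if "has_weak_deriv S d u v" "sobolev_loc k S v" for d v
  proof (rule sobolev_loc_cong[OF _ that(2)])
    show "AE z\<in>S in lebesgue. v z = weak_deriv S d u z"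
      using weak_deriv_AE_eq[OF assms(1) that(1)] by eventually_elim auto
  qed
  then show ?thesis using assms unfolding sobolev_loc.simps by blast
qed

lemma sobolev_loc_L2: "sobolev_loc k S u \<Longrightarrow> L2_loc S u"
  by (cases k) auto

lemma sobolev_loc_SucD:
  assumes "sobolev_loc (Suc k) S u" "d \<in> {1, \<i>}"
  shows "has_weak_deriv S d u (weak_deriv S d u)" "sobolev_loc k S (weak_deriv S d u)"
  using assms has_weak_deriv_weak_deriv by auto

lemma sobolev_loc_Suc_imp: "open S \<Longrightarrow> sobolev_loc (Suc k) S u \<Longrightarrow> sobolev_loc k S u"
proof (induction k arbitrary: u)
  case 0
  then show ?case by simp
next
  case (Suc k)
  show ?case
    by (rule sobolev_loc_SucI[OF Suc.prems(1) sobolev_loc_L2[OF Suc.prems(2)]])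
       (use sobolev_loc_SucD[OF Suc.prems(2)] Suc.IH[OF Suc.prems(1)] in blast)
qed

lemma sobolev_loc_mono: "open S \<Longrightarrow> sobolev_loc k S u \<Longrightarrow> j \<le> k \<Longrightarrow> sobolev_loc j S u"
  by (rotate_tac 2, induction rule: dec_induct) (auto dest: sobolev_loc_Suc_imp simp del: sobolev_loc.simps)

section \<open>Arithmetic of locally L^1, L^2 and bounded functions\<close>

lemma compact_lmeasurable_facts:
  fixes K :: "complex set"
  assumes "compact K"
  shows "K \<in> sets lebesgue" "set_integrable lebesgue K (\<lambda>z. c :: real)"
proof -
  have K: "K \<in> sets borel" using assms by (simp add: compact_imp_closed)
  then show "K \<in> sets lebesgue" by simp
  have "emeasure lebesgue K < \<infinity>" using emeasure_compact_finite[OF assms] K by (simp add: emeasure_completion less_top)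
  then show "set_integrable lebesgue K (\<lambda>z. c)" using K unfolding set_integrable_def
    by (intro integrable_scaleR_left integrable_real_indicator) auto
qed

lemma set_borel_measurable_norm_sq:
  fixes u :: "complex \<Rightarrow> 'b::euclidean_space"
  assumes "set_borel_measurable M S u"
  shows "set_borel_measurable M S (\<lambda>z. (norm (u z))\<^sup>2)"
proof -
  have "(\<lambda>z. (norm (indicator S z *\<^sub>R u z))\<^sup>2) \<in> borel_measurable M"
    using borel_measurable_power[OF measurable_compose[OF assms[unfolded set_borel_measurable_def] borel_measurable_norm]] .
  moreover have "(norm (indicator S z *\<^sub>R u z))\<^sup>2 = indicator S z *\<^sub>R (norm (u z))\<^sup>2" for z
    by (simp add: indicator_def)
  ultimately show ?thesis by (simp add: set_borel_measurable_def)
qed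

lemma set_borel_measurable_prod:
  fixes prod :: "'a::euclidean_space \<Rightarrow> 'b::euclidean_space \<Rightarrow> 'c::euclidean_space"
  assumes bl: "bounded_bilinear prod"
    and "set_borel_measurable M S u" "set_borel_measurable M S v"
  shows "set_borel_measurable M S (\<lambda>z. prod (u z) (v z))"
proof -
  interpret bounded_bilinear prod by (rule bl)
  have "(\<lambda>z. prod (indicator S z *\<^sub>R u z) (indicator S z *\<^sub>R v z)) \<in> borel_measurable M"
    using assms by (intro borel_measurable_bilinear[OF bl]) (auto simp: set_borel_measurable_def)
  moreover have "prod (indicator S z *\<^sub>R u z) (indicator S z *\<^sub>R v z) = indicator S z *\<^sub>R prod (u z) (v z)" for z
    by (simp add: indicator_def zero_left)
  ultimately show ?thesis by (simp add: set_borel_measurable_def)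
qed

lemma set_borel_measurable_add:
  fixes u v :: "complex \<Rightarrow> 'b::euclidean_space"
  assumes "set_borel_measurable M S u" "set_borel_measurable M S v"
  shows "set_borel_measurable M S (\<lambda>z. u z + v z)"
  using borel_measurable_add[OF assms[unfolded set_borel_measurable_def]]
  by (simp add: set_borel_measurable_def scaleR_add_right)

lemma set_borel_measurable_scaleR:
  fixes u :: "complex \<Rightarrow> 'b::euclidean_space"
  assumes "set_borel_measurable M S u"
  shows "set_borel_measurable M S (\<lambda>z. c *\<^sub>R u z)"
  using borel_measurable_scaleR[OF borel_measurable_const[of c] assms[unfolded set_borel_measurable_def]]
  by (simp add: set_borel_measurable_def mult.commute)

lemma set_borel_measurable_compact:
  fixes u :: "complex \<Rightarrow> 'b::euclidean_space"
  assumes "set_borel_measurable lebesgue S u" "compact K" "K \<subseteq> S"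
  shows "set_borel_measurable lebesgue K u"
  using set_borel_measurable_subset[OF assms(1) compact_lmeasurable_facts(1)[OF assms(2)] assms(3)] .

lemma L1_loc_add: "L1_loc S u \<Longrightarrow> L1_loc S v \<Longrightarrow> L1_loc S (\<lambda>z. u z + v z)"
  unfolding L1_loc_def by (auto intro!: set_borel_measurable_add set_integral_add)

lemma L1_loc_scaleR: "L1_loc S u \<Longrightarrow> L1_loc S (\<lambda>z. c *\<^sub>R u z)"
  unfolding L1_loc_def by (auto intro!: set_borel_measurable_scaleR)

lemma norm_add_sq_le: "(norm (a + b :: 'a::real_normed_vector))\<^sup>2 \<le> 2 * (norm a)\<^sup>2 + 2 * (norm b)\<^sup>2"
proof -
  have "(norm (a + b))\<^sup>2 \<le> (norm a + norm b)\<^sup>2" by (intro power_mono norm_triangle_ineq norm_ge_zero)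
  also have "\<dots> \<le> 2 * (norm a)\<^sup>2 + 2 * (norm b)\<^sup>2"
    using sum_squares_bound[of "norm a" "norm b"] by (simp add: power2_sum)
  finally show ?thesis .
qed

lemma L2_loc_add:
  assumes "L2_loc S u" "L2_loc S v" shows "L2_loc S (\<lambda>z. u z + v z)"
  unfolding L2_loc_def
proof (intro conjI allI impI)
  show m: "set_borel_measurable lebesgue S (\<lambda>z. u z + v z)"
    using assms by (auto simp: L2_loc_def intro!: set_borel_measurable_add)
  fix K assume K: "compact K \<and> K \<subseteq> S"
  show "set_integrable lebesgue K (\<lambda>z. (norm (u z + v z))\<^sup>2)"
  proof (rule set_integrable_bound)
    show "set_integrable lebesgue K (\<lambda>z. 2 * (norm (u z))\<^sup>2 + 2 * (norm (v z))\<^sup>2)"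
      using assms K by (intro set_integral_add(1) set_integrable_mult_right) (auto simp: L2_loc_def)
    show "set_borel_measurable lebesgue K (\<lambda>z. (norm (u z + v z))\<^sup>2)"
      using K by (intro set_borel_measurable_norm_sq set_borel_measurable_compact[OF m]) auto
    show "AE x\<in>K in lebesgue. norm ((norm (u x + v x))\<^sup>2) \<le> norm (2 * (norm (u x))\<^sup>2 + 2 * (norm (v x))\<^sup>2)"
      using norm_add_sq_le by (auto intro!: AE_I2 simp: abs_of_nonneg)
  qed
qed

lemma L2_loc_scaleR:
  assumes "L2_loc S u" shows "L2_loc S (\<lambda>z. c *\<^sub>R u z)"
  using assms unfolding L2_loc_def
  by (auto intro!: set_borel_measurable_scaleR set_integrable_mult_right simp: power_mult_distrib)

lemma L2_loc_prod_L1: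
  fixes prod :: "'a::euclidean_space \<Rightarrow> 'b::euclidean_space \<Rightarrow> 'c::euclidean_space"
  assumes bl: "bounded_bilinear prod" and u: "L2_loc S u" and v: "L2_loc S v"
  shows "L1_loc S (\<lambda>z. prod (u z) (v z))"
  unfolding L1_loc_def
proof (intro conjI allI impI)
  show m: "set_borel_measurable lebesgue S (\<lambda>z. prod (u z) (v z))"
    using u v by (intro set_borel_measurable_prod[OF bl]) (auto simp: L2_loc_def)
  fix K assume K: "compact K \<and> K \<subseteq> S"
  obtain C where C: "0 \<le> C" "\<And>a b. norm (prod a b) \<le> norm a * norm b * C"
    using bounded_bilinear.nonneg_bounded[OF bl] by blast
  show "set_integrable lebesgue K (\<lambda>z. prod (u z) (v z))"
  proof (rule set_integrable_bound)
    show "set_integrable lebesgue K (\<lambda>z. C * ((norm (u z))\<^sup>2 + (norm (v z))\<^sup>2))"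
      using u v K by (intro set_integral_add(1) set_integrable_mult_right) (auto simp: L2_loc_def)
    show "set_borel_measurable lebesgue K (\<lambda>z. prod (u z) (v z))"
      using K by (intro set_borel_measurable_compact[OF m]) auto
    have "norm (prod a b) \<le> C * ((norm a)\<^sup>2 + (norm b)\<^sup>2)" for a b
    proof -
      have "norm a * norm b \<le> (norm a)\<^sup>2 + (norm b)\<^sup>2"
        using sum_squares_bound[of "norm a" "norm b"] mult_nonneg_nonneg[OF norm_ge_zero[of a] norm_ge_zero[of b]] by linarith
      from mult_left_mono[OF this C(1)] show ?thesis using C(2)[of a b] by (simp add: mult.commute)
    qed
    then show "AE x\<in>K in lebesgue. norm (prod (u x) (v x)) \<le> norm (C * ((norm (u x))\<^sup>2 + (norm (v x))\<^sup>2))"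
      using C(1) by (auto intro!: AE_I2 simp: abs_of_nonneg)
  qed
qed

definition Linf_loc :: "complex set \<Rightarrow> (complex \<Rightarrow> 'b::euclidean_space) \<Rightarrow> bool" where
  "Linf_loc S u \<longleftrightarrow> set_borel_measurable lebesgue S u \<and>
     (\<forall>K. compact K \<and> K \<subseteq> S \<longrightarrow> (\<exists>C. AE z\<in>K in lebesgue. norm (u z) \<le> C))"

lemma Linf_loc_prod_L2:
  fixes prod :: "'a::euclidean_space \<Rightarrow> 'b::euclidean_space \<Rightarrow> 'c::euclidean_space"
  assumes bl: "bounded_bilinear prod" and u: "Linf_loc S u" and v: "L2_loc S v"
  shows "L2_loc S (\<lambda>z. prod (u z) (v z))"
  unfolding L2_loc_def
proof (intro conjI allI impI)
  show m: "set_borel_measurable lebesgue S (\<lambda>z. prod (u z) (v z))"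
    using u v by (intro set_borel_measurable_prod[OF bl]) (auto simp: L2_loc_def Linf_loc_def)
  fix K assume K: "compact K \<and> K \<subseteq> S"
  obtain C where C: "0 \<le> C" "\<And>a b. norm (prod a b) \<le> norm a * norm b * C"
    using bounded_bilinear.nonneg_bounded[OF bl] by blast
  obtain B where B: "AE z\<in>K in lebesgue. norm (u z) \<le> B" using u K by (auto simp: Linf_loc_def)
  show "set_integrable lebesgue K (\<lambda>z. (norm (prod (u z) (v z)))\<^sup>2)"
  proof (rule set_integrable_bound)
    show "set_integrable lebesgue K (\<lambda>z. (B * C)\<^sup>2 * (norm (v z))\<^sup>2)"
      using v K by (intro set_integrable_mult_right) (auto simp: L2_loc_def)
    show "set_borel_measurable lebesgue K (\<lambda>z. (norm (prod (u z) (v z)))\<^sup>2)"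
      using K by (intro set_borel_measurable_norm_sq set_borel_measurable_compact[OF m]) auto
    show "AE x\<in>K in lebesgue. norm ((norm (prod (u x) (v x)))\<^sup>2) \<le> norm ((B * C)\<^sup>2 * (norm (v x))\<^sup>2)"
      using B
    proof eventually_elim
      case (elim z)
      show ?case
      proof
        assume "z \<in> K"
        then have "norm (u z) * norm (v z) * C \<le> B * norm (v z) * C"
          using elim C(1) by (intro mult_right_mono) auto
        then have "norm (prod (u z) (v z)) \<le> (B * C) * norm (v z)" using C(2)[of "u z" "v z"] by (simp add: mult_ac)
        then have "(norm (prod (u z) (v z)))\<^sup>2 \<le> ((B * C) * norm (v z))\<^sup>2" by (intro power_mono) auto
        then show "norm ((norm (prod (u z) (v z)))\<^sup>2) \<le> norm ((B * C)\<^sup>2 * (norm (v z))\<^sup>2)"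
          by (simp add: power_mult_distrib)
      qed
    qed
  qed
qed

section \<open>Linearity of weak derivatives and Sobolev classes\<close>

lemma has_weak_deriv_add:
  assumes "has_weak_deriv S d u u'" "has_weak_deriv S d v v'" "d \<in> {1, \<i>}"
  shows "has_weak_deriv S d (\<lambda>z. u z + v z) (\<lambda>z. u' z + v' z)"
proof -
  \<comment> \<open>Additivity of the integral over S needs integrability there, while the functions
    are only locally integrable; the compact support of the test function supplies it.\<close>
  have int: "set_integrable lebesgue S (\<lambda>z. g z *\<^sub>R w z)"
    if w: "L1_loc S w" and g: "g \<in> borel_measurable borel" "\<And>z. \<bar>g z\<bar> \<le> C" and K: "compact K" "K \<subseteq> S" "\<And>z. z \<notin> K \<Longrightarrow> g z = 0"
    for g C K and w :: "complex \<Rightarrow> 'a"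
  proof -
    have "set_integrable lebesgue K (\<lambda>z. C *\<^sub>R w z)" using w K by (simp add: L1_loc_def)
    moreover have wK: "(\<lambda>z. indicator K z *\<^sub>R w z) \<in> borel_measurable lebesgue"
      using w K by (auto simp: L1_loc_def set_borel_measurable_def[symmetric] intro: set_borel_measurable_compact)
    have gm: "g \<in> borel_measurable lebesgue" using g(1) by (intro measurable_completion) simp
    have "(\<lambda>z. g z *\<^sub>R (indicator K z *\<^sub>R w z)) \<in> borel_measurable lebesgue"
      by (rule borel_measurable_scaleR[OF gm wK])
    then have "set_borel_measurable lebesgue K (\<lambda>z. g z *\<^sub>R w z)"
      by (simp add: set_borel_measurable_def mult.commute)
    ultimately have "set_integrable lebesgue K (\<lambda>z. g z *\<^sub>R w z)"
      by (rule set_integrable_bound)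
         (use g(2) in \<open>auto intro!: AE_I2 mult_right_mono intro: order_trans[OF _ abs_ge_self]\<close>)
    moreover have "indicator K z *\<^sub>R g z *\<^sub>R w z = indicator S z *\<^sub>R g z *\<^sub>R w z" for z
      using K by (cases "z \<in> K") auto
    ultimately show ?thesis unfolding set_integrable_def by (simp only:)
  qed
  show ?thesis
    unfolding has_weak_deriv_def
  proof (intro conjI allI impI)
    show "L1_loc S (\<lambda>z. u z + v z)" "L1_loc S (\<lambda>z. u' z + v' z)"
      using assms by (auto simp: has_weak_deriv_def intro: L1_loc_add)
    fix f assume f: "test_function S f"
    obtain K where K: "compact K" "K \<subseteq> S" "\<And>z. z \<notin> K \<Longrightarrow> f z = 0" "\<And>z. z \<notin> K \<Longrightarrow> frechet_derivative f (at z) = (\<lambda>_. 0)"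
      using test_function_support[OF f] by metis
    have m: "f \<in> borel_measurable borel" "(\<lambda>z. frechet_derivative f (at z) d) \<in> borel_measurable borel"
      by (rule borel_measurable_continuous_onI test_function_continuous[OF f] test_function_deriv_continuous[OF f assms(3)])+
    obtain C where C: "\<And>z. \<bar>f z\<bar> \<le> C" using test_function_bounded[OF f] by metis
    obtain C' where C': "\<And>z. \<bar>frechet_derivative f (at z) d\<bar> \<le> C'" using test_function_deriv_bounded[OF f assms(3)] by metis
    have L: "L1_loc S u" "L1_loc S u'" "L1_loc S v" "L1_loc S v'" using assms by (auto simp: has_weak_deriv_def)
    have K0: "\<And>z. z \<notin> K \<Longrightarrow> frechet_derivative f (at z) d = 0" using K(4) by simp
    show "(LINT z:S|lebesgue. frechet_derivative f (at z) d *\<^sub>R (u z + v z)) = - (LINT z:S|lebesgue. f z *\<^sub>R (u' z + v' z))"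
      unfolding scaleR_add_right
      using assms(1,2) f
        set_integral_add(2)[OF int[OF L(1) m(2) C' K(1,2) K0] int[OF L(3) m(2) C' K(1,2) K0]]
        set_integral_add(2)[OF int[OF L(2) m(1) C K(1,2,3)] int[OF L(4) m(1) C K(1,2,3)]]
      by (simp add: has_weak_deriv_def)
  qed
qed

lemma has_weak_deriv_scaleR:
  assumes "has_weak_deriv S d u u'"
  shows "has_weak_deriv S d (\<lambda>z. c *\<^sub>R u z) (\<lambda>z. c *\<^sub>R u' z)"
proof -
  have "(LINT z:S|lebesgue. g z *\<^sub>R c *\<^sub>R w z) = c *\<^sub>R (LINT z:S|lebesgue. g z *\<^sub>R w z)"
    for g and w :: "complex \<Rightarrow> 'a"
    using set_integral_scaleR_right[of lebesgue S c "\<lambda>z. g z *\<^sub>R w z"] by (simp only: scaleR_left_commute)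
  then show ?thesis using assms by (auto simp: has_weak_deriv_def intro: L1_loc_scaleR)
qed

lemma sobolev_loc_add:
  "open S \<Longrightarrow> sobolev_loc k S u \<Longrightarrow> sobolev_loc k S v \<Longrightarrow> sobolev_loc k S (\<lambda>z. u z + v z)"
proof (induction k arbitrary: u v)
  case 0
  then show ?case by (simp add: L2_loc_add)
next
  case (Suc k)
  show ?case
  proof (rule sobolev_loc_SucI[OF Suc.prems(1) L2_loc_add[OF Suc.prems(2,3)[THEN sobolev_loc_L2]]])
    fix d :: complex assume d: "d \<in> {1, \<i>}"
    note D = sobolev_loc_SucD[OF Suc.prems(2) d] sobolev_loc_SucD[OF Suc.prems(3) d]
    show "\<exists>w. has_weak_deriv S d (\<lambda>z. u z + v z) w \<and> sobolev_loc k S w"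
      using has_weak_deriv_add[OF D(1,3) d] Suc.IH[OF Suc.prems(1) D(2,4)] by blast
  qed
qed

lemma sobolev_loc_scaleR:
  "open S \<Longrightarrow> sobolev_loc k S u \<Longrightarrow> sobolev_loc k S (\<lambda>z. c *\<^sub>R u z)"
proof (induction k arbitrary: u)
  case 0
  then show ?case by (simp add: L2_loc_scaleR)
next
  case (Suc k)
  show ?case
  proof (rule sobolev_loc_SucI[OF Suc.prems(1) L2_loc_scaleR[OF Suc.prems(2)[THEN sobolev_loc_L2]]])
    fix d :: complex assume d: "d \<in> {1, \<i>}"
    note D = sobolev_loc_SucD[OF Suc.prems(2) d]
    show "\<exists>w. has_weak_deriv S d (\<lambda>z. c *\<^sub>R u z) w \<and> sobolev_loc k S w"
      using has_weak_deriv_scaleR[OF D(1)] Suc.IH[OF Suc.prems(1) D(2)] by blast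
  qed
qed

text \<open>The Leibniz expression consists of products of two L^2 functions and so is only locally
  L^1. That the product itself is nevertheless in L^2 is the embedding
  \<open>W11_L2_bound\<close>.\<close>

lemma sobolev_loc_1_prod:
  fixes prod :: "'a::euclidean_space \<Rightarrow> 'b::euclidean_space \<Rightarrow> 'c::euclidean_space"
  assumes bl: "bounded_bilinear prod" and S: "open S"
    and u: "sobolev_loc (Suc 0) S u" and v: "sobolev_loc (Suc 0) S v"
  shows "d \<in> {1, \<i>} \<Longrightarrow> has_weak_deriv S d (\<lambda>z. prod (u z) (v z))
      (\<lambda>z. prod (weak_deriv S d u z) (v z) + prod (u z) (weak_deriv S d v z))"
    and "L2_loc S (\<lambda>z. prod (u z) (v z))"
proof -
  have L: "L2_loc S u" "L2_loc S v" using u v by (auto dest: sobolev_loc_L2)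
  have D: "has_weak_deriv S d (\<lambda>z. prod (u z) (v z)) (\<lambda>z. prod (weak_deriv S d u z) (v z) + prod (u z) (weak_deriv S d v z))"
    if d: "d \<in> {1, \<i>}" for d
  proof -
    note D = sobolev_loc_SucD[OF u d] sobolev_loc_SucD[OF v d]
    show ?thesis
      by (rule has_weak_deriv_prod[OF bl S d D(1,3)])
         (use L D(2,4) in \<open>auto intro!: L1_loc_add L2_loc_prod_L1[OF bl]\<close>)
  qed
  then show "d \<in> {1, \<i>} \<Longrightarrow> has_weak_deriv S d (\<lambda>z. prod (u z) (v z))
      (\<lambda>z. prod (weak_deriv S d u z) (v z) + prod (u z) (weak_deriv S d v z))" .
  have "set_borel_measurable lebesgue S (\<lambda>z. prod (u z) (v z))"
    using L by (intro set_borel_measurable_prod[OF bl]) (auto simp: L2_loc_def)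
  then show "L2_loc S (\<lambda>z. prod (u z) (v z))"
    using W11_L2_bound[OF S D[of 1] D[of \<i>]] by (simp add: L2_loc_def)
qed

lemma sobolev_loc_2_Linf:
  assumes S: "open S" and u: "sobolev_loc (Suc (Suc 0)) S u"
  shows "Linf_loc S u"
proof -
  have d: "1 \<in> {1, \<i>}" "\<i> \<in> {1, \<i>}" by auto
  show ?thesis
    using W21_bounded[OF S sobolev_loc_SucD(1)[OF u d(1)] sobolev_loc_SucD(1)[OF u d(2)]
        sobolev_loc_SucD(1)[OF sobolev_loc_SucD(2)[OF u d(1)] d(2)]] sobolev_loc_L2[OF u]
    by (auto simp: Linf_loc_def L2_loc_def)
qed

text \<open>In the Leibniz expression the term with the derivative of \<open>u\<close> is a product
  of two functions of class 1, so it is in L^2 by \<open>sobolev_loc_1_prod\<close>; the term with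
  the derivative of \<open>v\<close> is a bounded function times an L^2 function.\<close>

lemma sobolev_loc_2_prod_1:
  fixes prod :: "'a::euclidean_space \<Rightarrow> 'b::euclidean_space \<Rightarrow> 'c::euclidean_space"
  assumes bl: "bounded_bilinear prod" and S: "open S"
    and u: "sobolev_loc (Suc (Suc 0)) S u" and v: "sobolev_loc (Suc 0) S v"
  shows "sobolev_loc (Suc 0) S (\<lambda>z. prod (u z) (v z))"
proof (rule sobolev_loc_SucI[OF S])
  note u1 = sobolev_loc_Suc_imp[OF S u]
  show "L2_loc S (\<lambda>z. prod (u z) (v z))" by (rule sobolev_loc_1_prod(2)[OF bl S u1 v])
  fix d :: complex assume d: "d \<in> {1, \<i>}"
  have "L2_loc S (\<lambda>z. prod (weak_deriv S d u z) (v z) + prod (u z) (weak_deriv S d v z))"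
    using sobolev_loc_1_prod(2)[OF bl S sobolev_loc_SucD(2)[OF u d] v]
      Linf_loc_prod_L2[OF bl sobolev_loc_2_Linf[OF S u]] sobolev_loc_SucD(2)[OF v d]
    by (auto intro: L2_loc_add)
  then show "\<exists>w. has_weak_deriv S d (\<lambda>z. prod (u z) (v z)) w \<and> sobolev_loc 0 S w"
    using sobolev_loc_1_prod(1)[OF bl S u1 v d] by auto
qed

text \<open>Allowing different orders for the two factors is what makes the induction close:
  differentiating one factor lowers only its own order. The algebra property is the case j =
  m.\<close>

lemma sobolev_loc_prod:
  fixes prod :: "'a::euclidean_space \<Rightarrow> 'b::euclidean_space \<Rightarrow> 'c::euclidean_space"
  assumes bl: "bounded_bilinear prod" and S: "open S"
  shows "2 \<le> m \<Longrightarrow> j \<le> m \<Longrightarrow> sobolev_loc m S u \<Longrightarrow> sobolev_loc j S v \<Longrightarrow> sobolev_loc j S (\<lambda>z. prod (u z) (v z))"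
proof (induction j arbitrary: m u v)
  case 0
  have "sobolev_loc (Suc (Suc 0)) S u" by (rule sobolev_loc_mono[OF S 0(3)]) (use 0 in simp)
  then show ?case using Linf_loc_prod_L2[OF bl sobolev_loc_2_Linf[OF S]] 0 by simp
next
  case (Suc j)
  have u2: "sobolev_loc (Suc (Suc 0)) S u" by (rule sobolev_loc_mono[OF S Suc.prems(3)]) (use Suc.prems in simp)
  have u1: "sobolev_loc (Suc 0) S u" by (rule sobolev_loc_Suc_imp[OF S u2])
  have v1: "sobolev_loc (Suc 0) S v" by (rule sobolev_loc_mono[OF S Suc.prems(4)]) simp
  show ?case
  proof (cases j)
    case 0
    then show ?thesis using sobolev_loc_2_prod_1[OF bl S u2 v1] by simp
  next
    case j: (Suc i)
    show ?thesis
    proof (rule sobolev_loc_SucI[OF S sobolev_loc_1_prod(2)[OF bl S u1 v1]])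
      fix d :: complex assume d: "d \<in> {1, \<i>}"
      obtain m' where m': "m = Suc m'" using Suc.prems(1) by (cases m) auto
      have Du: "sobolev_loc m' S (weak_deriv S d u)" using sobolev_loc_SucD(2)[OF _ d] Suc.prems(3) m' by blast
      have vj: "sobolev_loc j S v" by (rule sobolev_loc_Suc_imp[OF S Suc.prems(4)])
      have "sobolev_loc j S (\<lambda>z. prod (u z) (weak_deriv S d v z))"
        by (rule Suc.IH[OF Suc.prems(1) _ Suc.prems(3) sobolev_loc_SucD(2)[OF Suc.prems(4) d]]) (use Suc.prems in simp)
      moreover have "sobolev_loc j S (\<lambda>z. prod (weak_deriv S d u z) (v z))"
      proof (cases "2 \<le> m'")
        case True
        then show ?thesis by (rule Suc.IH[OF _ _ Du vj]) (use Suc.prems m' in simp)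
      next
        case False
        \<comment> \<open>The borderline m = 2: the derivative of \<open>u\<close> has dropped to
          class 1, but then \<open>v\<close> has class 2, so the factors exchange roles.\<close>
        then have eq: "m' = Suc 0" "j = Suc 0" using Suc.prems m' j by auto
        have "sobolev_loc (Suc (Suc 0)) S v" using Suc.prems(4) eq by simp
        from sobolev_loc_2_prod_1[OF bounded_bilinear.flip[OF bl] S this] Du eq show ?thesis by simp
      qed
      ultimately have "sobolev_loc j S (\<lambda>z. prod (weak_deriv S d u z) (v z) + prod (u z) (weak_deriv S d v z))"
        by (intro sobolev_loc_add[OF S])
      then show "\<exists>w. has_weak_deriv S d (\<lambda>z. prod (u z) (v z)) w \<and> sobolev_loc j S w"
        using sobolev_loc_1_prod(1)[OF bl S u1 v1 d] by blast
    qed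
  qed
qed

section \<open>Matrices\<close>

lemma bounded_bilinear_matrix_mult: "bounded_bilinear ((**) :: 'r mat \<Rightarrow> 'r mat \<Rightarrow> 'r::finite mat)"
  unfolding bilinear_conv_bounded_bilinear[symmetric]
  by (auto simp: bilinear_def distrib_left distrib_right sum.distrib 
      matrix_matrix_mult_def vec_eq_iff scaleR_sum_right intro!: linearI sum.cong)

lemma bounded_bilinear_commutator: "bounded_bilinear (commutator :: 'r mat \<Rightarrow> 'r mat \<Rightarrow> 'r::finite mat)"
proof -
  interpret bounded_bilinear "(**) :: 'r mat \<Rightarrow> 'r mat \<Rightarrow> 'r::finite mat" by (rule bounded_bilinear_matrix_mult)
  show ?thesis unfolding bilinear_conv_bounded_bilinear[symmetric] commutator_def
    by (auto simp: bilinear_def add_left add_right diff_left diff_right scaleR_left scaleR_right scaleR_diff_right intro!: linearI)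
qed

text \<open>This and \<open>form_inner\<close> are the pointwise operations behind
  \<open>bracket\<close> and \<open>inner_L2\<close>, isolated as bilinear maps of matrices so that
  the product lemmas for Sobolev and L^2 functions apply to them.\<close>

definition form_bracket :: "'r::finite mat \<times> 'r mat \<Rightarrow> 'r mat \<Rightarrow> 'r mat \<times> 'r mat" where
  "form_bracket a x = (commutator (fst a) x, commutator (snd a) x)"

definition form_inner :: "'r::finite mat \<times> 'r mat \<Rightarrow> 'r mat \<times> 'r mat \<Rightarrow> real" where
  "form_inner a b = - Re (trace (fst a ** fst b + snd a ** snd b))"

lemma bounded_bilinear_form_bracket:
  "bounded_bilinear (form_bracket :: 'r mat \<times> 'r mat \<Rightarrow> 'r mat \<Rightarrow> 'r mat \<times> 'r::finite mat)"
proof -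
  interpret bounded_bilinear "commutator :: 'r mat \<Rightarrow> 'r mat \<Rightarrow> 'r::finite mat" by (rule bounded_bilinear_commutator)
  show ?thesis unfolding bilinear_conv_bounded_bilinear[symmetric] form_bracket_def
    by (auto simp: bilinear_def add_left add_right scaleR_left scaleR_right intro!: linearI)
qed

lemma trace_scaleR: "trace (c *\<^sub>R (X :: 'r::finite mat)) = c *\<^sub>R trace X"
  by (simp add: trace_def scaleR_sum_right)

lemma bounded_bilinear_form_inner:
  "bounded_bilinear (form_inner :: 'r mat \<times> 'r mat \<Rightarrow> 'r mat \<times> 'r::finite mat \<Rightarrow> real)"
proof -
  interpret bounded_bilinear "(**) :: 'r mat \<Rightarrow> 'r mat \<Rightarrow> 'r::finite mat" by (rule bounded_bilinear_matrix_mult)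
  show ?thesis unfolding bilinear_conv_bounded_bilinear[symmetric] form_inner_def
    by (auto simp: bilinear_def add_left add_right scaleR_left scaleR_right trace_add trace_scaleR algebra_simps intro!: linearI)
qed

lemma form_inner_commute: "form_inner a b = form_inner b a"
  by (simp add: form_inner_def trace_add trace_mul_sym[of "fst a"] trace_mul_sym[of "snd a"])

text \<open>Invariance of the trace form: by cyclicity of the trace, bracketing with a fixed matrix
  is a skew operation.\<close>

lemma form_inner_bracket:
  fixes x :: "'r::finite mat"
  shows "form_inner (form_bracket a x) b = - form_inner a (form_bracket b x)"
proof -
  interpret bounded_bilinear "(**) :: 'r mat \<Rightarrow> 'r mat \<Rightarrow> 'r::finite mat" by (rule bounded_bilinear_matrix_mult)
  have "trace (commutator X x ** Y) = - trace (X ** commutator Y x)" for X Y :: "'r mat"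
  proof -
    have "trace ((x ** X) ** Y) = trace (X ** (Y ** x))"
      using trace_mul_sym[of x "X ** Y"] by (simp add: matrix_mul_assoc)
    then show ?thesis
      by (simp add: commutator_def diff_left diff_right trace_sub matrix_mul_assoc)
  qed
  then show ?thesis by (simp add: form_inner_def form_bracket_def trace_add)
qed

lemma form_bracket_jacobi:
  fixes x :: "'r::finite mat"
  shows "form_bracket a (commutator x y) = form_bracket (form_bracket a x) y - form_bracket (form_bracket a y) x"
proof -
  interpret bounded_bilinear "(**) :: 'r mat \<Rightarrow> 'r mat \<Rightarrow> 'r::finite mat" by (rule bounded_bilinear_matrix_mult)
  have "commutator X (commutator x y) = commutator (commutator X x) y - commutator (commutator X y) x" for X :: "'r mat"
    by (simp add: commutator_def diff_left diff_right matrix_mul_assoc)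
  then show ?thesis by (simp add: form_bracket_def)
qed

lemma commutator_swap: "commutator x y = - commutator y x"
  by (simp add: commutator_def)

lemma bracket_eq: "bracket \<phi> \<xi> = (\<lambda>p z. form_bracket (\<phi> p z) (\<xi> p z))"
  by (simp add: bracket_def form_bracket_def)

lemma inner_L2_eq: "inner_L2 A E \<phi> \<psi> = integral_M A E (\<lambda>p z. form_inner (\<phi> p z) (\<psi> p z))"
  by (simp add: inner_L2_def form_inner_def)

lemma matrix_inv_mult:
  fixes g :: "'r::finite mat"
  assumes "invertible g"
  shows "matrix_inv g ** g = mat 1" "g ** matrix_inv g = mat 1"
  using someI_ex[OF assms[unfolded invertible_def]] by (auto simp: matrix_inv_def)

lemma conj_by_linear:
  fixes g :: "'r::finite mat"
  shows "conj_by g (X + Y) = conj_by g X + conj_by g Y" "conj_by g (c *\<^sub>R X) = c *\<^sub>R conj_by g X"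
proof -
  interpret bounded_bilinear "(**) :: 'r mat \<Rightarrow> 'r mat \<Rightarrow> 'r::finite mat" by (rule bounded_bilinear_matrix_mult)
  show "conj_by g (X + Y) = conj_by g X + conj_by g Y" "conj_by g (c *\<^sub>R X) = c *\<^sub>R conj_by g X"
    by (simp_all add: conj_by_def add_left add_right scaleR_left scaleR_right)
qed

lemma conj_by_commutator:
  fixes g :: "'r::finite mat"
  assumes "invertible g"
  shows "conj_by g (commutator X Y) = commutator (conj_by g X) (conj_by g Y)"
proof -
  interpret bounded_bilinear "(**) :: 'r mat \<Rightarrow> 'r mat \<Rightarrow> 'r::finite mat" by (rule bounded_bilinear_matrix_mult)
  have "conj_by g X ** conj_by g Y = conj_by g (X ** Y)" for X Y
  proof -
    have "conj_by g X ** conj_by g Y = g ** X ** (matrix_inv g ** g) ** Y ** matrix_inv g"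
      by (simp add: conj_by_def matrix_mul_assoc)
    then show ?thesis by (simp add: matrix_inv_mult[OF assms] conj_by_def matrix_mul_assoc)
  qed
  then show ?thesis by (simp add: commutator_def conj_by_def diff_left diff_right)
qed

lemma adjoint_mat_linear:
  "adjoint_mat (X + Y) = adjoint_mat X + adjoint_mat Y" "adjoint_mat (X - Y) = adjoint_mat X - adjoint_mat Y"
  "adjoint_mat (c *\<^sub>R X) = c *\<^sub>R adjoint_mat X"
  by (simp_all add: adjoint_mat_def vec_eq_iff)

lemma adjoint_mat_mult: "adjoint_mat (X ** Y) = adjoint_mat Y ** adjoint_mat X"
  by (simp add: adjoint_mat_def matrix_matrix_mult_def vec_eq_iff mult.commute)

lemma skew_adjoint_linear:
  "skew_adjoint X \<Longrightarrow> skew_adjoint Y \<Longrightarrow> skew_adjoint (X + Y)"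
  "skew_adjoint X \<Longrightarrow> skew_adjoint (c *\<^sub>R X)"
  by (simp_all add: skew_adjoint_def adjoint_mat_linear)

lemma skew_adjoint_commutator:
  fixes X :: "'r::finite mat"
  shows "skew_adjoint X \<Longrightarrow> skew_adjoint Y \<Longrightarrow> skew_adjoint (commutator X Y)"
proof -
  interpret bounded_bilinear "(**) :: 'r mat \<Rightarrow> 'r mat \<Rightarrow> 'r::finite mat" by (rule bounded_bilinear_matrix_mult)
  show "skew_adjoint X \<Longrightarrow> skew_adjoint Y \<Longrightarrow> skew_adjoint (commutator X Y)"
    by (simp add: skew_adjoint_def commutator_def adjoint_mat_linear adjoint_mat_mult minus_left minus_right)
qed

section \<open>Patches\<close>

lemma chart_facts:
  assumes "compact_riemann_surface A" "c \<in> A"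
  shows "open (fst c)" "open (snd c ` fst c)"
    "homeomorphism (fst c) (snd c ` fst c) (snd c) (inv_into (fst c) (snd c))"
  using assms by (auto simp: compact_riemann_surface_def case_prod_beta)

lemma chart_change_holomorphic:
  assumes "compact_riemann_surface A" "c \<in> A" "c' \<in> A"
  shows "(snd c' \<circ> inv_into (fst c) (snd c)) holomorphic_on snd c ` (fst c \<inter> fst c')"
  using assms unfolding compact_riemann_surface_def case_prod_beta by blast

lemma frame_facts:
  assumes "hermitian_vector_bundle A E" "f \<in> bframes E"
  shows "open (fst f)"
    and "x \<in> fst f \<Longrightarrow> bij_betw (snd f x) UNIV {y. bproj E y = x}"
    and "x \<in> fst f \<Longrightarrow> snd f x (v + w) = badd E (snd f x v) (snd f x w)"
    and "x \<in> fst f \<Longrightarrow> snd f x (c *s v) = bscale E c (snd f x v)"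
  using assms unfolding hermitian_vector_bundle_def case_prod_beta by blast+

lemma patch_chart: "p \<in> patches A E \<Longrightarrow> fst p \<in> A" and patch_frame: "p \<in> patches A E \<Longrightarrow> snd p \<in> bframes E"
  by (auto simp: patches_def)

lemma point_coord:
  assumes "compact_riemann_surface A" "p \<in> patches A E" "x \<in> fst (fst p)"
  shows "point p (coord p x) = x"
  using homeomorphism_apply1[OF chart_facts(3)[OF assms(1) patch_chart[OF assms(2)]] assms(3)]
  by (simp add: point_def coord_def)

lemma pdom_open:
  assumes "compact_riemann_surface A" "hermitian_vector_bundle A E" "p \<in> patches A E"
  shows "open (pdom p)"
  unfolding pdom_def
  using chart_facts(1)[OF assms(1) patch_chart[OF assms(3)]] frame_facts(1)[OF assms(2) patch_frame[OF assms(3)]] by blast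

lemma coord_open_image:
  assumes A: "compact_riemann_surface A" and p: "p \<in> patches A E" and B: "open B" "B \<subseteq> fst (fst p)"
  shows "open (coord p ` B)"
proof -
  note c = chart_facts[OF A patch_chart[OF p]]
  have "openin (top_of_set (fst (fst p))) B" using B by (simp add: openin_open_eq c(1))
  then have "openin (top_of_set (snd (fst p) ` fst (fst p))) (snd (fst p) ` B)"
    by (rule homeomorphism_imp_open_map[OF c(3)])
  then show ?thesis using c(2) by (simp add: openin_open_eq coord_def)
qed

lemma region_open:
  assumes "compact_riemann_surface A" "hermitian_vector_bundle A E" "p \<in> patches A E"
  shows "open (region p)"
  unfolding region_def
  by (rule coord_open_image[OF assms(1,3) pdom_open[OF assms]]) (simp add: pdom_def)

lemma overlap_subset: "overlap p q \<subseteq> region p"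
  by (auto simp: overlap_def region_def)

text \<open>The coordinate change is holomorphic, hence differentiable, and differentiable maps of
  the plane send null sets to null sets; the bad set in the coordinate of \<open>p\<close> is the
  image of the bad set in the coordinate of \<open>q\<close>.\<close>

lemma AE_coord_change:
  assumes A: "compact_riemann_surface A" and p: "p \<in> patches A E" and q: "q \<in> patches A E"
    and P: "AE w\<in>region q in lebesgue. P w"
  shows "AE z\<in>overlap p q in lebesgue. P (coord q (point p z))"
proof -
  define N where "N = {w \<in> overlap q p. \<not> P w}"
  have "AE w in lebesgue. w \<notin> N"
    using P by eventually_elim (use overlap_subset[of q p] in \<open>auto simp: N_def\<close>)
  then obtain N0 where N0: "N \<subseteq> N0" "N0 \<in> null_sets lebesgue" by (rule AE_E3) auto
  have "N \<in> null_sets lebesgue" by (rule completion.complete2[OF N0])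
  then have neg: "negligible N" by (simp add: negligible_iff_null_sets)
  have "(coord p \<circ> point q) holomorphic_on coord q ` (fst (fst q) \<inter> fst (fst p))"
    using chart_change_holomorphic[OF A patch_chart[OF q] patch_chart[OF p]] by (simp add: coord_def point_def)
  then have "(coord p \<circ> point q) holomorphic_on N"
    by (rule holomorphic_on_subset) (auto simp: N_def overlap_def pdom_def)
  then have "(coord p \<circ> point q) differentiable_on N"
    unfolding holomorphic_on_def differentiable_on_def by (blast intro: field_differentiable_imp_differentiable)
  then have "negligible ((coord p \<circ> point q) ` N)"
    by (intro negligible_differentiable_image_negligible[OF _ neg]) auto
  then have "(coord p \<circ> point q) ` N \<in> null_sets lebesgue" by (simp add: negligible_iff_null_sets)
  then have "AE z in lebesgue. z \<notin> (coord p \<circ> point q) ` N" by (rule AE_not_in)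
  then show ?thesis
  proof eventually_elim
    case (elim z)
    show ?case
    proof
      assume "z \<in> overlap p q"
      then obtain x where x: "x \<in> pdom p" "x \<in> pdom q" "z = coord p x" by (auto simp: overlap_def)
      have px: "point p z = x" using point_coord[OF A p, of x] x by (simp add: pdom_def)
      have qx: "point q (coord q x) = x" using point_coord[OF A q, of x] x by (simp add: pdom_def)
      show "P (coord q (point p z))"
      proof (rule ccontr)
        assume "\<not> P (coord q (point p z))"
        then have "coord q x \<in> N" using x px by (auto simp: N_def overlap_def)
        then have "(coord p \<circ> point q) (coord q x) \<in> (coord p \<circ> point q) ` N" by (rule imageI)
        then show False using elim qx x(3) by simp
      qed
    qed
  qed
qed

text \<open>The two frames identify the coordinate space with the same fibre, so the transition in
  the opposite direction is a two-sided inverse.\<close>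

lemma transition_invertible:
  assumes A: "compact_riemann_surface A" and E: "hermitian_vector_bundle A E"
    and p: "p \<in> patches A E" and q: "q \<in> patches A E" and z: "z \<in> overlap p q"
  shows "invertible (transition p q z)"
proof -
  obtain x where x: "x \<in> pdom p" "x \<in> pdom q" "z = coord p x" using z by (auto simp: overlap_def)
  have px: "point p z = x" using point_coord[OF A p, of x] x by (simp add: pdom_def)
  define e where "e = snd (snd p) x"
  define f where "f = snd (snd q) x"
  have xp: "x \<in> fst (snd p)" and xq: "x \<in> fst (snd q)" using x by (auto simp: pdom_def)
  note pf = frame_facts[OF E patch_frame[OF p]] and qf = frame_facts[OF E patch_frame[OF q]]
  have be: "bij_betw e UNIV {y. bproj E y = x}" using pf(2)[OF xp] by (simp add: e_def)
  have bf: "bij_betw f UNIV {y. bproj E y = x}" using qf(2)[OF xq] by (simp add: f_def)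
  have inj: "inj e" "inj f" using be bf by (auto simp: bij_betw_def)
  have range: "range e = range f" using be bf by (auto simp: bij_betw_def)
  \<comment> \<open>A frame need not be onto the total space, so \<open>inv\<close> inverts it only
    on the fibre; equality of the two ranges guarantees that it is applied there.\<close>
  have ee: "e (inv e (f v)) = f v" for v using range by (intro f_inv_into_f) auto
  have ff: "f (inv f (e v)) = e v" for v using range by (intro f_inv_into_f) auto
  have lin: "Vector_Spaces.linear (*s) (*s) (\<lambda>v. inv e (f v))"
  proof
    fix v w and c :: complex
    have "e (inv e (f v) + inv e (f w)) = f (v + w)"
      using pf(3)[OF xp] qf(3)[OF xq] ee by (simp add: e_def f_def)
    then show "inv e (f (v + w)) = inv e (f v) + inv e (f w)" using ee injD[OF inj(1)] by metis
    have "e (c *s inv e (f v)) = f (c *s v)"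
      using pf(4)[OF xp] qf(4)[OF xq] ee by (simp add: e_def f_def)
    then show "inv e (f (c *s v)) = c *s inv e (f v)" using ee injD[OF inj(1)] by metis
  qed
  have lin': "Vector_Spaces.linear (*s) (*s) (\<lambda>v. inv f (e v))"
  proof
    fix v w and c :: complex
    have "f (inv f (e v) + inv f (e w)) = e (v + w)"
      using pf(3)[OF xp] qf(3)[OF xq] ff by (simp add: e_def f_def)
    then show "inv f (e (v + w)) = inv f (e v) + inv f (e w)" using ff injD[OF inj(2)] by metis
    have "f (c *s inv f (e v)) = e (c *s v)"
      using pf(4)[OF xp] qf(4)[OF xq] ff by (simp add: e_def f_def)
    then show "inv f (e (c *s v)) = c *s inv f (e v)" using ff injD[OF inj(2)] by metis
  qed
  have "(\<lambda>v. inv e (f v)) \<circ> (\<lambda>v. inv f (e v)) = id" "(\<lambda>v. inv f (e v)) \<circ> (\<lambda>v. inv e (f v)) = id"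
    using inj by (auto simp: fun_eq_iff ee ff)
  then have "matrix (\<lambda>v. inv e (f v)) ** matrix (\<lambda>v. inv f (e v)) = mat 1"
    "matrix (\<lambda>v. inv f (e v)) ** matrix (\<lambda>v. inv e (f v)) = mat 1"
    using matrix_compose_gen[OF lin' lin] matrix_compose_gen[OF lin lin'] by (simp_all add: matrix_id_mat_1)
  then have "invertible (matrix (\<lambda>v. inv e (f v)))" unfolding invertible_def by blast
  then show ?thesis by (simp add: transition_def px e_def f_def)
qed

section \<open>Local families\<close>

lemma aeq_refl: "aeq A E u u"
  by (simp add: aeq_def)

lemma aeq_sym: "aeq A E u v \<Longrightarrow> aeq A E v u"
  unfolding aeq_def by (intro ballI, drule (1) bspec, erule eventually_mono) simp

lemma aeq_trans: "aeq A E u v \<Longrightarrow> aeq A E v w \<Longrightarrow> aeq A E u w"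
  unfolding aeq_def by (intro ballI, drule (1) bspec, drule (1) bspec, erule (1) eventually_elim2) simp

lemma aeq_map2:
  assumes "aeq A E u u'" "aeq A E v v'"
  shows "aeq A E (\<lambda>p z. f (u p z) (v p z)) (\<lambda>p z. f (u' p z) (v' p z))"
  unfolding aeq_def
proof
  fix p assume "p \<in> patches A E"
  then have "AE z\<in>region p in lebesgue. u p z = u' p z" "AE z\<in>region p in lebesgue. v p z = v' p z"
    using assms by (auto simp: aeq_def)
  then show "AE z\<in>region p in lebesgue. f (u p z) (v p z) = f (u' p z) (v' p z)"
    by eventually_elim auto
qed

lemma of_class_cong: "aeq A E u v \<Longrightarrow> of_class A E k u \<Longrightarrow> of_class A E k v"
  unfolding aeq_def of_class_def using sobolev_loc_cong by blast

definition loc_bounded ::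
  "'m chart set \<Rightarrow> ('m, 'e, 'r) herm_bundle \<Rightarrow> ('m, 'e, 'r, 'b::euclidean_space) local_family \<Rightarrow> bool" where
  "loc_bounded A E u \<longleftrightarrow> (\<forall>p\<in>patches A E. Linf_loc (region p) (u p))"

definition loc_integrable ::
  "'m chart set \<Rightarrow> ('m, 'e, 'r) herm_bundle \<Rightarrow> ('m, 'e, 'r, 'b::euclidean_space) local_family \<Rightarrow> bool" where
  "loc_integrable A E u \<longleftrightarrow> (\<forall>p\<in>patches A E. L1_loc (region p) (u p))"

lemma of_class_0: "of_class A E 0 u \<longleftrightarrow> (\<forall>p\<in>patches A E. L2_loc (region p) (u p))"
  by (simp add: of_class_def)

lemma of_class_imp_0: "of_class A E k u \<Longrightarrow> of_class A E 0 u"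
  by (auto simp: of_class_def dest: sobolev_loc_L2)

lemma of_class_0_add: "of_class A E 0 u \<Longrightarrow> of_class A E 0 v \<Longrightarrow> of_class A E 0 (\<lambda>p z. u p z + v p z)"
  by (simp add: of_class_0 L2_loc_add)

lemma of_class_0_scaleR: "of_class A E 0 u \<Longrightarrow> of_class A E 0 (\<lambda>p z. c *\<^sub>R u p z)"
  by (simp add: of_class_0 L2_loc_scaleR)

lemma of_class_0_diff: "of_class A E 0 u \<Longrightarrow> of_class A E 0 v \<Longrightarrow> of_class A E 0 (\<lambda>p z. u p z - v p z)"
  using of_class_0_add[OF _ of_class_0_scaleR[of A E v "-1"], of u] by simp

lemma of_class_0_bracket: "of_class A E 0 \<phi> \<Longrightarrow> loc_bounded A E \<xi> \<Longrightarrow> of_class A E 0 (bracket \<phi> \<xi>)"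
  unfolding bracket_eq of_class_0 loc_bounded_def
  using Linf_loc_prod_L2[OF bounded_bilinear.flip[OF bounded_bilinear_form_bracket]] by blast

lemma loc_integrable_inner:
  "of_class A E 0 \<phi> \<Longrightarrow> of_class A E 0 \<psi> \<Longrightarrow> loc_integrable A E (\<lambda>p z. form_inner (\<phi> p z) (\<psi> p z))"
  unfolding of_class_0 loc_integrable_def using L2_loc_prod_L1[OF bounded_bilinear_form_inner] by blast

section \<open>Square integrable functions\<close>

text \<open>The optimal weight would be t = sqrt (Q / P); adding a positive \<open>e\<close> to both
  roots avoids a division by zero when P or Q vanishes, and \<open>e\<close> is then sent to
  zero.\<close>

lemma sqrt_mult_bound:
  fixes P Q R :: real
  assumes "0 \<le> P" "0 \<le> Q" and R: "\<And>t. 0 < t \<Longrightarrow> 2 * R \<le> t * P + Q / t"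
  shows "R \<le> sqrt P * sqrt Q"
proof -
  have "R \<le> (sqrt P + e) * (sqrt Q + e)" if e: "0 < e" for e
  proof -
    define a where "a = sqrt P + e"
    define b where "b = sqrt Q + e"
    have ab: "0 < a" "0 < b" "P \<le> a\<^sup>2" "Q \<le> b\<^sup>2"
      using assms(1,2) e by (auto simp: a_def b_def add_nonneg_pos power2_sum)
    have "2 * R \<le> (b / a) * P + Q / (b / a)" using ab by (intro R) simp
    also have "\<dots> \<le> (b / a) * a\<^sup>2 + b\<^sup>2 / (b / a)"
      using ab by (intro add_mono mult_left_mono divide_right_mono) auto
    also have "\<dots> = 2 * (a * b)" using ab by (simp add: power2_eq_square field_simps)
    finally show ?thesis by (simp add: a_def b_def)
  qed
  then have "\<forall>\<^sub>F e in at_right 0. R \<le> (sqrt P + e) * (sqrt Q + e)"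
    by (auto simp: eventually_at_filter)
  moreover have "((\<lambda>e. (sqrt P + e) * (sqrt Q + e)) \<longlongrightarrow> (sqrt P + 0) * (sqrt Q + 0)) (at_right 0)"
    by (intro tendsto_intros)
  ultimately show ?thesis
    using tendsto_lowerbound[of "\<lambda>e. (sqrt P + e) * (sqrt Q + e)" "(sqrt P + 0) * (sqrt Q + 0)" "at_right 0" R] by simp
qed

lemma set_integral_nonneg': "(\<And>z. 0 \<le> f z) \<Longrightarrow> 0 \<le> (LINT z:K|M. (f z :: real))"
  unfolding set_lebesgue_integral_def by (intro Bochner_Integration.integral_nonneg) simp

text \<open>Cauchy-Schwarz, obtained from Young's inequality with a free weight t by integrating and
  optimising with \<open>sqrt_mult_bound\<close>. The smaller set C is there because the pieces used
  to integrate over the surface are only measurable sets inside compact ones.\<close>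

lemma L2_bilinear_bound:
  fixes prod :: "'a::euclidean_space \<Rightarrow> 'b::euclidean_space \<Rightarrow> 'c::euclidean_space"
  assumes bl: "bounded_bilinear prod" and M: "0 \<le> M" "\<And>a b. norm (prod a b) \<le> norm a * norm b * M"
    and x: "L2_loc S x" and y: "L2_loc S y" and K: "compact K" "K \<subseteq> S" and C: "C \<in> sets lebesgue" "C \<subseteq> K"
  shows "norm (LINT z:C|lebesgue. prod (x z) (y z)) \<le>
    M * (sqrt (LINT z:K|lebesgue. (norm (x z))\<^sup>2) * sqrt (LINT z:K|lebesgue. (norm (y z))\<^sup>2))"
proof -
  note KL = compact_lmeasurable_facts(1)[OF K(1)]
  define P where "P = (LINT z:K|lebesgue. (norm (x z))\<^sup>2)"
  define Q where "Q = (LINT z:K|lebesgue. (norm (y z))\<^sup>2)"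
  have ix: "set_integrable lebesgue K (\<lambda>z. (norm (x z))\<^sup>2)" and iy: "set_integrable lebesgue K (\<lambda>z. (norm (y z))\<^sup>2)"
    using x y K by (auto simp: L2_loc_def)
  have pK: "set_integrable lebesgue K (\<lambda>z. prod (x z) (y z))"
    using L2_loc_prod_L1[OF bl x y] K by (auto simp: L1_loc_def)
  have npK: "set_integrable lebesgue K (\<lambda>z. norm (prod (x z) (y z)))" by (rule set_integrable_norm[OF pK])
  have pC: "set_integrable lebesgue C (\<lambda>z. prod (x z) (y z))" by (rule set_integrable_subset[OF pK C])
  have "norm (LINT z:C|lebesgue. prod (x z) (y z)) \<le> (LINT z:C|lebesgue. norm (prod (x z) (y z)))"
    by (rule set_integral_norm_bound[OF pC])
  also have "\<dots> \<le> (LINT z:K|lebesgue. norm (prod (x z) (y z)))"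
    unfolding set_lebesgue_integral_def
    by (rule integral_mono) (use C(2) npK set_integrable_norm[OF pC] in \<open>auto simp: set_integrable_def split: split_indicator\<close>)
  also have "\<dots> \<le> sqrt (M * P) * sqrt (M * Q)"
  proof (rule sqrt_mult_bound)
    show "0 \<le> M * P" "0 \<le> M * Q" using M(1) by (simp_all add: P_def Q_def set_integral_nonneg')
    fix t :: real assume t: "0 < t"
    have "2 * norm (prod a b) \<le> (t * M) * (norm a)\<^sup>2 + (M / t) * (norm b)\<^sup>2" for a b
    proof -
      have "2 * (norm a * norm b) \<le> t * (norm a)\<^sup>2 + (norm b)\<^sup>2 / t"
        using sum_squares_bound[of "sqrt t * norm a" "norm b / sqrt t"] t
        by (simp add: power_mult_distrib power_divide)
      from mult_left_mono[OF this M(1)] M(2)[of a b] show ?thesis by (simp add: algebra_simps)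
    qed
    then have "(LINT z:K|lebesgue. 2 * norm (prod (x z) (y z))) \<le>
        (LINT z:K|lebesgue. (t * M) * (norm (x z))\<^sup>2 + (M / t) * (norm (y z))\<^sup>2)"
      by (intro set_integral_mono set_integral_add(1) set_integrable_mult_right ix iy npK)
    also have "\<dots> = (t * M) * P + (M / t) * Q"
      using ix iy by (subst set_integral_add(2)) (auto intro: set_integrable_mult_right simp: P_def Q_def)
    finally show "2 * (LINT z:K|lebesgue. norm (prod (x z) (y z))) \<le> t * (M * P) + M * Q / t" by simp
  qed
  also have "\<dots> = M * (sqrt P * sqrt Q)" using M(1) by (simp add: real_sqrt_mult mult_ac)
  finally show ?thesis by (simp add: P_def Q_def)
qed

text \<open>Coarser than the topology used in \<open>curve_deriv\<close>: only the functions
  themselves are compared, not their weak derivatives. This is all that the inner products and the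
  brackets with bounded sections see.\<close>

definition L2_tendsto ::
  "'m chart set \<Rightarrow> ('m, 'e, 'r) herm_bundle \<Rightarrow> (real \<Rightarrow> ('m, 'e, 'r, 'b::euclidean_space) local_family) \<Rightarrow>
   ('m, 'e, 'r, 'b) local_family \<Rightarrow> real filter \<Rightarrow> bool" where
  "L2_tendsto A E a b F \<longleftrightarrow> (\<forall>p\<in>patches A E. \<forall>K. compact K \<and> K \<subseteq> region p \<longrightarrow>
     ((\<lambda>h. LINT z:K|lebesgue. (norm (a h p z - b p z))\<^sup>2) \<longlongrightarrow> 0) F)"

lemma L2_tendsto_dominated:
  assumes a: "L2_tendsto A E a a' F" and b: "L2_tendsto A E b b' F"
    and La: "\<forall>\<^sub>F h in F. of_class A E 0 (a h)" "of_class A E 0 a'"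
    and Lb: "\<forall>\<^sub>F h in F. of_class A E 0 (b h)" "of_class A E 0 b'"
    and Lc: "\<forall>\<^sub>F h in F. of_class A E 0 (c h)" "of_class A E 0 c'"
    and bd: "\<And>p K. p \<in> patches A E \<Longrightarrow> compact K \<Longrightarrow> K \<subseteq> region p \<Longrightarrow> \<exists>C. \<forall>\<^sub>F h in F. AE z\<in>K in lebesgue.
      (norm (c h p z - c' p z))\<^sup>2 \<le> C * ((norm (a h p z - a' p z))\<^sup>2 + (norm (b h p z - b' p z))\<^sup>2)"
  shows "L2_tendsto A E c c' F"
  unfolding L2_tendsto_def
proof (intro ballI allI impI)
  fix p K assume p: "p \<in> patches A E" and K: "compact K \<and> K \<subseteq> region p"
  obtain C where C: "\<forall>\<^sub>F h in F. AE z\<in>K in lebesgue.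
      (norm (c h p z - c' p z))\<^sup>2 \<le> C * ((norm (a h p z - a' p z))\<^sup>2 + (norm (b h p z - b' p z))\<^sup>2)"
    using bd[OF p] K by blast
  have si: "set_integrable lebesgue K (\<lambda>z. (norm (x p z - y p z))\<^sup>2)" if "of_class A E 0 x" "of_class A E 0 y"
    for x y :: "('a, 'b, 'c, 'z::euclidean_space) local_family"
    using of_class_0_diff[OF that] p K by (auto simp: of_class_0 L2_loc_def)
  let ?I = "\<lambda>x y. LINT z:K|lebesgue. (norm (x p z - y p z))\<^sup>2"
  show "((\<lambda>h. ?I (c h) c') \<longlongrightarrow> 0) F"
  proof (rule tendsto_sandwich)
    show "\<forall>\<^sub>F h in F. 0 \<le> ?I (c h) c'" by (intro always_eventually allI set_integral_nonneg') simp
    show "\<forall>\<^sub>F h in F. ?I (c h) c' \<le> C * (?I (a h) a' + ?I (b h) b')"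
      using La(1) Lb(1) Lc(1) C
    proof eventually_elim
      case (elim h)
      note i = si[OF elim(1) La(2)] si[OF elim(2) Lb(2)]
      have "?I (c h) c' \<le> (LINT z:K|lebesgue. C * ((norm (a h p z - a' p z))\<^sup>2 + (norm (b h p z - b' p z))\<^sup>2))"
        using elim(4) by (intro set_integral_mono_AE set_integrable_mult_right set_integral_add(1) i si elim(3) Lc(2)) auto
      also have "\<dots> = C * (?I (a h) a' + ?I (b h) b')"
        by (simp add: set_integral_add(2)[OF i])
      finally show ?case .
    qed
    have "((\<lambda>h. C * (?I (a h) a' + ?I (b h) b')) \<longlongrightarrow> C * (0 + 0)) F"
      using a b p K by (intro tendsto_intros) (auto simp: L2_tendsto_def)
    then show "((\<lambda>h. C * (?I (a h) a' + ?I (b h) b')) \<longlongrightarrow> 0) F" by simp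
  qed simp
qed

lemma L2_tendsto_lincomb:
  assumes a: "L2_tendsto A E a a' F" and b: "L2_tendsto A E b b' F"
    and La: "\<forall>\<^sub>F h in F. of_class A E 0 (a h)" "of_class A E 0 a'"
    and Lb: "\<forall>\<^sub>F h in F. of_class A E 0 (b h)" "of_class A E 0 b'"
  shows "L2_tendsto A E (\<lambda>h p z. a h p z + r *\<^sub>R b h p z) (\<lambda>p z. a' p z + r *\<^sub>R b' p z) F"
proof (rule L2_tendsto_dominated[OF a b La Lb])
  show "\<forall>\<^sub>F h in F. of_class A E 0 (\<lambda>p z. a h p z + r *\<^sub>R b h p z)"
    using La(1) Lb(1) by eventually_elim (intro of_class_0_add of_class_0_scaleR)
  show "of_class A E 0 (\<lambda>p z. a' p z + r *\<^sub>R b' p z)" using La Lb by (intro of_class_0_add of_class_0_scaleR)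
  fix p K
  have "(norm ((x + r *\<^sub>R y) - (x' + r *\<^sub>R y')))\<^sup>2 \<le> (2 + 2 * r\<^sup>2) * ((norm (x - x'))\<^sup>2 + (norm (y - y'))\<^sup>2)" for x x' y y' :: 'd
  proof -
    have eq: "(x + r *\<^sub>R y) - (x' + r *\<^sub>R y') = (x - x') + r *\<^sub>R (y - y')" by (simp add: algebra_simps)
    have "(norm ((x + r *\<^sub>R y) - (x' + r *\<^sub>R y')))\<^sup>2 \<le> 2 * (norm (x - x'))\<^sup>2 + 2 * (r\<^sup>2 * (norm (y - y'))\<^sup>2)"
      unfolding eq using norm_add_sq_le[of "x - x'" "r *\<^sub>R (y - y')"] by (simp add: power_mult_distrib)
    also have "\<dots> \<le> (2 + 2 * r\<^sup>2) * ((norm (x - x'))\<^sup>2 + (norm (y - y'))\<^sup>2)"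
      by (simp add: algebra_simps)
    finally show ?thesis .
  qed
  then show "\<exists>C. \<forall>\<^sub>F h in F. AE z\<in>K in lebesgue.
      (norm ((a h p z + r *\<^sub>R b h p z) - (a' p z + r *\<^sub>R b' p z)))\<^sup>2 \<le> C * ((norm (a h p z - a' p z))\<^sup>2 + (norm (b h p z - b' p z))\<^sup>2)"
    by (intro exI[of _ "2 + 2 * r\<^sup>2"] always_eventually allI AE_I2) simp
qed

text \<open>Bracketing with a bounded section is a bounded operation on L^2 over each compact set.
  There is one source family, so it fills both slots of \<open>L2_tendsto_dominated\<close>.\<close>

lemma L2_tendsto_bracket:
  assumes a: "L2_tendsto A E a a' F" and La: "\<forall>\<^sub>F h in F. of_class A E 0 (a h)" "of_class A E 0 a'"
    and \<xi>: "loc_bounded A E \<xi>"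
  shows "L2_tendsto A E (\<lambda>h. bracket (a h) \<xi>) (bracket a' \<xi>) F"
proof (rule L2_tendsto_dominated[OF a a La La])
  interpret bounded_bilinear "form_bracket :: 'c mat \<times> 'c mat \<Rightarrow> 'c mat \<Rightarrow> 'c mat \<times> 'c mat"
    by (rule bounded_bilinear_form_bracket)
  show "\<forall>\<^sub>F h in F. of_class A E 0 (bracket (a h) \<xi>)"
    using La(1) by eventually_elim (intro of_class_0_bracket \<xi>)
  show "of_class A E 0 (bracket a' \<xi>)" by (intro of_class_0_bracket \<xi> La)
  fix p K assume p: "p \<in> patches A E" and K: "compact K" "K \<subseteq> region p"
  obtain M where M: "0 \<le> M" "\<And>a b. norm (form_bracket a b :: 'c mat \<times> 'c mat) \<le> norm a * norm b * M"
    using nonneg_bounded by blast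
  obtain B where B: "AE z\<in>K in lebesgue. norm (\<xi> p z) \<le> B"
    using \<xi> p K unfolding loc_bounded_def Linf_loc_def by blast
  have *: "AE z\<in>K in lebesgue. (norm (bracket (a h) \<xi> p z - bracket a' \<xi> p z))\<^sup>2 \<le>
      (B * M)\<^sup>2 * ((norm (a h p z - a' p z))\<^sup>2 + (norm (a h p z - a' p z))\<^sup>2)" for h
    using B
  proof eventually_elim
    case (elim z)
    show ?case
    proof
      assume "z \<in> K"
      then have "norm (a h p z - a' p z) * norm (\<xi> p z) * M \<le> norm (a h p z - a' p z) * B * M"
        using elim M(1) by (intro mult_right_mono mult_left_mono) auto
      then have "norm (bracket (a h) \<xi> p z - bracket a' \<xi> p z) \<le> (B * M) * norm (a h p z - a' p z)"
        using M(2)[of "a h p z - a' p z" "\<xi> p z"] by (simp add: bracket_eq diff_left mult_ac)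
      then have "(norm (bracket (a h) \<xi> p z - bracket a' \<xi> p z))\<^sup>2 \<le> ((B * M) * norm (a h p z - a' p z))\<^sup>2"
        by (intro power_mono) auto
      then show "(norm (bracket (a h) \<xi> p z - bracket a' \<xi> p z))\<^sup>2 \<le>
          (B * M)\<^sup>2 * ((norm (a h p z - a' p z))\<^sup>2 + (norm (a h p z - a' p z))\<^sup>2)"
        by (simp add: power_mult_distrib algebra_simps) (smt (verit) zero_le_mult_iff zero_le_power2)
    qed
  qed
  show "\<exists>C. \<forall>\<^sub>F h in F. AE z\<in>K in lebesgue. (norm (bracket (a h) \<xi> p z - bracket a' \<xi> p z))\<^sup>2 \<le>
      C * ((norm (a h p z - a' p z))\<^sup>2 + (norm (a h p z - a' p z))\<^sup>2)"
    by (rule exI, rule always_eventually, rule allI, rule *)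
qed

text \<open>Applied to difference quotients, this is the passage from differentiability to
  continuity.\<close>

lemma L2_tendsto_scale_0:
  assumes a: "L2_tendsto A E a a' (at 0)" and La: "\<forall>\<^sub>F h in at 0. of_class A E 0 (a h)" "of_class A E 0 a'"
  shows "L2_tendsto A E (\<lambda>h p z. h *\<^sub>R a h p z) (\<lambda>p z. 0) (at 0)"
  unfolding L2_tendsto_def
proof (intro ballI allI impI)
  fix p K assume p: "p \<in> patches A E" and K: "compact K \<and> K \<subseteq> region p"
  have si: "set_integrable lebesgue K (\<lambda>z. (norm (x p z))\<^sup>2)" if "of_class A E 0 x"
    for x :: "('a, 'b, 'c, 'd) local_family"
    using that p K by (auto simp: of_class_0 L2_loc_def)
  let ?I = "\<lambda>x. LINT z:K|lebesgue. (norm (x p z :: 'd))\<^sup>2"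
  show "((\<lambda>h. LINT z:K|lebesgue. (norm (h *\<^sub>R a h p z - 0))\<^sup>2) \<longlongrightarrow> 0) (at 0)"
  proof (rule tendsto_sandwich)
    show "\<forall>\<^sub>F h in at 0. 0 \<le> (LINT z:K|lebesgue. (norm (h *\<^sub>R a h p z - 0))\<^sup>2)"
      by (intro always_eventually allI set_integral_nonneg') simp
    show "\<forall>\<^sub>F h in at 0. (LINT z:K|lebesgue. (norm (h *\<^sub>R a h p z - 0))\<^sup>2) \<le> h\<^sup>2 * (2 * ?I (\<lambda>p z. a h p z - a' p z) + 2 * ?I a')"
      using La(1)
    proof eventually_elim
      case (elim h)
      note i = si[OF of_class_0_diff[OF elim La(2)]] si[OF La(2)]
      have "?I (a h) \<le> (LINT z:K|lebesgue. 2 * (norm (a h p z - a' p z))\<^sup>2 + 2 * (norm (a' p z))\<^sup>2)"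
        using norm_add_sq_le[of "a h p z - a' p z" "a' p z" for z]
        by (intro set_integral_mono si elim set_integral_add(1) set_integrable_mult_right i) simp
      also have "\<dots> = 2 * ?I (\<lambda>p z. a h p z - a' p z) + 2 * ?I a'"
        using i by (subst set_integral_add(2)) (auto intro: set_integrable_mult_right)
      finally have "h\<^sup>2 * ?I (a h) \<le> h\<^sup>2 * (2 * ?I (\<lambda>p z. a h p z - a' p z) + 2 * ?I a')" by (rule mult_left_mono) simp
      then show ?case by (simp add: power_mult_distrib)
    qed
    have "((\<lambda>h. h\<^sup>2 * (2 * ?I (\<lambda>p z. a h p z - a' p z) + 2 * ?I a')) \<longlongrightarrow> 0\<^sup>2 * (2 * 0 + 2 * ?I a')) (at 0)"
      using a p K by (intro tendsto_intros) (auto simp: L2_tendsto_def)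
    then show "((\<lambda>h. h\<^sup>2 * (2 * ?I (\<lambda>p z. a h p z - a' p z) + 2 * ?I a')) \<longlongrightarrow> 0) (at 0)" by simp
  qed simp
qed

lemma set_integral_norm_sq_eq_0:
  fixes x :: "complex \<Rightarrow> 'b::euclidean_space"
  assumes "set_integrable lebesgue K (\<lambda>z. (norm (x z))\<^sup>2)" "(LINT z:K|lebesgue. (norm (x z))\<^sup>2) = 0"
  shows "AE z\<in>K in lebesgue. x z = 0"
proof -
  have "AE z in lebesgue. indicator K z *\<^sub>R (norm (x z))\<^sup>2 = 0"
    using assms unfolding set_integrable_def set_lebesgue_integral_def
    by (subst integral_nonneg_eq_0_iff_AE[symmetric]) auto
  then show ?thesis by eventually_elim (auto simp: indicator_def split: if_splits)
qed

lemma sobolev_sq_nonneg: "0 \<le> sobolev_sq k S K u"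
  by (induction k arbitrary: u) (auto intro!: add_nonneg_nonneg set_integral_nonneg')

lemma sobolev_sq_ge: "(LINT z:K|lebesgue. (norm (u z))\<^sup>2) \<le> sobolev_sq k S K u"
  by (cases k) (auto intro!: add_nonneg_nonneg sobolev_sq_nonneg)

lemma curve_deriv_L2_tendsto:
  assumes "curve_deriv A E k c B 0"
  shows "L2_tendsto A E (\<lambda>h p z. (c h p z - c 0 p z) /\<^sub>R h) B (at 0)"
  unfolding L2_tendsto_def
proof (intro ballI allI impI)
  fix p K assume p: "p \<in> patches A E" and K: "compact K \<and> K \<subseteq> region p"
  have lim: "((\<lambda>h. sobolev_sq k (region p) K (\<lambda>z. (c (0 + h) p z - c 0 p z) /\<^sub>R h - B p z)) \<longlongrightarrow> 0) (at 0)"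
    using assms p K by (simp add: curve_deriv_def)
  show "((\<lambda>h. LINT z:K|lebesgue. (norm ((c h p z - c 0 p z) /\<^sub>R h - B p z))\<^sup>2) \<longlongrightarrow> 0) (at 0)"
  proof (rule tendsto_sandwich[OF _ _ tendsto_const lim])
    show "\<forall>\<^sub>F h in at 0. 0 \<le> (LINT z:K|lebesgue. (norm ((c h p z - c 0 p z) /\<^sub>R h - B p z))\<^sup>2)"
      by (intro always_eventually allI set_integral_nonneg') simp
    show "\<forall>\<^sub>F h in at 0. (LINT z:K|lebesgue. (norm ((c h p z - c 0 p z) /\<^sub>R h - B p z))\<^sup>2) \<le>
        sobolev_sq k (region p) K (\<lambda>z. (c (0 + h) p z - c 0 p z) /\<^sub>R h - B p z)"
      using sobolev_sq_ge by (intro always_eventually allI) simp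
  qed
qed

section \<open>Integration over the surface\<close>

locale surface_bundle =
  fixes A :: "'m::t2_space chart set" and E :: "('m, 'e, 'r::finite) herm_bundle"
  assumes surface: "compact_riemann_surface A" and hermitian: "hermitian_vector_bundle A E"
begin

lemma region_open': "p \<in> patches A E \<Longrightarrow> open (region p)"
  by (rule region_open[OF surface hermitian])

definition pieces :: "('m set \<times> ('m, 'e, 'r) patch) set" where
  "pieces = (SOME D. decomposition A E D)"

lemma decomposition_pieces: "decomposition A E pieces"
  unfolding pieces_def by (rule someI_ex[OF decomposition_exists[OF surface hermitian]])

text \<open>The chart image of a Borel piece is its preimage under the continuous inverse chart,
  hence Borel. The closure of the piece is compact because the surface is, and the chart maps this
  closure onto a compact subset of the region.\<close>

lemma piece:
  assumes "c \<in> pieces"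
  shows "snd c \<in> patches A E" "coord (snd c) ` fst c \<in> sets lebesgue"
    "\<exists>K. compact K \<and> K \<subseteq> region (snd c) \<and> coord (snd c) ` fst c \<subseteq> K"
proof -
  obtain B p where c: "c = (B, p)" by (cases c)
  have B: "p \<in> patches A E" "B \<in> sets borel" "closure B \<subseteq> pdom p"
    using assms decomposition_pieces by (auto simp: decomposition_def c)
  show "snd c \<in> patches A E" using B(1) by (simp add: c)
  note ch = chart_facts[OF surface patch_chart[OF B(1)]]
  let ?U = "fst (fst p)" and ?f = "snd (fst p)"
  have BU: "B \<subseteq> ?U" "closure B \<subseteq> ?U" using B(3) closure_subset[of B] by (auto simp: pdom_def)
  have cont: "continuous_on ?U ?f" "continuous_on (?f ` ?U) (inv_into ?U ?f)"
    using ch(3) by (auto simp: homeomorphism_def)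
  have "compact (UNIV :: 'm set)" using surface by (simp add: compact_riemann_surface_def)
  then have "compact (closure B)" using compact_Int_closed[of UNIV "closure B"] by simp
  then have "compact (?f ` closure B)"
    by (intro compact_continuous_image continuous_on_subset[OF cont(1)] BU(2))
  moreover have "?f ` closure B \<subseteq> region p" using B(3) by (auto simp: region_def coord_def)
  moreover have "?f ` B \<subseteq> ?f ` closure B" using closure_subset by blast
  ultimately show "\<exists>K. compact K \<and> K \<subseteq> region (snd c) \<and> coord (snd c) ` fst c \<subseteq> K"
    by (auto simp: c coord_def)
  have "?f ` B = inv_into ?U ?f -` B \<inter> ?f ` ?U"
    using homeomorphism_apply1[OF ch(3)] BU(1) by force
  moreover have "inv_into ?U ?f \<in> borel_measurable (restrict_space borel (?f ` ?U))"
    by (rule borel_measurable_continuous_on_restrict[OF cont(2)])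
  from measurable_sets[OF this B(2)] have "inv_into ?U ?f -` B \<inter> ?f ` ?U \<in> sets borel"
    using ch(2) by (simp add: space_restrict_space sets_restrict_space_iff)
  ultimately have "?f ` B \<in> sets borel" by simp
  then show "coord (snd c) ` fst c \<in> sets lebesgue" by (simp add: c coord_def)
qed

lemma integral_M_pieces:
  "integral_M A E \<omega> = (\<Sum>c\<in>pieces. LINT z:coord (snd c) ` fst c|lebesgue. \<omega> (snd c) z)"
  by (simp add: integral_M_def pieces_def case_prod_beta)

lemma integrable_piece:
  assumes "loc_integrable A E \<omega>" "c \<in> pieces"
  shows "set_integrable lebesgue (coord (snd c) ` fst c) (\<omega> (snd c))"
proof -
  obtain K where K: "compact K" "K \<subseteq> region (snd c)" "coord (snd c) ` fst c \<subseteq> K" using piece(3)[OF assms(2)] by blast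
  have "set_integrable lebesgue K (\<omega> (snd c))"
    using assms(1) piece(1)[OF assms(2)] K by (auto simp: loc_integrable_def L1_loc_def)
  then show ?thesis by (rule set_integrable_subset[OF _ piece(2)[OF assms(2)] K(3)])
qed

lemma integral_M_add:
  assumes "loc_integrable A E \<omega>" "loc_integrable A E \<omega>'"
  shows "integral_M A E (\<lambda>p z. \<omega> p z + \<omega>' p z) = integral_M A E \<omega> + integral_M A E \<omega>'"
  unfolding integral_M_pieces sum.distrib[symmetric]
  by (intro sum.cong refl set_integral_add(2) integrable_piece assms)

lemma integral_M_scale: "integral_M A E (\<lambda>p z. c * \<omega> p z) = c * integral_M A E \<omega>"
  unfolding integral_M_pieces sum_distrib_left by simp

lemma integral_M_cong:
  assumes "aeq A E \<omega> \<omega>'"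
  shows "integral_M A E \<omega> = integral_M A E \<omega>'"
  unfolding integral_M_pieces
proof (intro sum.cong refl set_integral_lebesgue_cong_AE)
  fix c assume c: "c \<in> pieces"
  have sub: "coord (snd c) ` fst c \<subseteq> region (snd c)" using piece(3)[OF c] by blast
  have "AE z\<in>region (snd c) in lebesgue. \<omega> (snd c) z = \<omega>' (snd c) z"
    using assms piece(1)[OF c] by (simp add: aeq_def)
  then show "AE z in lebesgue. z \<in> coord (snd c) ` fst c \<longrightarrow> \<omega> (snd c) z = \<omega>' (snd c) z"
    by eventually_elim (use sub in auto)
qed

lemma inner_L2_cong: "aeq A E a a' \<Longrightarrow> aeq A E b b' \<Longrightarrow> inner_L2 A E a b = inner_L2 A E a' b'"
  unfolding inner_L2_eq using integral_M_cong[OF aeq_map2[of A E a a' b b' form_inner]] .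

lemma inner_L2_add_left:
  assumes "of_class A E 0 a" "of_class A E 0 b" "of_class A E 0 c"
  shows "inner_L2 A E (\<lambda>p z. a p z + b p z) c = inner_L2 A E a c + inner_L2 A E b c"
proof -
  interpret bounded_bilinear "form_inner :: 'r mat \<times> 'r mat \<Rightarrow> 'r mat \<times> 'r mat \<Rightarrow> real"
    by (rule bounded_bilinear_form_inner)
  show ?thesis unfolding inner_L2_eq add_left
    by (intro integral_M_add loc_integrable_inner assms)
qed

lemma inner_L2_commute: "inner_L2 A E a b = inner_L2 A E b a"
  unfolding inner_L2_eq by (rule arg_cong[where f = "integral_M A E"], intro ext, rule form_inner_commute)

lemma inner_L2_scale_left: "inner_L2 A E (\<lambda>p z. c *\<^sub>R a p z) b = c * inner_L2 A E a b"
proof -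
  interpret bounded_bilinear "form_inner :: 'r mat \<times> 'r mat \<Rightarrow> 'r mat \<times> 'r mat \<Rightarrow> real"
    by (rule bounded_bilinear_form_inner)
  show ?thesis unfolding inner_L2_eq scaleR_left using integral_M_scale by simp
qed

lemma inner_L2_diff_left:
  assumes "of_class A E 0 a" "of_class A E 0 b" "of_class A E 0 c"
  shows "inner_L2 A E (\<lambda>p z. a p z - b p z) c = inner_L2 A E a c - inner_L2 A E b c"
  using inner_L2_add_left[OF assms(1) of_class_0_scaleR[OF assms(2), of "-1"] assms(3)]
    inner_L2_scale_left[of "-1" b c] by simp

lemma inner_L2_add_right:
  assumes "of_class A E 0 a" "of_class A E 0 b" "of_class A E 0 c"
  shows "inner_L2 A E c (\<lambda>p z. a p z + b p z) = inner_L2 A E c a + inner_L2 A E c b"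
  unfolding inner_L2_commute[of c] by (rule inner_L2_add_left[OF assms])

lemma inner_L2_diff_right:
  assumes "of_class A E 0 a" "of_class A E 0 b" "of_class A E 0 c"
  shows "inner_L2 A E c (\<lambda>p z. a p z - b p z) = inner_L2 A E c a - inner_L2 A E c b"
  unfolding inner_L2_commute[of c] by (rule inner_L2_diff_left[OF assms])

lemma inner_L2_bracket: "inner_L2 A E (bracket a x) b = - inner_L2 A E a (bracket b x)"
  unfolding inner_L2_eq bracket_eq form_inner_bracket
  using integral_M_scale[of "-1"] by simp

lemma inner_L2_tendsto:
  assumes a: "L2_tendsto A E a a' F" and b: "L2_tendsto A E b b' F"
    and La: "\<forall>\<^sub>F h in F. of_class A E 0 (a h)" "of_class A E 0 a'"
    and Lb: "\<forall>\<^sub>F h in F. of_class A E 0 (b h)" "of_class A E 0 b'"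
  shows "((\<lambda>h. inner_L2 A E (a h) (b h)) \<longlongrightarrow> inner_L2 A E a' b') F"
  unfolding inner_L2_eq integral_M_pieces
proof (rule tendsto_sum)
  interpret bounded_bilinear "form_inner :: 'r mat \<times> 'r mat \<Rightarrow> 'r mat \<times> 'r mat \<Rightarrow> real"
    by (rule bounded_bilinear_form_inner)
  fix c assume c: "c \<in> pieces"
  define p where "p = snd c"
  define C where "C = coord (snd c) ` fst c"
  obtain K where K: "compact K" "K \<subseteq> region p" "C \<subseteq> K" using piece(3)[OF c] unfolding p_def C_def by blast
  have p: "p \<in> patches A E" and C: "C \<in> sets lebesgue" using piece(1,2)[OF c] by (simp_all add: p_def C_def)
  obtain M where M: "0 \<le> M" "\<And>a b. norm (form_inner a (b :: 'r mat \<times> 'r mat)) \<le> norm a * norm b * M"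
    using nonneg_bounded by blast
  have L2: "L2_loc (region p) (x p)" if "of_class A E 0 x" for x :: "('m, 'e, 'r) form1"
    using that p by (simp add: of_class_0)
  have sC: "set_integrable lebesgue C (\<lambda>z. form_inner (x p z) (y p z))" if "of_class A E 0 x" "of_class A E 0 y" for x y :: "('m, 'e, 'r) form1"
    using integrable_piece[OF loc_integrable_inner[OF that] c] by (simp add: p_def C_def)
  have bnd: "\<bar>LINT z:C|lebesgue. form_inner (x p z) (y p z)\<bar> \<le>
      M * (sqrt (LINT z:K|lebesgue. (norm (x p z))\<^sup>2) * sqrt (LINT z:K|lebesgue. (norm (y p z))\<^sup>2))"
    if "of_class A E 0 x" "of_class A E 0 y" for x y :: "('m, 'e, 'r) form1"
    using L2_bilinear_bound[OF bounded_bilinear_form_inner M L2[OF that(1)] L2[OF that(2)] K(1,2) C K(3)] by simp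
  define X where "X h = sqrt (LINT z:K|lebesgue. (norm (a h p z - a' p z))\<^sup>2)" for h
  define Y where "Y h = sqrt (LINT z:K|lebesgue. (norm (b h p z - b' p z))\<^sup>2)" for h
  define X' where "X' = sqrt (LINT z:K|lebesgue. (norm (a' p z))\<^sup>2)"
  define Y' where "Y' = sqrt (LINT z:K|lebesgue. (norm (b' p z))\<^sup>2)"
  have "((\<lambda>h. LINT z:K|lebesgue. (norm (a h p z - a' p z))\<^sup>2) \<longlongrightarrow> 0) F"
    using a p K by (simp add: L2_tendsto_def)
  from tendsto_real_sqrt[OF this] have X: "(X \<longlongrightarrow> 0) F" by (simp add: X_def[abs_def])
  have "((\<lambda>h. LINT z:K|lebesgue. (norm (b h p z - b' p z))\<^sup>2) \<longlongrightarrow> 0) F"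
    using b p K by (simp add: L2_tendsto_def)
  from tendsto_real_sqrt[OF this] have Y: "(Y \<longlongrightarrow> 0) F" by (simp add: Y_def[abs_def])
  have "((\<lambda>h. (LINT z:C|lebesgue. form_inner (a h p z) (b h p z)) - (LINT z:C|lebesgue. form_inner (a' p z) (b' p z))) \<longlongrightarrow> 0) F"
  proof (rule Lim_null_comparison)
    show "\<forall>\<^sub>F h in F. norm ((LINT z:C|lebesgue. form_inner (a h p z) (b h p z)) - (LINT z:C|lebesgue. form_inner (a' p z) (b' p z)))
        \<le> M * (X h * Y h) + M * (X h * Y') + M * (X' * Y h)"
      using La(1) Lb(1)
    proof eventually_elim
      case (elim h)
      note da = of_class_0_diff[OF elim(1) La(2)] and db = of_class_0_diff[OF elim(2) Lb(2)]
      have "(LINT z:C|lebesgue. form_inner (a h p z) (b h p z)) - (LINT z:C|lebesgue. form_inner (a' p z) (b' p z)) =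
          (LINT z:C|lebesgue. form_inner (a h p z) (b h p z) - form_inner (a' p z) (b' p z))"
        by (intro set_integral_diff(2)[symmetric] sC elim La Lb)
      \<comment> \<open>A product of two increments plus two terms linear in one increment, each
        controlled by the Cauchy-Schwarz bound \<open>bnd\<close>.\<close>
      also have "\<dots> = (LINT z:C|lebesgue. (form_inner (a h p z - a' p z) (b h p z - b' p z) +
          form_inner (a h p z - a' p z) (b' p z)) + form_inner (a' p z) (b h p z - b' p z))"
        by (simp add: diff_left diff_right)
      also have "\<dots> = (LINT z:C|lebesgue. form_inner (a h p z - a' p z) (b h p z - b' p z)) +
          (LINT z:C|lebesgue. form_inner (a h p z - a' p z) (b' p z)) + (LINT z:C|lebesgue. form_inner (a' p z) (b h p z - b' p z))"
        using sC[OF da db] sC[OF da Lb(2)] sC[OF La(2) db] by (simp add: set_integral_add)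
      finally show ?case
        using bnd[OF da db] bnd[OF da Lb(2)] bnd[OF La(2) db]
        unfolding X_def Y_def X'_def Y'_def real_norm_def by linarith
    qed
    have "((\<lambda>h. M * (X h * Y h) + M * (X h * Y') + M * (X' * Y h)) \<longlongrightarrow> M * (0 * 0) + M * (0 * Y') + M * (X' * 0)) F"
      by (intro tendsto_intros X Y)
    then show "((\<lambda>h. M * (X h * Y h) + M * (X h * Y') + M * (X' * Y h)) \<longlongrightarrow> 0) F" by simp
  qed
  then show "((\<lambda>h. LINT z:coord (snd c) ` fst c|lebesgue. form_inner (a h (snd c) z) (b h (snd c) z)) \<longlongrightarrow>
      (LINT z:coord (snd c) ` fst c|lebesgue. form_inner (a' (snd c) z) (b' (snd c) z))) F"
    by (simp add: LIM_zero_iff C_def p_def)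
qed

text \<open>From |b - c|^2 \<le> 2 |a - b|^2 + 2 |a - c|^2 on each compact set. It serves to
  identify the variation field, which is given only as a limit of difference quotients.\<close>

lemma L2_tendsto_unique:
  fixes a :: "real \<Rightarrow> ('m, 'e, 'r, 'b::euclidean_space) local_family"
  assumes a: "L2_tendsto A E a b F" "L2_tendsto A E a c F" and F: "F \<noteq> bot"
    and La: "\<forall>\<^sub>F h in F. of_class A E 0 (a h)" and Lb: "of_class A E 0 b" "of_class A E 0 c"
  shows "aeq A E b c"
  unfolding aeq_def
proof (intro ballI AE_on_open[OF region_open'])
  fix p K assume p: "p \<in> patches A E" and K: "compact K" "K \<subseteq> region p"
  have si: "set_integrable lebesgue K (\<lambda>z. (norm (x p z - y p z))\<^sup>2)" if "of_class A E 0 x" "of_class A E 0 y"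
    for x y :: "('m, 'e, 'r, 'b) local_family"
    using of_class_0_diff[OF that] p K by (auto simp: of_class_0 L2_loc_def)
  let ?I = "\<lambda>x y. LINT z:K|lebesgue. (norm (x p z - y p z))\<^sup>2"
  have ev: "\<forall>\<^sub>F h in F. ?I b c \<le> 2 * ?I (a h) b + 2 * ?I (a h) c"
    using La
  proof eventually_elim
    case (elim h)
    note i = si[OF elim Lb(1)] si[OF elim Lb(2)]
    have "(norm (x - y))\<^sup>2 \<le> 2 * (norm (w - x))\<^sup>2 + 2 * (norm (w - y))\<^sup>2" for x y w :: 'b
      using norm_add_sq_le[of "x - w" "w - y"] by (simp add: norm_minus_commute)
    then have "?I b c \<le> (LINT z:K|lebesgue. 2 * (norm (a h p z - b p z))\<^sup>2 + 2 * (norm (a h p z - c p z))\<^sup>2)"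
      by (intro set_integral_mono si Lb set_integral_add(1) set_integrable_mult_right i)
    also have "\<dots> = 2 * ?I (a h) b + 2 * ?I (a h) c"
      using i by (subst set_integral_add(2)) (auto intro: set_integrable_mult_right)
    finally show ?case .
  qed
  have lim: "((\<lambda>h. 2 * ?I (a h) b + 2 * ?I (a h) c) \<longlongrightarrow> 2 * 0 + 2 * 0) F"
    using a p K by (intro tendsto_intros) (auto simp: L2_tendsto_def)
  have "?I b c \<le> 0" using tendsto_lowerbound[OF lim ev F] by simp
  moreover have "0 \<le> ?I b c" by (rule set_integral_nonneg') simp
  ultimately have "AE z\<in>K in lebesgue. b p z - c p z = 0"
    by (intro set_integral_norm_sq_eq_0 si Lb) simp
  then show "AE z\<in>K in lebesgue. b p z = c p z" by simp
qed

end

lemma L2_loc_Pair: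
  assumes "L2_loc S a" "L2_loc S b"
  shows "L2_loc S (\<lambda>z. (a z, b z))"
  unfolding L2_loc_def
proof (intro conjI allI impI)
  have "(\<lambda>z. (indicator S z *\<^sub>R a z, indicator S z *\<^sub>R b z)) \<in> borel_measurable lebesgue"
    using assms by (intro borel_measurable_Pair) (auto simp: L2_loc_def set_borel_measurable_def)
  then show "set_borel_measurable lebesgue S (\<lambda>z. (a z, b z))" by (simp add: set_borel_measurable_def)
  fix K assume "compact K \<and> K \<subseteq> S"
  then have "set_integrable lebesgue K (\<lambda>z. (norm (a z))\<^sup>2 + (norm (b z))\<^sup>2)"
    using assms by (intro set_integral_add(1)) (auto simp: L2_loc_def)
  then show "set_integrable lebesgue K (\<lambda>z. (norm (a z, b z))\<^sup>2)" by (simp add: norm_Pair)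
qed

text \<open>The part of \<open>cov_deriv\<close> that does not involve the connection: all weak
  derivatives are confined to this term, and the dependence on the connection is a bracket.\<close>

definition ext_deriv :: "('m, 'e, 'r::finite) endo \<Rightarrow> ('m, 'e, 'r) form1" where
  "ext_deriv \<xi> = (\<lambda>p z. (weak_deriv (region p) 1 (\<xi> p) z, weak_deriv (region p) \<i> (\<xi> p) z))"

lemma cov_deriv_eq: "cov_deriv N \<xi> = (\<lambda>p z. ext_deriv \<xi> p z + bracket N \<xi> p z)"
  by (simp add: cov_deriv_def ext_deriv_def)

context surface_bundle
begin

section \<open>Sections and covariant derivatives\<close>

lemma of_class_add: "of_class A E k u \<Longrightarrow> of_class A E k v \<Longrightarrow> of_class A E k (\<lambda>p z. u p z + v p z)"
  by (simp add: of_class_def sobolev_loc_add region_open')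

lemma of_class_scaleR: "of_class A E k u \<Longrightarrow> of_class A E k (\<lambda>p z. c *\<^sub>R u p z)"
  by (simp add: of_class_def sobolev_loc_scaleR region_open')

text \<open>For k at least 1 the order \<open>Suc k\<close> is at least 2, the order at which
  \<open>sobolev_loc_2_Linf\<close> gives local boundedness.\<close>

lemma of_class_loc_bounded:
  assumes "of_class A E (Suc k) \<xi>" "1 \<le> k" shows "loc_bounded A E \<xi>"
  unfolding loc_bounded_def
proof
  fix p assume p: "p \<in> patches A E"
  have "sobolev_loc (Suc (Suc 0)) (region p) (\<xi> p)"
    by (rule sobolev_loc_mono[OF region_open'[OF p], of "Suc k"]) (use assms p in \<open>auto simp: of_class_def simp del: sobolev_loc.simps\<close>)
  then show "Linf_loc (region p) (\<xi> p)" by (rule sobolev_loc_2_Linf[OF region_open'[OF p]])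
qed

lemma of_class_ext_deriv:
  assumes "of_class A E (Suc k) \<xi>" shows "of_class A E 0 (ext_deriv \<xi>)"
  unfolding of_class_0 ext_deriv_def
proof
  fix p assume "p \<in> patches A E"
  then have "sobolev_loc (Suc k) (region p) (\<xi> p)" using assms by (auto simp: of_class_def)
  then show "L2_loc (region p) (\<lambda>z. (weak_deriv (region p) 1 (\<xi> p) z, weak_deriv (region p) \<i> (\<xi> p) z))"
    by (intro L2_loc_Pair sobolev_loc_L2[OF sobolev_loc_SucD(2)]) auto
qed

lemma of_class_cov_deriv:
  assumes "of_class A E (Suc k) \<xi>" "1 \<le> k" "of_class A E 0 N"
  shows "of_class A E 0 (cov_deriv N \<xi>)"
  unfolding cov_deriv_eq
  by (intro of_class_0_add of_class_ext_deriv[OF assms(1)] of_class_0_bracket of_class_loc_bounded[OF assms(1,2)] assms)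

text \<open>Weak derivatives are chosen representatives, so the identities for
  \<open>ext_deriv\<close> below are derived almost everywhere, by exhibiting an explicit weak
  derivative in each direction.\<close>

lemma ext_deriv_AE_eq:
  assumes "p \<in> patches A E" "has_weak_deriv (region p) 1 (\<xi> p) v" "has_weak_deriv (region p) \<i> (\<xi> p) w"
  shows "AE z\<in>region p in lebesgue. ext_deriv \<xi> p z = (v z, w z)"
  using weak_deriv_AE_eq[OF region_open'[OF assms(1)] assms(2)] weak_deriv_AE_eq[OF region_open'[OF assms(1)] assms(3)]
  by eventually_elim (simp add: ext_deriv_def)

lemma ext_deriv_comb:
  assumes "of_class A E (Suc k) \<xi>" "of_class A E (Suc k) \<eta>"
  shows "aeq A E (ext_deriv (\<lambda>p z. a *\<^sub>R \<xi> p z + b *\<^sub>R \<eta> p z)) (\<lambda>p z. a *\<^sub>R ext_deriv \<xi> p z + b *\<^sub>R ext_deriv \<eta> p z)"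
  unfolding aeq_def
proof
  fix p assume p: "p \<in> patches A E"
  have s: "sobolev_loc (Suc k) (region p) (\<xi> p)" "sobolev_loc (Suc k) (region p) (\<eta> p)"
    using assms p by (auto simp: of_class_def)
  have D: "has_weak_deriv (region p) d (\<lambda>z. a *\<^sub>R \<xi> p z + b *\<^sub>R \<eta> p z)
      (\<lambda>z. a *\<^sub>R weak_deriv (region p) d (\<xi> p) z + b *\<^sub>R weak_deriv (region p) d (\<eta> p) z)" if "d \<in> {1, \<i>}" for d
    by (intro has_weak_deriv_add has_weak_deriv_scaleR sobolev_loc_SucD(1)[OF s(1)] sobolev_loc_SucD(1)[OF s(2)] that)
  have d: "1 \<in> {1, \<i>}" "\<i> \<in> {1, \<i>}" by auto
  show "AE z\<in>region p in lebesgue.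
      ext_deriv (\<lambda>p z. a *\<^sub>R \<xi> p z + b *\<^sub>R \<eta> p z) p z = a *\<^sub>R ext_deriv \<xi> p z + b *\<^sub>R ext_deriv \<eta> p z"
    using ext_deriv_AE_eq[OF p, of "\<lambda>p z. a *\<^sub>R \<xi> p z + b *\<^sub>R \<eta> p z", OF D[OF d(1)] D[OF d(2)]]
    by eventually_elim (simp add: ext_deriv_def)
qed

lemma ext_deriv_commutator:
  assumes "of_class A E (Suc k) \<xi>" "of_class A E (Suc k) \<eta>"
  shows "aeq A E (ext_deriv (\<lambda>p z. commutator (\<xi> p z) (\<eta> p z)))
    (\<lambda>p z. bracket (ext_deriv \<xi>) \<eta> p z - bracket (ext_deriv \<eta>) \<xi> p z)"
  unfolding aeq_def
proof
  fix p assume p: "p \<in> patches A E"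
  have s: "sobolev_loc (Suc 0) (region p) (\<xi> p)" "sobolev_loc (Suc 0) (region p) (\<eta> p)"
    by (rule sobolev_loc_mono[OF region_open'[OF p], of "Suc k"],
        use assms p in \<open>auto simp: of_class_def simp del: sobolev_loc.simps\<close>)+
  note D = sobolev_loc_1_prod(1)[OF bounded_bilinear_commutator region_open'[OF p] s]
  have d: "1 \<in> {1, \<i>}" "\<i> \<in> {1, \<i>}" by auto
  show "AE z\<in>region p in lebesgue. ext_deriv (\<lambda>p z. commutator (\<xi> p z) (\<eta> p z)) p z =
      bracket (ext_deriv \<xi>) \<eta> p z - bracket (ext_deriv \<eta>) \<xi> p z"
    using ext_deriv_AE_eq[OF p, of "\<lambda>p z. commutator (\<xi> p z) (\<eta> p z)", OF D[OF d(1)] D[OF d(2)]]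
    by eventually_elim (simp add: ext_deriv_def bracket_eq form_bracket_def commutator_swap[of "\<xi> p _"])
qed

text \<open>The Leibniz rule handles the derivative term and the Jacobi identity the bracket with
  \<open>N\<close>: the covariant derivative is a derivation of the commutator.\<close>

lemma cov_deriv_commutator:
  assumes "of_class A E (Suc k) \<xi>" "of_class A E (Suc k) \<eta>"
  shows "aeq A E (cov_deriv N (\<lambda>p z. commutator (\<xi> p z) (\<eta> p z)))
    (\<lambda>p z. bracket (cov_deriv N \<xi>) \<eta> p z - bracket (cov_deriv N \<eta>) \<xi> p z)"
proof -
  interpret bounded_bilinear "form_bracket :: 'r mat \<times> 'r mat \<Rightarrow> 'r mat \<Rightarrow> 'r mat \<times> 'r mat"
    by (rule bounded_bilinear_form_bracket)
  show ?thesis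
    unfolding aeq_def
  proof
    fix p assume "p \<in> patches A E"
    with ext_deriv_commutator[OF assms] have "AE z\<in>region p in lebesgue.
        ext_deriv (\<lambda>p z. commutator (\<xi> p z) (\<eta> p z)) p z =
        bracket (ext_deriv \<xi>) \<eta> p z - bracket (ext_deriv \<eta>) \<xi> p z"
      by (simp only: aeq_def)
    then show "AE z\<in>region p in lebesgue.
        cov_deriv N (\<lambda>p z. commutator (\<xi> p z) (\<eta> p z)) p z =
        bracket (cov_deriv N \<xi>) \<eta> p z - bracket (cov_deriv N \<eta>) \<xi> p z"
      by eventually_elim (simp add: cov_deriv_eq bracket_eq form_bracket_jacobi add_left)
  qed
qed

lemma cov_deriv_cong: "aeq A E N N' \<Longrightarrow> aeq A E (cov_deriv N \<xi>) (cov_deriv N' \<xi>)"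
  unfolding aeq_def
  by (intro ballI, drule (1) bspec, elim eventually_mono) (simp add: cov_deriv_eq bracket_eq)

lemma bracket_cong: "aeq A E \<phi> \<phi>' \<Longrightarrow> aeq A E (bracket \<phi> \<xi>) (bracket \<phi>' \<xi>)"
  unfolding aeq_def
  by (intro ballI, drule (1) bspec, elim eventually_mono) (simp add: bracket_eq)

lemma sections_u_comb:
  assumes "\<xi> \<in> sections_u A E k" "\<eta> \<in> sections_u A E k"
  shows "(\<lambda>p z. a *\<^sub>R \<xi> p z + b *\<^sub>R \<eta> p z) \<in> sections_u A E k"
proof -
  have "endo_section A E (\<lambda>p z. a *\<^sub>R \<xi> p z + b *\<^sub>R \<eta> p z)"
    unfolding endo_section_def
  proof (intro ballI)
    fix p q assume pq: "p \<in> patches A E" "q \<in> patches A E"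
    have "AE z\<in>overlap p q in lebesgue. \<xi> p z = conj_by (transition p q z) (\<xi> q (coord q (point p z)))"
      "AE z\<in>overlap p q in lebesgue. \<eta> p z = conj_by (transition p q z) (\<eta> q (coord q (point p z)))"
      using assms pq by (auto simp: sections_u_def endo_section_def)
    then show "AE z\<in>overlap p q in lebesgue. a *\<^sub>R \<xi> p z + b *\<^sub>R \<eta> p z =
        conj_by (transition p q z) (a *\<^sub>R \<xi> q (coord q (point p z)) + b *\<^sub>R \<eta> q (coord q (point p z)))"
      by eventually_elim (simp add: conj_by_linear)
  qed
  moreover have "of_class A E k (\<lambda>p z. a *\<^sub>R \<xi> p z + b *\<^sub>R \<eta> p z)"
    using assms by (intro of_class_add of_class_scaleR) (auto simp: sections_u_def)
  moreover have "AE z\<in>region p in lebesgue. skew_adjoint (a *\<^sub>R \<xi> p z + b *\<^sub>R \<eta> p z)" if p: "p \<in> patches A E" for p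
  proof -
    have "AE z\<in>region p in lebesgue. skew_adjoint (\<xi> p z)" "AE z\<in>region p in lebesgue. skew_adjoint (\<eta> p z)"
      using assms p by (auto simp: sections_u_def)
    then show ?thesis by eventually_elim (simp add: skew_adjoint_linear)
  qed
  ultimately show ?thesis by (simp add: sections_u_def)
qed

text \<open>Conjugation by the invertible transition matrices respects commutators, commutators of
  skew-adjoint matrices are skew-adjoint, and the Sobolev class is preserved by
  \<open>sobolev_loc_prod\<close> with equal orders.\<close>

lemma sections_u_commutator:
  assumes "\<xi> \<in> sections_u A E k" "\<eta> \<in> sections_u A E k" "2 \<le> k"
  shows "(\<lambda>p z. commutator (\<xi> p z) (\<eta> p z)) \<in> sections_u A E k"
proof -
  have "endo_section A E (\<lambda>p z. commutator (\<xi> p z) (\<eta> p z))"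
    unfolding endo_section_def
  proof (intro ballI)
    fix p q assume pq: "p \<in> patches A E" "q \<in> patches A E"
    have "AE z\<in>overlap p q in lebesgue. \<xi> p z = conj_by (transition p q z) (\<xi> q (coord q (point p z)))"
      "AE z\<in>overlap p q in lebesgue. \<eta> p z = conj_by (transition p q z) (\<eta> q (coord q (point p z)))"
      using assms pq by (auto simp: sections_u_def endo_section_def)
    then show "AE z\<in>overlap p q in lebesgue. commutator (\<xi> p z) (\<eta> p z) =
        conj_by (transition p q z) (commutator (\<xi> q (coord q (point p z))) (\<eta> q (coord q (point p z))))"
      by eventually_elim (simp add: conj_by_commutator[OF transition_invertible[OF surface hermitian pq]])
  qed
  moreover have "of_class A E k (\<lambda>p z. commutator (\<xi> p z) (\<eta> p z))"
    unfolding of_class_def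
  proof
    fix p assume p: "p \<in> patches A E"
    show "sobolev_loc k (region p) (\<lambda>z. commutator (\<xi> p z) (\<eta> p z))"
      by (rule sobolev_loc_prod[OF bounded_bilinear_commutator region_open'[OF p] assms(3) order_refl])
         (use assms p in \<open>auto simp: sections_u_def of_class_def\<close>)
  qed
  moreover have "AE z\<in>region p in lebesgue. skew_adjoint (commutator (\<xi> p z) (\<eta> p z))" if p: "p \<in> patches A E" for p
  proof -
    have "AE z\<in>region p in lebesgue. skew_adjoint (\<xi> p z)" "AE z\<in>region p in lebesgue. skew_adjoint (\<eta> p z)"
      using assms p by (auto simp: sections_u_def)
    then show ?thesis by eventually_elim (simp add: skew_adjoint_commutator)
  qed
  ultimately show ?thesis by (simp add: sections_u_def)
qed

text \<open>Equality in the coordinate of \<open>q\<close> holds off a null set there; comparing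
  transformation laws in the coordinate of \<open>p\<close> requires this null set to be carried
  over by the coordinate change.\<close>

lemma AE_pull_form:
  assumes ae: "aeq A E \<phi> \<phi>'" and p: "p \<in> patches A E" and q: "q \<in> patches A E"
  shows "AE z\<in>overlap p q in lebesgue. \<phi> p z = \<phi>' p z \<and> pull_form p q \<phi> z = pull_form p q \<phi>' z"
proof -
  have "AE z\<in>region p in lebesgue. \<phi> p z = \<phi>' p z" "AE w\<in>region q in lebesgue. \<phi> q w = \<phi>' q w"
    using ae p q by (auto simp: aeq_def)
  from this(1) AE_coord_change[OF surface p q this(2)] show ?thesis
    by eventually_elim (use overlap_subset[of p q] in \<open>auto simp: pull_form_def\<close>)
qed

text \<open>The given segment agrees with the one at the start of the variation only up to null
  sets, so membership, including the transformation laws on overlaps, has to be stable under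
  \<open>aeq\<close>.\<close>

lemma forms_u_cong:
  assumes ae: "aeq A E \<phi> \<phi>'" and \<phi>: "\<phi> \<in> forms_u A E k"
  shows "\<phi>' \<in> forms_u A E k"
proof -
  have "endo_form1 A E \<phi>'"
    unfolding endo_form1_def
  proof (intro ballI)
    fix p q assume pq: "p \<in> patches A E" "q \<in> patches A E"
    have "AE z\<in>overlap p q in lebesgue.
        \<phi> p z = map_prod (conj_by (transition p q z)) (conj_by (transition p q z)) (pull_form p q \<phi> z)"
      using \<phi> pq by (auto simp: forms_u_def endo_form1_def)
    with AE_pull_form[OF ae pq] show "AE z\<in>overlap p q in lebesgue.
        \<phi>' p z = map_prod (conj_by (transition p q z)) (conj_by (transition p q z)) (pull_form p q \<phi>' z)"
      by eventually_elim auto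
  qed
  moreover have "AE z\<in>region p in lebesgue. skew_adjoint (fst (\<phi>' p z)) \<and> skew_adjoint (snd (\<phi>' p z))"
    if p: "p \<in> patches A E" for p
  proof -
    have "AE z\<in>region p in lebesgue. skew_adjoint (fst (\<phi> p z)) \<and> skew_adjoint (snd (\<phi> p z))"
      "AE z\<in>region p in lebesgue. \<phi> p z = \<phi>' p z"
      using \<phi> ae p by (auto simp: forms_u_def aeq_def)
    then show ?thesis by eventually_elim auto
  qed
  ultimately show ?thesis using of_class_cong[OF ae] \<phi> by (simp add: forms_u_def)
qed

lemma connections_cong:
  assumes ae: "aeq A E N N'" and N: "N \<in> connections A E k"
  shows "N' \<in> connections A E k"
proof -
  have "connection_form A E N'"
    unfolding connection_form_def
  proof (intro ballI)
    fix p q assume pq: "p \<in> patches A E" "q \<in> patches A E"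
    have "AE z\<in>overlap p q in lebesgue.
        (let g = transition p q; dg = frechet_derivative g (at z)
         in N p z = map_prod (conj_by (g z)) (conj_by (g z)) (pull_form p q N z)
              - (dg 1 ** matrix_inv (g z), dg \<i> ** matrix_inv (g z)))"
      using N pq by (auto simp: connections_def connection_form_def)
    with AE_pull_form[OF ae pq] show "AE z\<in>overlap p q in lebesgue.
        (let g = transition p q; dg = frechet_derivative g (at z)
         in N' p z = map_prod (conj_by (g z)) (conj_by (g z)) (pull_form p q N' z)
              - (dg 1 ** matrix_inv (g z), dg \<i> ** matrix_inv (g z)))"
      by eventually_elim (auto simp: Let_def)
  qed
  moreover have "AE z\<in>region p in lebesgue. skew_adjoint (fst (N' p z)) \<and> skew_adjoint (snd (N' p z))"
    if p: "p \<in> patches A E" for p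
  proof -
    have "AE z\<in>region p in lebesgue. skew_adjoint (fst (N p z)) \<and> skew_adjoint (snd (N p z))"
      "AE z\<in>region p in lebesgue. N p z = N' p z"
      using N ae p by (auto simp: connections_def aeq_def)
    then show ?thesis by eventually_elim auto
  qed
  ultimately show ?thesis using of_class_cong[OF ae] N by (simp add: connections_def)
qed

section \<open>Variations of horizontal segments\<close>

lemma horizontal_pair_orthogonal:
  assumes "horizontal_pair A E k N \<phi>" "\<xi> \<in> sections_u A E (Suc k)"
  shows "inner_L2 A E \<phi> (cov_deriv N \<xi>) = 0"
proof -
  interpret bounded_bilinear "(**) :: 'r mat \<Rightarrow> 'r mat \<Rightarrow> 'r mat" by (rule bounded_bilinear_matrix_mult)
  have "inner_L2 A E \<phi> (cov_deriv N \<xi>) = integral_M A E (\<lambda>p z. - Re (trace (0 ** \<xi> p z)))"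
    using assms by (simp add: horizontal_pair_def has_codifferential_def)
  also have "\<dots> = 0" by (simp add: zero_left trace_def integral_M_pieces)
  finally show ?thesis .
qed

text \<open>A discrete product rule: with the difference quotients \<open>q h\<close> of \<phi> and
  \<open>n h\<close> of N, the sum of the pairing of \<open>q h\<close> with the covariant
  derivative of \<xi> at \<open>N h\<close> and of the pairing of \<open>\<phi> 0\<close> with the
  bracket of \<open>n h\<close> and \<xi> telescopes to a difference of two horizontality relations.
  It is therefore exactly zero for small nonzero h, and only the limit remains.\<close>

lemma linearised_horizontality:
  assumes k: "1 \<le> k" and \<epsilon>: "0 < \<epsilon>"
    and hor: "\<And>s. s \<in> {-\<epsilon><..<\<epsilon>} \<Longrightarrow> horizontal_pair A E k (N s) (\<phi> s)"
    and dN: "curve_deriv A E k N N' 0" and d\<phi>: "curve_deriv A E k \<phi> \<phi>' 0"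
    and \<xi>: "\<xi> \<in> sections_u A E (Suc k)"
  shows "inner_L2 A E \<phi>' (cov_deriv (N 0) \<xi>) + inner_L2 A E (\<phi> 0) (bracket N' \<xi>) = 0"
proof -
  interpret bounded_bilinear "form_bracket :: 'r mat \<times> 'r mat \<Rightarrow> 'r mat \<Rightarrow> 'r mat \<times> 'r mat"
    by (rule bounded_bilinear_form_bracket)
  define n where "n h = (\<lambda>p z. (N h p z - N 0 p z) /\<^sub>R h)" for h
  define q where "q h = (\<lambda>p z. (\<phi> h p z - \<phi> 0 p z) /\<^sub>R h)" for h
  have c\<xi>: "of_class A E (Suc k) \<xi>" using \<xi> by (simp add: sections_u_def)
  have b\<xi>: "loc_bounded A E \<xi>" by (rule of_class_loc_bounded[OF c\<xi> k])
  have L: "of_class A E 0 (N s)" "of_class A E 0 (\<phi> s)" if "s \<in> {-\<epsilon><..<\<epsilon>}" for s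
    using hor[OF that] by (auto simp: horizontal_pair_def connections_def forms_u_def intro: of_class_imp_0)
  have L0: "of_class A E 0 (N 0)" "of_class A E 0 (\<phi> 0)" using L[of 0] \<epsilon> by auto
  have L': "of_class A E 0 N'" "of_class A E 0 \<phi>'"
    using dN d\<phi> by (auto simp: curve_deriv_def forms_u_def intro: of_class_imp_0)
  have ev: "\<forall>\<^sub>F h in at 0. h \<in> {-\<epsilon><..<\<epsilon>} \<and> h \<noteq> 0"
    using \<epsilon> eventually_at_in_open'[of "{-\<epsilon><..<\<epsilon>}" 0] by (auto simp: eventually_at_filter elim: eventually_mono)
  have Ln: "\<forall>\<^sub>F h in at 0. of_class A E 0 (n h)" and Lq: "\<forall>\<^sub>F h in at 0. of_class A E 0 (q h)"
    and Lc: "\<forall>\<^sub>F h in at 0. of_class A E 0 (cov_deriv (N h) \<xi>)"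
    using ev by (eventually_elim, use L L0 in \<open>auto simp: n_def q_def intro!: of_class_0_scaleR of_class_0_diff of_class_cov_deriv[OF c\<xi> k]\<close>)+
  have Lb: "\<forall>\<^sub>F h in at 0. of_class A E 0 (bracket (n h) \<xi>)"
    using Ln by eventually_elim (rule of_class_0_bracket[OF _ b\<xi>])
  have tn: "L2_tendsto A E n N' (at 0)" and tq: "L2_tendsto A E q \<phi>' (at 0)"
    using curve_deriv_L2_tendsto[OF dN] curve_deriv_L2_tendsto[OF d\<phi>] by (simp_all add: n_def[abs_def] q_def[abs_def])
  have tb: "L2_tendsto A E (\<lambda>h. bracket (n h) \<xi>) (bracket N' \<xi>) (at 0)"
    by (rule L2_tendsto_bracket[OF tn Ln L'(1) b\<xi>])
  \<comment> \<open>The derivative of \<xi> cancels in the difference; for h = 0 both sides vanish.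
    This yields the convergence \<open>tc\<close> of the covariant derivatives.\<close>
  have eq: "h *\<^sub>R bracket (n h) \<xi> p z = cov_deriv (N h) \<xi> p z - cov_deriv (N 0) \<xi> p z" for h p z
    by (cases "h = 0") (simp_all add: cov_deriv_eq bracket_eq n_def scaleR_left diff_left)
  have tc: "L2_tendsto A E (\<lambda>h. cov_deriv (N h) \<xi>) (cov_deriv (N 0) \<xi>) (at 0)"
    using L2_tendsto_scale_0[OF tb Lb of_class_0_bracket[OF L'(1) b\<xi>]] by (simp add: L2_tendsto_def eq)
  have tconst: "L2_tendsto A E (\<lambda>h. \<phi> 0) (\<phi> 0) (at 0)" by (simp add: L2_tendsto_def)
  have "((\<lambda>h. inner_L2 A E (q h) (cov_deriv (N h) \<xi>) + inner_L2 A E (\<phi> 0) (bracket (n h) \<xi>)) \<longlongrightarrow>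
      inner_L2 A E \<phi>' (cov_deriv (N 0) \<xi>) + inner_L2 A E (\<phi> 0) (bracket N' \<xi>)) (at 0)"
    by (intro tendsto_add inner_L2_tendsto tq tc Lq Lc tconst tb Lb always_eventually allI
        of_class_cov_deriv[OF c\<xi> k] of_class_0_bracket[OF _ b\<xi>] L0 L')
  moreover have "\<forall>\<^sub>F h in at 0. inner_L2 A E (q h) (cov_deriv (N h) \<xi>) + inner_L2 A E (\<phi> 0) (bracket (n h) \<xi>) = 0"
    using ev
  proof eventually_elim
    case (elim h)
    note Lh = L[OF conjunct1[OF elim]]
    note C = of_class_cov_deriv[OF c\<xi> k]
    have zero: "inner_L2 A E (\<phi> s) (cov_deriv (N s) \<xi>) = 0" if "s \<in> {-\<epsilon><..<\<epsilon>}" for s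
      by (rule horizontal_pair_orthogonal[OF hor[OF that] \<xi>])
    have "inner_L2 A E (q h) (cov_deriv (N h) \<xi>) = inverse h * (inner_L2 A E (\<phi> h) (cov_deriv (N h) \<xi>) - inner_L2 A E (\<phi> 0) (cov_deriv (N h) \<xi>))"
      unfolding q_def inner_L2_scale_left by (subst inner_L2_diff_left[OF Lh(2) L0(2) C[OF Lh(1)]]) (rule refl)
    moreover have "inner_L2 A E (\<phi> 0) (bracket (n h) \<xi>) =
        inverse h * (inner_L2 A E (\<phi> 0) (cov_deriv (N h) \<xi>) - inner_L2 A E (\<phi> 0) (cov_deriv (N 0) \<xi>))"
    proof -
      have "bracket (n h) \<xi> = (\<lambda>p z. inverse h *\<^sub>R (cov_deriv (N h) \<xi> p z - cov_deriv (N 0) \<xi> p z))"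
        unfolding eq[symmetric] using elim by simp
      then have "inner_L2 A E (\<phi> 0) (bracket (n h) \<xi>) =
          inverse h * inner_L2 A E (\<phi> 0) (\<lambda>p z. cov_deriv (N h) \<xi> p z - cov_deriv (N 0) \<xi> p z)"
        by (simp only: inner_L2_commute[of "\<phi> 0"] inner_L2_scale_left)
      then show ?thesis by (simp only: inner_L2_diff_right[OF C[OF Lh(1)] C[OF L0(1)] L0(2)])
    qed
    ultimately show ?case using zero[of h] zero[of 0] elim \<epsilon> by simp
  qed
  then have "((\<lambda>h. inner_L2 A E (q h) (cov_deriv (N h) \<xi>) + inner_L2 A E (\<phi> 0) (bracket (n h) \<xi>)) \<longlongrightarrow> 0) (at 0)"
    by (rule tendsto_eventually)
  ultimately show ?thesis by (rule tendsto_unique[OF at_neq_bot])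
qed

text \<open>By gauge invariance the part of the variation generated by \<open>\<eta>\<close> does not contribute to the
  linearised equation; what remains is the neutral pairing of the orbit directions of \<open>\<zeta>\<close> and \<open>\<xi>\<close>.\<close>

lemma variation_neutral_orthogonal:
  assumes k: "1 \<le> k" and N: "of_class A E 0 N" and \<phi>: "of_class A E 0 \<phi>"
    and hor: "\<And>\<xi>. \<xi> \<in> sections_u A E (Suc k) \<Longrightarrow> inner_L2 A E \<phi> (cov_deriv N \<xi>) = 0"
    and lin: "\<And>\<xi>. \<xi> \<in> sections_u A E (Suc k) \<Longrightarrow>
      inner_L2 A E \<phi>' (cov_deriv N \<xi>) + inner_L2 A E \<phi> (bracket N' \<xi>) = 0"
    and \<eta>: "\<eta> \<in> sections_u A E (Suc k)" and \<zeta>: "\<zeta> \<in> sections_u A E (Suc k)" and \<xi>: "\<xi> \<in> sections_u A E (Suc k)"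
    and N': "aeq A E N' (\<lambda>p z. cov_deriv N \<eta> p z + bracket \<phi> \<zeta> p z)"
    and \<phi>': "aeq A E \<phi>' (\<lambda>p z. cov_deriv N \<zeta> p z + bracket \<phi> \<eta> p z)"
  shows "inner_L2 A E (cov_deriv N \<zeta>) (cov_deriv N \<xi>) - inner_L2 A E (bracket \<phi> \<zeta>) (bracket \<phi> \<xi>) = 0"
proof -
  interpret bounded_bilinear "form_bracket :: 'r mat \<times> 'r mat \<Rightarrow> 'r mat \<Rightarrow> 'r mat \<times> 'r mat"
    by (rule bounded_bilinear_form_bracket)
  have c: "of_class A E (Suc k) \<eta>" "of_class A E (Suc k) \<zeta>" "of_class A E (Suc k) \<xi>"
    using \<eta> \<zeta> \<xi> by (simp_all add: sections_u_def)
  note b = c[THEN of_class_loc_bounded[OF _ k]]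
  note C = c[THEN of_class_cov_deriv[OF _ k N]]
  note B = b[THEN of_class_0_bracket[OF \<phi>]]
  have "inner_L2 A E \<phi>' (cov_deriv N \<xi>) = inner_L2 A E (cov_deriv N \<zeta>) (cov_deriv N \<xi>) + inner_L2 A E (bracket \<phi> \<eta>) (cov_deriv N \<xi>)"
    by (simp only: inner_L2_cong[OF \<phi>' aeq_refl] inner_L2_add_left[OF C(2) B(1) C(3)])
  moreover have "inner_L2 A E (bracket \<phi> \<eta>) (cov_deriv N \<xi>) = - inner_L2 A E \<phi> (bracket (cov_deriv N \<xi>) \<eta>)"
    by (rule inner_L2_bracket)
  moreover have "inner_L2 A E \<phi> (bracket N' \<xi>) =
      inner_L2 A E \<phi> (bracket (cov_deriv N \<eta>) \<xi>) + inner_L2 A E \<phi> (bracket (bracket \<phi> \<zeta>) \<xi>)"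
  proof -
    have "bracket (\<lambda>p z. cov_deriv N \<eta> p z + bracket \<phi> \<zeta> p z) \<xi> =
        (\<lambda>p z. bracket (cov_deriv N \<eta>) \<xi> p z + bracket (bracket \<phi> \<zeta>) \<xi> p z)"
      by (simp add: bracket_eq add_left)
    then show ?thesis
      using inner_L2_cong[OF aeq_refl bracket_cong[OF N'], of \<phi> \<xi>]
        inner_L2_add_right[OF of_class_0_bracket[OF C(1) b(3)] of_class_0_bracket[OF B(2) b(3)] \<phi>] by simp
  qed
  moreover have "inner_L2 A E \<phi> (bracket (bracket \<phi> \<zeta>) \<xi>) = - inner_L2 A E (bracket \<phi> \<zeta>) (bracket \<phi> \<xi>)"
    using inner_L2_bracket[of \<phi> \<xi> "bracket \<phi> \<zeta>"] by (simp add: inner_L2_commute[of "bracket \<phi> \<zeta>"])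
  moreover have "inner_L2 A E \<phi> (bracket (cov_deriv N \<eta>) \<xi>) - inner_L2 A E \<phi> (bracket (cov_deriv N \<xi>) \<eta>) = 0"
  proof -
    have "(\<lambda>p z. commutator (\<eta> p z) (\<xi> p z)) \<in> sections_u A E (Suc k)"
      using k by (intro sections_u_commutator \<eta> \<xi>) simp
    from hor[OF this] show ?thesis
      unfolding inner_L2_cong[OF aeq_refl cov_deriv_commutator[OF c(1,3)]]
        inner_L2_diff_right[OF of_class_0_bracket[OF C(1) b(3)] of_class_0_bracket[OF C(3) b(1)] \<phi>] .
  qed
  ultimately show ?thesis using lin[OF \<xi>] by simp
qed

end

section \<open>Conjugate endpoints produce a degenerate gauge direction\<close>

theorem theorem4p5:
  fixes A :: "'m::t2_space chart set"
    and E :: "('m, 'e, 'r::finite) herm_bundle"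
    and k :: nat
    and \<gamma> :: "real \<Rightarrow> ('m, 'e, 'r) form1"
  assumes "compact_riemann_surface A"
    and "hermitian_vector_bundle A E"
    and "k \<ge> 1"
    and "horizontal_segment A E k \<gamma>"
    and "flat A E (\<gamma> 0)" and "flat A E (\<gamma> 1)"
    and "irreducible_connection A E k (\<gamma> (1/2))"
    and "conjugate_endpoints A E k \<gamma>"
  shows "(\<gamma> (1/2), \<lambda>p z. (1/2) *\<^sub>R (\<gamma> 1 p z - \<gamma> 0 p z)) \<in> degeneracy_locus A E k"
proof -
  interpret surface_bundle A E by unfold_locales fact+
  interpret bounded_bilinear "form_bracket :: 'r mat \<times> 'r mat \<Rightarrow> 'r mat \<Rightarrow> 'r mat \<times> 'r mat"
    by (rule bounded_bilinear_form_bracket)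
  note k = \<open>k \<ge> 1\<close>
  obtain \<epsilon> N \<phi> Y where \<epsilon>: "0 < \<epsilon>"
    and smooth: "smooth_curve A E k \<epsilon> N" "smooth_curve A E k \<epsilon> \<phi>"
    and hor: "\<And>s. s \<in> {-\<epsilon><..<\<epsilon>} \<Longrightarrow> horizontal_pair A E k (N s) (\<phi> s)"
    and seg: "\<And>t. t \<in> {0..1} \<Longrightarrow> aeq A E (segment (N 0) (\<phi> 0) t) (\<gamma> t)"
    and Y: "\<And>t. t \<in> {0..1} \<Longrightarrow> curve_deriv A E k (\<lambda>s. segment (N s) (\<phi> s) t) (Y t) 0"
    and Y01: "Y 0 \<in> orbit_tangent A E k (\<gamma> 0)" "Y 1 \<in> orbit_tangent A E k (\<gamma> 1)"
    and nontriv: "\<exists>t\<in>{0..1}. Y t \<notin> orbit_tangent A E k (\<gamma> t)"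
    using \<open>conjugate_endpoints A E k \<gamma>\<close> unfolding conjugate_endpoints_def by blast
  have zero_in: "(0::real) \<in> {-\<epsilon><..<\<epsilon>}" using \<epsilon> by simp
  obtain N' where N': "curve_deriv A E k N N' 0" using smooth(1) zero_in unfolding smooth_curve_def by metis
  obtain \<phi>' where \<phi>': "curve_deriv A E k \<phi> \<phi>' 0" using smooth(2) zero_in unfolding smooth_curve_def by metis
  have hor0: "N 0 \<in> connections A E k" "\<phi> 0 \<in> forms_u A E k"
    using hor[OF zero_in] by (auto simp: horizontal_pair_def)
  have L: "of_class A E 0 (N s)" "of_class A E 0 (\<phi> s)" if "s \<in> {-\<epsilon><..<\<epsilon>}" for s
    using hor[OF that] by (auto simp: horizontal_pair_def connections_def forms_u_def intro: of_class_imp_0)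
  have L': "of_class A E 0 N'" "of_class A E 0 \<phi>'" "\<And>t. t \<in> {0..1} \<Longrightarrow> of_class A E 0 (Y t)"
    using N' \<phi>' Y by (auto simp: curve_deriv_def forms_u_def intro: of_class_imp_0)
  \<comment> \<open>The field \<open>Y t\<close> is known only as a derivative of the segments; its
    formula follows from uniqueness of L^2 limits and holds up to null sets.\<close>
  have Y_eq: "aeq A E (Y t) (\<lambda>p z. N' p z + (2 * t - 1) *\<^sub>R \<phi>' p z)" if t: "t \<in> {0..1}" for t
  proof (rule L2_tendsto_unique[OF curve_deriv_L2_tendsto[OF Y[OF t]] _ at_neq_bot])
    have ev: "\<forall>\<^sub>F h in at 0. h \<in> {-\<epsilon><..<\<epsilon>}"
      using eventually_at_in_open'[of "{-\<epsilon><..<\<epsilon>}" 0] zero_in by simp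
    have ev1: "\<forall>\<^sub>F h in at 0. of_class A E 0 (\<lambda>p z. (N h p z - N 0 p z) /\<^sub>R h)"
      using ev by eventually_elim (intro of_class_0_scaleR of_class_0_diff L zero_in)
    have ev2: "\<forall>\<^sub>F h in at 0. of_class A E 0 (\<lambda>p z. (\<phi> h p z - \<phi> 0 p z) /\<^sub>R h)"
      using ev by eventually_elim (intro of_class_0_scaleR of_class_0_diff L zero_in)
    have eq: "(segment (N h) (\<phi> h) t p z - segment (N 0) (\<phi> 0) t p z) /\<^sub>R h =
        (N h p z - N 0 p z) /\<^sub>R h + (2 * t - 1) *\<^sub>R ((\<phi> h p z - \<phi> 0 p z) /\<^sub>R h)" for h p z
    proof -
      have "segment (N h) (\<phi> h) t p z - segment (N 0) (\<phi> 0) t p z =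
          (N h p z - N 0 p z) + (2 * t - 1) *\<^sub>R (\<phi> h p z - \<phi> 0 p z)"
        by (simp add: segment_def scaleR_diff_right)
      then show ?thesis by (simp only: scaleR_add_right scaleR_left_commute)
    qed
    show "L2_tendsto A E (\<lambda>h p z. (segment (N h) (\<phi> h) t p z - segment (N 0) (\<phi> 0) t p z) /\<^sub>R h)
        (\<lambda>p z. N' p z + (2 * t - 1) *\<^sub>R \<phi>' p z) (at 0)"
      unfolding eq
      by (rule L2_tendsto_lincomb[OF curve_deriv_L2_tendsto[OF N'] curve_deriv_L2_tendsto[OF \<phi>'] ev1 L'(1) ev2 L'(2)])
    show "\<forall>\<^sub>F h in at 0. of_class A E 0 (\<lambda>p z. (segment (N h) (\<phi> h) t p z - segment (N 0) (\<phi> 0) t p z) /\<^sub>R h)"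
      unfolding eq using ev1 ev2 by eventually_elim (rule of_class_0_add[OF _ of_class_0_scaleR])
    show "of_class A E 0 (Y t)" by (rule L'(3)[OF t])
    show "of_class A E 0 (\<lambda>p z. N' p z + (2 * t - 1) *\<^sub>R \<phi>' p z)"
      by (intro of_class_0_add of_class_0_scaleR L')
  qed
  obtain \<xi>0 where \<xi>0: "\<xi>0 \<in> sections_u A E (Suc k)" "aeq A E (Y 0) (cov_deriv (\<gamma> 0) \<xi>0)"
    using Y01(1) by (auto simp: orbit_tangent_def)
  obtain \<xi>1 where \<xi>1: "\<xi>1 \<in> sections_u A E (Suc k)" "aeq A E (Y 1) (cov_deriv (\<gamma> 1) \<xi>1)"
    using Y01(2) by (auto simp: orbit_tangent_def)
  \<comment> \<open>Both combinations are written with scalar coefficients, -1/2 for the first term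
    of \<zeta>, to fit \<open>sections_u_comb\<close> and \<open>ext_deriv_comb\<close>.\<close>
  define \<eta> where "\<eta> = (\<lambda>p z. (1/2) *\<^sub>R \<xi>0 p z + (1/2) *\<^sub>R \<xi>1 p z)"
  define \<zeta> where "\<zeta> = (\<lambda>p z. (-1/2) *\<^sub>R \<xi>0 p z + (1/2) *\<^sub>R \<xi>1 p z)"
  have \<eta>: "\<eta> \<in> sections_u A E (Suc k)" and \<zeta>: "\<zeta> \<in> sections_u A E (Suc k)"
    unfolding \<eta>_def \<zeta>_def by (intro sections_u_comb \<xi>0 \<xi>1)+
  have c01: "of_class A E (Suc k) \<xi>0" "of_class A E (Suc k) \<xi>1" using \<xi>0 \<xi>1 by (simp_all add: sections_u_def)
  have ends: "aeq A E (cov_deriv (\<gamma> t) \<xi>) (cov_deriv (segment (N 0) (\<phi> 0) t) \<xi>)" if "t \<in> {0..1}" for t \<xi>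
    by (rule cov_deriv_cong[OF aeq_sym[OF seg[OF that]]])
  have e0: "aeq A E (\<lambda>p z. N' p z - \<phi>' p z) (cov_deriv (segment (N 0) (\<phi> 0) 0) \<xi>0)"
    using aeq_trans[OF aeq_trans[OF aeq_sym[OF Y_eq[of 0]] \<xi>0(2)] ends[of 0]] by simp
  have e1: "aeq A E (\<lambda>p z. N' p z + \<phi>' p z) (cov_deriv (segment (N 0) (\<phi> 0) 1) \<xi>1)"
    using aeq_trans[OF aeq_trans[OF aeq_sym[OF Y_eq[of 1]] \<xi>1(2)] ends[of 1]] by simp
  have decomp: "AE z\<in>region p in lebesgue.
      N' p z = cov_deriv (N 0) \<eta> p z + bracket (\<phi> 0) \<zeta> p z \<and> \<phi>' p z = cov_deriv (N 0) \<zeta> p z + bracket (\<phi> 0) \<eta> p z"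
    if p: "p \<in> patches A E" for p
  proof -
    have "AE z\<in>region p in lebesgue. N' p z - \<phi>' p z = cov_deriv (segment (N 0) (\<phi> 0) 0) \<xi>0 p z"
      "AE z\<in>region p in lebesgue. N' p z + \<phi>' p z = cov_deriv (segment (N 0) (\<phi> 0) 1) \<xi>1 p z"
      "AE z\<in>region p in lebesgue. ext_deriv \<eta> p z = (1/2) *\<^sub>R ext_deriv \<xi>0 p z + (1/2) *\<^sub>R ext_deriv \<xi>1 p z"
      "AE z\<in>region p in lebesgue. ext_deriv \<zeta> p z = (-1/2) *\<^sub>R ext_deriv \<xi>0 p z + (1/2) *\<^sub>R ext_deriv \<xi>1 p z"
      using e0 e1 ext_deriv_comb[OF c01, of "1/2" "1/2"] ext_deriv_comb[OF c01, of "-1/2" "1/2"] p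
      unfolding aeq_def \<eta>_def \<zeta>_def by blast+
    then show ?thesis
    proof eventually_elim
      case (elim z)
      show ?case
      proof
        assume z: "z \<in> region p"
        define X0 where "X0 = ext_deriv \<xi>0 p z"
        define X1 where "X1 = ext_deriv \<xi>1 p z"
        define n where "n = N 0 p z"
        define f where "f = \<phi> 0 p z"
        have 1: "N' p z - \<phi>' p z = X0 + form_bracket (n - f) (\<xi>0 p z)"
          using elim(1) z by (simp add: cov_deriv_eq bracket_eq segment_def X0_def n_def f_def)
        have 2: "N' p z + \<phi>' p z = X1 + form_bracket (n + f) (\<xi>1 p z)"
          using elim(2) z by (simp add: cov_deriv_eq bracket_eq segment_def X1_def n_def f_def)
        \<comment> \<open>Adding the two endpoint equations collects the brackets with
          \<open>n\<close> into \<eta> and those with \<open>f\<close> into \<zeta>; subtracting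
          them exchanges the roles of \<eta> and \<zeta>.\<close>
        have "N' p z = (1/2) *\<^sub>R ((N' p z - \<phi>' p z) + (N' p z + \<phi>' p z))"
          by (simp add: scaleR_2[symmetric] del: scaleR_2)
        moreover have "\<phi>' p z = (1/2) *\<^sub>R ((N' p z + \<phi>' p z) - (N' p z - \<phi>' p z))"
          by (simp add: scaleR_2[symmetric] del: scaleR_2)
        ultimately show "N' p z = cov_deriv (N 0) \<eta> p z + bracket (\<phi> 0) \<zeta> p z \<and>
            \<phi>' p z = cov_deriv (N 0) \<zeta> p z + bracket (\<phi> 0) \<eta> p z"
          unfolding 1 2 using elim(3,4) z
          by (simp add: cov_deriv_eq bracket_eq X0_def[symmetric] X1_def[symmetric] n_def[symmetric] f_def[symmetric]
              \<eta>_def \<zeta>_def add_left add_right diff_left diff_right minus_right scaleR_right scaleR_add_right scaleR_diff_right)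
      qed
    qed
  qed
  have N'_eq: "aeq A E N' (\<lambda>p z. cov_deriv (N 0) \<eta> p z + bracket (\<phi> 0) \<zeta> p z)"
    unfolding aeq_def by (intro ballI, rule eventually_mono[OF decomp]) blast+
  have \<phi>'_eq: "aeq A E \<phi>' (\<lambda>p z. cov_deriv (N 0) \<zeta> p z + bracket (\<phi> 0) \<eta> p z)"
    unfolding aeq_def by (intro ballI, rule eventually_mono[OF decomp]) blast+
  \<comment> \<open>The form in the goal is read off from \<gamma>, which agrees with the segment of
    \<open>N 0\<close> and \<open>\<phi> 0\<close> only almost everywhere; hence the transport along
    \<open>mid\<close> and \<open>half\<close>.\<close>
  define \<phi>h where "\<phi>h = (\<lambda>p z. (1/2) *\<^sub>R (\<gamma> 1 p z - \<gamma> 0 p z))"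
  have mid: "aeq A E (N 0) (\<gamma> (1/2))" using seg[of "1/2"] by (simp add: segment_def)
  have half: "aeq A E (\<phi> 0) \<phi>h"
  proof -
    have "aeq A E (\<lambda>p z. (1/2) *\<^sub>R (segment (N 0) (\<phi> 0) 1 p z - segment (N 0) (\<phi> 0) 0 p z)) \<phi>h"
      unfolding \<phi>h_def using seg[of 1] seg[of 0] by (intro aeq_map2[where f = "\<lambda>x y. (1/2) *\<^sub>R (x - y)"]) simp_all
    moreover have "(1/2) *\<^sub>R (segment (N 0) (\<phi> 0) 1 p z - segment (N 0) (\<phi> 0) 0 p z) = \<phi> 0 p z" for p z
      by (simp add: segment_def scaleR_2[symmetric] del: scaleR_2)
    ultimately show ?thesis by simp
  qed
  have orth: "neutral_metric A E (cov_deriv (\<gamma> (1/2)) \<zeta>, bracket \<phi>h \<zeta>) (cov_deriv (\<gamma> (1/2)) \<xi>, bracket \<phi>h \<xi>) = 0"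
    if \<xi>: "\<xi> \<in> sections_u A E (Suc k)" for \<xi>
  proof -
    have "inner_L2 A E (cov_deriv (N 0) \<zeta>) (cov_deriv (N 0) \<xi>) - inner_L2 A E (bracket (\<phi> 0) \<zeta>) (bracket (\<phi> 0) \<xi>) = 0"
      by (rule variation_neutral_orthogonal[OF k L(1)[OF zero_in] L(2)[OF zero_in] horizontal_pair_orthogonal[OF hor[OF zero_in]]
            linearised_horizontality[OF k \<epsilon> hor N' \<phi>'] \<eta> \<zeta> \<xi> N'_eq \<phi>'_eq])
    then show ?thesis
      by (simp add: neutral_metric_def inner_L2_cong[OF cov_deriv_cong[OF mid] cov_deriv_cong[OF mid]]
          inner_L2_cong[OF bracket_cong[OF half] bracket_cong[OF half]])
  qed
  have nonzero: "\<not> (aeq A E (cov_deriv (\<gamma> (1/2)) \<zeta>) (\<lambda>p z. 0) \<and> aeq A E (bracket \<phi>h \<zeta>) (\<lambda>p z. 0))"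
  proof
    assume "aeq A E (cov_deriv (\<gamma> (1/2)) \<zeta>) (\<lambda>p z. 0) \<and> aeq A E (bracket \<phi>h \<zeta>) (\<lambda>p z. 0)"
    then have z: "aeq A E (cov_deriv (N 0) \<zeta>) (\<lambda>p z. 0)" "aeq A E (bracket (\<phi> 0) \<zeta>) (\<lambda>p z. 0)"
      using aeq_trans[OF cov_deriv_cong[OF mid]] aeq_trans[OF bracket_cong[OF half]] by blast+
    \<comment> \<open>Without the terms in \<zeta>, N' is the covariant derivative of \<eta> and
      \<phi>' the bracket of \<open>\<phi> 0\<close> with \<eta>; the coefficient 2t - 1 assembles
      them into the covariant derivative of \<eta> for the connection at time t.\<close>
    have "Y t \<in> orbit_tangent A E k (\<gamma> t)" if t: "t \<in> {0..1}" for t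
    proof -
      have "aeq A E (\<lambda>p z. N' p z + (2 * t - 1) *\<^sub>R \<phi>' p z) (cov_deriv (segment (N 0) (\<phi> 0) t) \<eta>)"
        unfolding aeq_def
      proof
        fix p assume p: "p \<in> patches A E"
        have "AE z\<in>region p in lebesgue. N' p z = cov_deriv (N 0) \<eta> p z + bracket (\<phi> 0) \<zeta> p z"
          "AE z\<in>region p in lebesgue. \<phi>' p z = cov_deriv (N 0) \<zeta> p z + bracket (\<phi> 0) \<eta> p z"
          "AE z\<in>region p in lebesgue. cov_deriv (N 0) \<zeta> p z = 0"
          "AE z\<in>region p in lebesgue. bracket (\<phi> 0) \<zeta> p z = 0"
          using N'_eq \<phi>'_eq z p unfolding aeq_def by blast+
        then show "AE z\<in>region p in lebesgue.
            N' p z + (2 * t - 1) *\<^sub>R \<phi>' p z = cov_deriv (segment (N 0) (\<phi> 0) t) \<eta> p z"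
        proof eventually_elim
          case (elim z)
          show ?case
          proof
            assume "z \<in> region p"
            then have "N' p z = cov_deriv (N 0) \<eta> p z" "\<phi>' p z = bracket (\<phi> 0) \<eta> p z" using elim by simp_all
            then show "N' p z + (2 * t - 1) *\<^sub>R \<phi>' p z = cov_deriv (segment (N 0) (\<phi> 0) t) \<eta> p z"
              by (simp add: cov_deriv_eq bracket_eq segment_def add_left scaleR_left)
          qed
        qed
      qed
      then have "aeq A E (Y t) (cov_deriv (\<gamma> t) \<eta>)"
        using aeq_trans[OF aeq_trans[OF Y_eq[OF t]] aeq_sym[OF ends[OF t]]] by blast
      then show ?thesis using \<eta> by (auto simp: orbit_tangent_def)
    qed
    then show False using nontriv by blast
  qed
  have "\<gamma> (1/2) \<in> connections A E k" by (rule connections_cong[OF mid hor0(1)])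
  moreover have "\<phi>h \<in> forms_u A E k" by (rule forms_u_cong[OF half hor0(2)])
  moreover have "(cov_deriv (\<gamma> (1/2)) \<zeta>, bracket \<phi>h \<zeta>) \<in> orbit_tangent_pair A E k (\<gamma> (1/2)) \<phi>h"
    using \<zeta> by (auto simp: orbit_tangent_pair_def)
  moreover have "\<forall>Z\<in>orbit_tangent_pair A E k (\<gamma> (1/2)) \<phi>h.
      neutral_metric A E (cov_deriv (\<gamma> (1/2)) \<zeta>, bracket \<phi>h \<zeta>) Z = 0"
    using orth by (auto simp: orbit_tangent_pair_def)
  ultimately have "(\<gamma> (1/2), \<phi>h) \<in> degeneracy_locus A E k"
    using nonzero unfolding degeneracy_locus_def by (auto intro!: bexI)
  then show ?thesis by (simp add: \<phi>h_def)
qed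

end
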